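(* Let $a,m\in\mathbb{R}$ and let $u$ be the solution of the damped stochastic Klein-Gordon equation $(\partial_{tt}-\partial_{xx}+a\partial_t+m^2)u=\dot W$ on $t>0$, $x\in\mathbb{R}$, with $u(0,x)=\partial_t u(0,x)=0$. For any fixed $t_0\ge 0$ and $x_0\in\mathbb{R}$, there exists a constant $0<K_1<\infty$ depending on $(t_0,x_0)$ such that $$\limsup_{h\to 0^+}\frac{|u(t_0+h,x_0+h)-u(t_0,x_0)|}{\sqrt{h\log\log(1/h)}}=K_1\quad\text{almost surely.}$$
   Context: $\dot W$ is Gaussian space-time white noise on $[0,\infty)\times\mathbb{R}$, defined on a complete probability space $(\Omega,\mathscr{F},\mathbb{P})$. The solution is the mild solution in the sense of Walsh, $$u(t,x)=\int_0^t\int_{-\infty}^\infty G(t-s,x-y)\,W(ds,dy),$$ a centered Gaussian random field, where $G$ is the fundamental solution of $\partial_{tt}-\partial_{xx}+a\partial_t+m^2$. Explicitly, the spatial Fourier transform $\hat G(t,\xi)=\int_{\mathbb{R}}G(t,x)e^{-ix\xi}dx$ is: $e^{-at/2}\,\frac{\sin(t\sqrt{\xi^2+m^2-a^2/4})}{\sqrt{\xi^2+m^2-a^2/4}}$ if $\xi^2>\frac{a^2}{4}-m^2$; $te^{-at/2}$ if $\xi^2=\frac{a^2}{4}-m^2$; and $e^{-at/2}\,\frac{\sinh(t\sqrt{a^2/4-m^2-\xi^2})}{\sqrt{a^2/4-m^2-\xi^2}}$ if $\xi^2<\frac{a^2}{4}-m^2$. The field $u$ is taken to be its version with almost surely continuous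 sample paths on $[0,\infty)\times\mathbb{R}$.
   Formalization: The formal theorem assumes t_0>0 instead of t_0≥0: at t_0=0 the variance of u(h,x_0+h) is of order h^2, so the limsup is 0 almost surely and no constant K_1>0 exists. *)

theory Defs
  imports "HOL-Probability.Probability"
begin

section \<open>Gaussian space-time white noise on the half plane\<close>

definition noise_sets :: "(real \<times> real) set set" where
  "noise_sets =
    {A. A \<in> sets borel \<and> A \<subseteq> {0..} \<times> UNIV \<and> emeasure lborel A < \<infinity>}"

text \<open>The degenerate law at \<open>0\<close> counts as centered Gaussian.\<close>

definition centered_gaussian :: "'w measure \<Rightarrow> ('w \<Rightarrow> real) \<Rightarrow> bool" where
  "centered_gaussian M X \<longleftrightarrow>
    X \<in> borel_measurable M \<and>
    ((AE \<omega> in M. X \<omega> = 0) \<or> (\<exists>\<sigma>>0. distributed M lborel X (normal_density 0 \<sigma>)))"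

text \<open>A centered Gaussian process indexed by the sets of finite Lebesgue measure, with
  covariance \<open>E[W(A) W(B)] = |A \<inter> B|\<close>.\<close>

definition white_noise :: "'w measure \<Rightarrow> ((real \<times> real) set \<Rightarrow> 'w \<Rightarrow> real) \<Rightarrow> bool" where
  "white_noise M W \<longleftrightarrow>
    (\<forall>S c. finite S \<longrightarrow> S \<subseteq> noise_sets \<longrightarrow>
        centered_gaussian M (\<lambda>\<omega>. \<Sum>A\<in>S. c A * W A \<omega>)) \<and>
    (\<forall>A\<in>noise_sets. \<forall>B\<in>noise_sets.
        (LINT \<omega>|M. W A \<omega> * W B \<omega>) = measure lborel (A \<inter> B))"

text \<open>The Walsh integral of a deterministic integrand \<open>f\<close>, vanishing for negative times: the
  \<open>L\<^sup>2(M)\<close>-limit of the integrals \<open>\<Sum>A. c A * W A\<close> of simple functions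
  \<open>\<Sum>A. c A * indicator A\<close> that converge to \<open>f\<close> in \<open>L\<^sup>2\<close>. By the isometry the limit does not
  depend on the approximating sequence; it is determined up to null events.\<close>

definition has_walsh_integral ::
  "'w measure \<Rightarrow> ((real \<times> real) set \<Rightarrow> 'w \<Rightarrow> real) \<Rightarrow> (real \<times> real \<Rightarrow> real) \<Rightarrow> ('w \<Rightarrow> real) \<Rightarrow> bool"
where
  "has_walsh_integral M W f X \<longleftrightarrow>
    f \<in> borel_measurable borel \<and> X \<in> borel_measurable M \<and>
    (\<exists>S c. (\<forall>n::nat. finite (S n) \<and> S n \<subseteq> noise_sets) \<and>
      (\<lambda>n. \<integral>\<^sup>+ p. ennreal ((f p - (\<Sum>A\<in>S n. c n A * indicator A p))\<^sup>2) \<partial>lborel) \<longlonglongrightarrow> 0 \<and>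
      (\<lambda>n. \<integral>\<^sup>+ \<omega>. ennreal ((X \<omega> - (\<Sum>A\<in>S n. c n A * W A \<omega>))\<^sup>2) \<partial>M) \<longlonglongrightarrow> 0)"


section \<open>The fundamental solution of the damped Klein-Gordon operator\<close>

text \<open>\<open>D i j\<close> is the partial derivative of order \<open>i\<close> in time and \<open>j\<close> in space of the compactly
  supported smooth function \<open>D 0 0\<close>.\<close>

definition test_function_partials :: "(nat \<Rightarrow> nat \<Rightarrow> real \<Rightarrow> real \<Rightarrow> real) \<Rightarrow> bool" where
  "test_function_partials D \<longleftrightarrow>
    (\<exists>R. \<forall>t x. \<bar>t\<bar> > R \<or> \<bar>x\<bar> > R \<longrightarrow> D 0 0 t x = 0) \<and>
    (\<forall>i j. continuous_on UNIV (\<lambda>(t, x). D i j t x)) \<and>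
    (\<forall>i j t x. ((\<lambda>s. D i j s x) has_real_derivative D (Suc i) j t x) (at t) \<and>
               ((\<lambda>y. D i j t y) has_real_derivative D i (Suc j) t x) (at x))"

definition klein_gordon_symbol :: "real \<Rightarrow> real \<Rightarrow> real \<Rightarrow> real \<Rightarrow> real" where
  "klein_gordon_symbol a m t \<xi> =
    (if \<xi>\<^sup>2 > a\<^sup>2 / 4 - m\<^sup>2 then
       exp (- a * t / 2) * (sin (t * sqrt (\<xi>\<^sup>2 + m\<^sup>2 - a\<^sup>2 / 4)) / sqrt (\<xi>\<^sup>2 + m\<^sup>2 - a\<^sup>2 / 4))
     else if \<xi>\<^sup>2 = a\<^sup>2 / 4 - m\<^sup>2 then
       t * exp (- a * t / 2)
     else
       exp (- a * t / 2) * (sinh (t * sqrt (a\<^sup>2 / 4 - m\<^sup>2 - \<xi>\<^sup>2)) / sqrt (a\<^sup>2 / 4 - m\<^sup>2 - \<xi>\<^sup>2)))"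

text \<open>\<open>G\<close> is a locally integrable function, carried by \<open>t \<ge> 0\<close>, that solves
  \<open>(\<partial>\<^sub>t\<^sub>t - \<partial>\<^sub>x\<^sub>x + a \<partial>\<^sub>t + m\<^sup>2) G = \<delta>\<close> in the sense of distributions: tested against
  \<open>\<phi> = D 0 0\<close>, the adjoint operator carries the sign \<open>- a \<partial>\<^sub>t\<close>. The equation determines \<open>G\<close> only
  almost everywhere in space-time; the Fourier transform selects each \<open>G t\<close> up to null sets.\<close>

definition klein_gordon_fundamental_solution ::
  "real \<Rightarrow> real \<Rightarrow> (real \<Rightarrow> real \<Rightarrow> real) \<Rightarrow> bool" where
  "klein_gordon_fundamental_solution a m G \<longleftrightarrow>
    (\<lambda>(t, x). G t x) \<in> borel_measurable borel \<and>
    (\<forall>t x. t < 0 \<longrightarrow> G t x = 0) \<and>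
    (\<forall>K. compact K \<longrightarrow> set_integrable lborel K (\<lambda>(t, x). G t x)) \<and>
    (\<forall>D. test_function_partials D \<longrightarrow>
      (LINT (t, x)|lborel. G t x * (D 2 0 t x - D 0 2 t x - a * D 1 0 t x + m\<^sup>2 * D 0 0 t x))
        = D 0 0 0 0) \<and>
    (\<forall>t\<ge>0. integrable lborel (G t) \<and>
      (\<forall>\<xi>. (LINT x|lborel. complex_of_real (G t x) * exp (- \<i> * complex_of_real (x * \<xi>)))
            = complex_of_real (klein_gordon_symbol a m t \<xi>)))"


section \<open>The mild solution with zero initial data\<close>

definition mild_solution ::
  "'w measure \<Rightarrow> ((real \<times> real) set \<Rightarrow> 'w \<Rightarrow> real) \<Rightarrow> (real \<Rightarrow> real \<Rightarrow> real) \<Rightarrow>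
   (real \<Rightarrow> real \<Rightarrow> 'w \<Rightarrow> real) \<Rightarrow> bool" where
  "mild_solution M W G u \<longleftrightarrow>
    (\<forall>t\<ge>0. \<forall>x. has_walsh_integral M W
       (\<lambda>(s, y). if 0 \<le> s \<and> s \<le> t then G (t - s) (x - y) else 0) (u t x))"

definition ae_continuous_paths :: "'w measure \<Rightarrow> (real \<Rightarrow> real \<Rightarrow> 'w \<Rightarrow> real) \<Rightarrow> bool" where
  "ae_continuous_paths M u \<longleftrightarrow>
    (AE \<omega> in M. continuous_on ({0..} \<times> UNIV) (\<lambda>(t, x). u t x \<omega>))"

end

theory Submission
  imports Defs "HOL-Real_Asymp.Real_Asymp"
begin

text \<open>The increment \<open>X h = u (t0 + h) (x0 + h) - u t0 x0\<close> runs along a characteristic of the wave operator.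
The backward light cone of \<open>(t0 + h, x0 + h)\<close> shares its left edge with the cone of
\<open>(t0, x0)\<close>; moving along the characteristic only adds a strip of width \<open>2 * h\<close> in the direction
\<open>y + s\<close>. On each cone the Green function is smooth, so \<open>X h\<close> is the white noise of the new strip,
weighted by a profile that is the same for all \<open>h\<close> up to \<open>O(h)\<close>, plus a contribution of size
\<open>O(h)\<close> in mean square from the change of the integrand on the old cone. The strips added over disjoint intervals
of \<open>h\<close> are disjoint. Hence \<open>X\<close> behaves like a Brownian motion with variance \<open>\<sigma>\<^sup>2 h\<close>, where
\<open>\<sigma>\<^sup>2\<close> is half the integral of \<open>exp (- a r)\<close> over \<open>0 \<le> r \<le> t0\<close>, and it obeys the law of the iterated
logarithm with the constant \<open>sqrt 2 * \<sigma>\<close>.\<close>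

text \<open>The probabilistic part is the locale \<open>near_brownian_increments\<close>, which asks for three things about
a Gaussian process \<open>X\<close>: variances of increments at most \<open>C (h - k)\<close>; standard deviations within
\<open>C h\<close> of \<open>\<sigma> sqrt (h - k)\<close>; covariances of increments over disjoint intervals at most \<open>C\<close> times the
product of the lengths. The upper bound \<open>lil_upper\<close> combines Gaussian tails along a geometric
sequence with ratio near 1 and dyadic chaining (\<open>gaussian_increments_maximal\<close>) inside each block.
The lower bound \<open>lil_lower\<close> uses increments along a geometric sequence with ratio near 0. They are
not independent, but their correlations decay geometrically, and this suffices:
\<open>nearly_uncorrelated_gaussian_lower\<close> replaces the events of the second Borel-Cantelli lemma by
Gaussian bumps. A bump is a superposition of characters (Fourier transform), so the covariance of two
bumps is controlled by the correlation alone, and Chebyshev's inequality shows that the sum of the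
bumps diverges almost surely.\<close>

text \<open>The analytic part has three steps. By \<open>walsh_integral_law\<close>, a Walsh integral is centered Gaussian with
variance the squared norm of the integrand, and the integral is linear in the integrand. By
\<open>fundamental_solution_eq_green\<close>, the Fourier transform forces the fundamental solution to be
\<open>exp (- a t / 2) / 2 * J (t\<^sup>2 - x\<^sup>2)\<close> for \<open>\<bar>x\<bar> \<le> t\<close> and zero outside, where \<open>J\<close> is the entire function
\<open>kg_profile\<close>, a Bessel function of order 0 in disguise. Finally \<open>light_kernel_estimates\<close> reads off the three
bounds from the geometry of the cones.\<close>

section \<open>Centered Gaussian laws\<close>

text \<open>The law is encoded by its characteristic function, so that a limit in \<open>L\<^sup>2\<close> stays in the class and
the degenerate case \<open>v = 0\<close> needs no separate treatment.\<close>

definition gaussian_law :: "'w measure \<Rightarrow> ('w \<Rightarrow> real) \<Rightarrow> real \<Rightarrow> bool" where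
  "gaussian_law M X v \<longleftrightarrow>
    X \<in> borel_measurable M \<and> 0 \<le> v \<and>
    (\<forall>s. (CLINT \<omega>|M. iexp (s * X \<omega>)) = complex_of_real (exp (- (v * s\<^sup>2 / 2))))"

lemma std_normal_scaled_char:
  assumes "0 \<le> v"
  shows "char (distr std_normal_distribution borel (\<lambda>x. sqrt v * x)) s
    = complex_of_real (exp (- (v * s\<^sup>2 / 2)))"
proof -
  have "char (distr std_normal_distribution borel (\<lambda>x. sqrt v * x)) s
      = char std_normal_distribution (s * sqrt v)"
    by (simp add: char_def integral_distr ac_simps)
  also have "\<dots> = complex_of_real (exp (- (v * s\<^sup>2 / 2)))"
    using assms by (simp add: char_std_normal_distribution power_mult_distrib mult.commute del: exp_of_real)
  finally show ?thesis .
qed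

text \<open>Uniqueness of characteristic functions; scaling by \<open>sqrt v\<close> covers \<open>v = 0\<close> too, where no density exists.\<close>

lemma (in prob_space) gaussian_law_distr:
  assumes "gaussian_law M X v"
  shows "distr M borel X = distr std_normal_distribution borel (\<lambda>x. sqrt v * x)"
proof (rule Levy_uniqueness)
  have X[measurable]: "X \<in> borel_measurable M" and v: "0 \<le> v"
    using assms by (auto simp: gaussian_law_def)
  interpret S: real_distribution std_normal_distribution by (rule real_dist_normal_dist)
  show "real_distribution (distr M borel X)" by simp
  show "real_distribution (distr std_normal_distribution borel (\<lambda>x. sqrt v * x))"
    by (rule S.real_distribution_distr) simp
  show "char (distr M borel X) = char (distr std_normal_distribution borel (\<lambda>x. sqrt v * x))"
  proof
    fix s
    have "char (distr M borel X) s = (CLINT \<omega>|M. iexp (s * X \<omega>))"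
      unfolding char_def by (subst integral_distr) auto
    then show "char (distr M borel X) s
        = char (distr std_normal_distribution borel (\<lambda>x. sqrt v * x)) s"
      using assms unfolding std_normal_scaled_char[OF v] gaussian_law_def by simp
  qed
qed

text \<open>Chernoff's bound in density form: for \<open>c \<le> x\<close> the standard density is at most \<open>exp (- c\<^sup>2 / 2)\<close> times
the normal density centered at \<open>c\<close>, and symmetrically on the other side.\<close>

lemma std_normal_tail:
  fixes c :: real
  assumes "0 \<le> c"
  shows "measure std_normal_distribution {x. c \<le> \<bar>x\<bar>} \<le> 2 * exp (- (c\<^sup>2 / 2))"
proof -
  have pw: "indicator {x. c \<le> \<bar>x\<bar>} x * std_normal_density x
      \<le> exp (- (c\<^sup>2 / 2)) * (normal_density c 1 x + normal_density (- c) 1 x)" for x :: real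
  proof -
    have *: "std_normal_density x \<le> exp (- (c\<^sup>2 / 2)) * normal_density d 1 x"
      if "d\<^sup>2 = c\<^sup>2" "c\<^sup>2 \<le> d * x" for d
    proof -
      have "- x\<^sup>2 / 2 \<le> - (c\<^sup>2 / 2) - (x - d)\<^sup>2 / 2"
        using that by (simp add: power2_diff field_simps)
      then have "exp (- x\<^sup>2 / 2) \<le> exp (- (c\<^sup>2 / 2)) * exp (- (x - d)\<^sup>2 / 2)"
        by (simp flip: exp_add)
      then show ?thesis
        by (simp add: normal_density_def divide_right_mono)
    qed
    consider "c \<le> x" | "c \<le> - x" | "\<bar>x\<bar> < c" by linarith
    then show ?thesis
    proof cases
      case 1
      have "std_normal_density x \<le> exp (- (c\<^sup>2 / 2)) * normal_density c 1 x"
        using 1 assms by (intro *) (auto simp: power2_eq_square mult_left_mono)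
      with 1 assms show ?thesis by (auto simp: indicator_def algebra_simps intro: order_trans)
    next
      case 2
      have "std_normal_density x \<le> exp (- (c\<^sup>2 / 2)) * normal_density (- c) 1 x"
        using mult_left_mono[OF 2 assms] by (intro *) (auto simp: power2_eq_square)
      with 2 assms show ?thesis by (auto simp: indicator_def algebra_simps intro: order_trans)
    next
      case 3 then show ?thesis by simp
    qed
  qed
  have "measure std_normal_distribution {x. c \<le> \<bar>x\<bar>}
      = (LINT x|std_normal_distribution. indicator {x. c \<le> \<bar>x\<bar>} x)"
    by simp
  also have "\<dots> = (LINT x|lborel. indicator {x. c \<le> \<bar>x\<bar>} x * std_normal_density x)"
    by (subst integral_density) (auto simp: mult.commute)
  also have "\<dots> \<le> (LINT x|lborel. exp (- (c\<^sup>2 / 2)) * (normal_density c 1 x + normal_density (- c) 1 x))"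
  proof (rule integral_mono)
    show "integrable lborel (\<lambda>x. indicator {x. c \<le> \<bar>x\<bar>} x * std_normal_density x)"
      using integrable_mult_indicator[of "{x. c \<le> \<bar>x\<bar>}" lborel std_normal_density] by simp
  qed (use pw in auto)
  also have "\<dots> = 2 * exp (- (c\<^sup>2 / 2))"
    by (subst integral_mult_right_zero, subst Bochner_Integration.integral_add) auto
  finally show ?thesis .
qed

lemma (in prob_space) gaussian_law_tail:
  assumes X: "gaussian_law M X v" and v: "v \<le> V" "0 < V" and l: "0 < l"
  shows "prob {\<omega> \<in> space M. l \<le> \<bar>X \<omega>\<bar>} \<le> 2 * exp (- (l\<^sup>2 / (2 * V)))"
proof -
  have [measurable]: "X \<in> borel_measurable M" and v0: "0 \<le> v"
    using X by (auto simp: gaussian_law_def)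
  interpret S: real_distribution std_normal_distribution by (rule real_dist_normal_dist)
  have "prob {\<omega> \<in> space M. l \<le> \<bar>X \<omega>\<bar>} = measure (distr M borel X) {x. l \<le> \<bar>x\<bar>}"
    by (subst measure_distr) (auto intro!: arg_cong[where f = prob])
  also have "\<dots> = measure std_normal_distribution {x. l \<le> \<bar>sqrt v * x\<bar>}"
    unfolding gaussian_law_distr[OF X] by (subst measure_distr) (auto simp: vimage_def)
  also have "\<dots> \<le> measure std_normal_distribution {x. l / sqrt V \<le> \<bar>x\<bar>}"
  proof (rule S.finite_measure_mono)
    show "{x. l \<le> \<bar>sqrt v * x\<bar>} \<subseteq> {x. l / sqrt V \<le> \<bar>x\<bar>}"
    proof safe
      fix x assume "l \<le> \<bar>sqrt v * x\<bar>"
      also have "\<dots> \<le> sqrt V * \<bar>x\<bar>"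
        using v v0 by (simp add: abs_mult mult_right_mono)
      finally show "l / sqrt V \<le> \<bar>x\<bar>" using v by (simp add: field_simps)
    qed
  qed simp
  also have "\<dots> \<le> 2 * exp (- ((l / sqrt V)\<^sup>2 / 2))"
    using l v by (intro std_normal_tail) simp
  also have "(l / sqrt V)\<^sup>2 / 2 = l\<^sup>2 / (2 * V)"
    using v by (simp add: power_divide)
  finally show ?thesis .
qed

section \<open>Nearly uncorrelated Gaussian sequences\<close>

lemma exp_neg_diff_le:
  fixes x y :: real
  assumes "0 \<le> x" "0 \<le> y"
  shows "\<bar>exp (- x) - exp (- y)\<bar> \<le> \<bar>x - y\<bar>"
proof -
  have *: "exp (- a) - exp (- b) \<le> b - a" "0 \<le> exp (- a) - exp (- b)" if "0 \<le> a" "a \<le> b" for a b :: real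
  proof -
    have "1 - exp (- (b - a)) \<le> b - a"
      using exp_ge_add_one_self[of "- (b - a)"] by linarith
    moreover have "exp (- a) - exp (- b) = exp (- a) * (1 - exp (- (b - a)))"
      by (simp add: algebra_simps flip: exp_add)
    moreover have "exp (- a) * (1 - exp (- (b - a))) \<le> 1 * (1 - exp (- (b - a)))"
      using that by (intro mult_right_mono) auto
    ultimately show "exp (- a) - exp (- b) \<le> b - a" by simp
    show "0 \<le> exp (- a) - exp (- b)" using that by simp
  qed
  show ?thesis using *[of x y] *[of y x] assms by (cases "x \<le> y") auto
qed

text \<open>The bump is the characteristic function of the standard normal law at \<open>sqrt 2 / \<epsilon> * (x - \<mu>)\<close>, hence
a mixture of characters \<open>iexp (r * x)\<close> over normally distributed frequencies \<open>r\<close>.\<close>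

lemma gaussian_bump_fourier:
  fixes \<mu> \<epsilon> x :: real
  assumes "0 < \<epsilon>"
  shows "complex_of_real (exp (- ((x - \<mu>)\<^sup>2 / \<epsilon>\<^sup>2)))
    = (CLINT s|std_normal_distribution. iexp (- (sqrt 2 / \<epsilon> * s * \<mu>)) * iexp (sqrt 2 / \<epsilon> * s * x))"
proof -
  have "complex_of_real (exp (- ((x - \<mu>)\<^sup>2 / \<epsilon>\<^sup>2))) = char std_normal_distribution (sqrt 2 / \<epsilon> * (x - \<mu>))"
    using assms by (simp add: char_std_normal_distribution power_mult_distrib power_divide del: exp_of_real of_real_exp)
  also have "\<dots> = (CLINT s|std_normal_distribution. iexp (- (sqrt 2 / \<epsilon> * s * \<mu>)) * iexp (sqrt 2 / \<epsilon> * s * x))"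
    unfolding char_def
    by (intro Bochner_Integration.integral_cong refl) (simp add: exp_add[symmetric] algebra_simps diff_divide_distrib)
  finally show ?thesis .
qed

lemma (in prob_space) expectation_bump_fourier:
  fixes \<xi> :: "'a \<Rightarrow> real" and Z :: "'a \<Rightarrow> complex"
  assumes \<epsilon>: "0 < \<epsilon>" and [measurable]: "\<xi> \<in> borel_measurable M" "Z \<in> borel_measurable M"
    and Z: "\<And>\<omega>. norm (Z \<omega>) \<le> 1"
  shows "(CLINT \<omega>|M. complex_of_real (exp (- ((\<xi> \<omega> - \<mu>)\<^sup>2 / \<epsilon>\<^sup>2))) * Z \<omega>)
    = (CLINT s|std_normal_distribution.
        iexp (- (sqrt 2 / \<epsilon> * s * \<mu>)) * (CLINT \<omega>|M. iexp (sqrt 2 / \<epsilon> * s * \<xi> \<omega>) * Z \<omega>))"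
proof -
  let ?G = "std_normal_distribution" and ?r = "sqrt 2 / \<epsilon>"
  let ?F = "\<lambda>s \<omega>. iexp (- (?r * s * \<mu>)) * iexp (?r * s * \<xi> \<omega>) * Z \<omega>"
  interpret S: real_distribution ?G by (rule real_dist_normal_dist)
  interpret P: pair_prob_space ?G M ..
  have meas: "case_prod ?F \<in> borel_measurable (?G \<Otimes>\<^sub>M M)"
    by (simp add: split_beta')
  have int: "integrable (?G \<Otimes>\<^sub>M M) (case_prod ?F)"
    by (rule P.P.integrable_const_bound[where B = 1])
       (use Z meas in \<open>auto simp: norm_mult\<close>)
  have "(CLINT \<omega>|M. complex_of_real (exp (- ((\<xi> \<omega> - \<mu>)\<^sup>2 / \<epsilon>\<^sup>2))) * Z \<omega>)
      = (CLINT \<omega>|M. CLINT s|?G. ?F s \<omega>)"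
    unfolding gaussian_bump_fourier[OF \<epsilon>]
    by (intro Bochner_Integration.integral_cong refl) (rule integral_mult_left_zero[symmetric])
  also have "\<dots> = (CLINT s|?G. CLINT \<omega>|M. ?F s \<omega>)"
    by (rule P.Fubini_integral[OF int])
  also have "\<dots> = (CLINT s|?G. iexp (- (?r * s * \<mu>)) * (CLINT \<omega>|M. iexp (?r * s * \<xi> \<omega>) * Z \<omega>))"
    by (simp add: mult.assoc)
  finally show ?thesis .
qed

lemma std_normal_abs_moment: "(LINT x|std_normal_distribution. \<bar>x\<bar>) \<le> 1"
  "integrable std_normal_distribution (\<lambda>x. \<bar>x\<bar>)"
proof -
  have "(LINT x|std_normal_distribution. \<bar>x\<bar>) = sqrt (2 / pi)"
    using std_normal_distribution_odd_moments_abs[of 0] by simp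
  also have "\<dots> \<le> 1" using pi_gt3 by simp
  finally show "(LINT x|std_normal_distribution. \<bar>x\<bar>) \<le> 1" .
  show "integrable std_normal_distribution (\<lambda>x. \<bar>x\<bar>)"
    using integrable_std_normal_distribution_moment[of 1] by (intro integrable_abs) simp
qed

text \<open>Only the linear combinations of \<open>\<xi>\<close> and \<open>\<eta>\<close> are known to be Gaussian. Writing both bumps as mixtures
of characters reduces the covariance to an average over two independent normal frequencies \<open>s\<close>, \<open>t\<close> of
the difference between \<open>exp (- r\<^sup>2 (s\<^sup>2 + 2 \<rho> s t + t\<^sup>2) / 2)\<close> and the same expression with \<open>\<rho> = 0\<close>. This
difference is at most \<open>r\<^sup>2 \<bar>\<rho> s t\<bar>\<close>.\<close>

lemma (in prob_space) bump_covariance_le: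
  fixes \<xi> \<eta> :: "'a \<Rightarrow> real"
  assumes \<epsilon>: "0 < \<epsilon>"
    and law: "\<And>s t. gaussian_law M (\<lambda>\<omega>. s * \<xi> \<omega> + t * \<eta> \<omega>) (s\<^sup>2 + 2 * \<rho> * s * t + t\<^sup>2)"
  shows "\<bar>expectation (\<lambda>\<omega>. exp (- ((\<xi> \<omega> - \<mu>)\<^sup>2 / \<epsilon>\<^sup>2)) * exp (- ((\<eta> \<omega> - \<nu>)\<^sup>2 / \<epsilon>\<^sup>2)))
    - expectation (\<lambda>\<omega>. exp (- ((\<xi> \<omega> - \<mu>)\<^sup>2 / \<epsilon>\<^sup>2))) * expectation (\<lambda>\<omega>. exp (- ((\<eta> \<omega> - \<nu>)\<^sup>2 / \<epsilon>\<^sup>2)))\<bar>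
    \<le> 2 / \<epsilon>\<^sup>2 * \<bar>\<rho>\<bar>"
proof -
  let ?G = "std_normal_distribution" 
  define r where "r = sqrt 2 / \<epsilon>"
  have r2: "r\<^sup>2 = 2 / \<epsilon>\<^sup>2" by (simp add: r_def power_divide)
  interpret S: real_distribution ?G by (rule real_dist_normal_dist)
  have [measurable]: "\<xi> \<in> borel_measurable M" "\<eta> \<in> borel_measurable M"
    using law[of 1 0] law[of 0 1] by (auto simp: gaussian_law_def)
  have nonneg: "0 \<le> s\<^sup>2 + 2 * \<rho> * s * t + t\<^sup>2" for s t
    using law[of s t] by (auto simp: gaussian_law_def)
  have ch: "(CLINT \<omega>|M. iexp (s * \<xi> \<omega>) * iexp (t * \<eta> \<omega>)) = complex_of_real (exp (- ((s\<^sup>2 + 2 * \<rho> * s * t + t\<^sup>2) / 2)))" for s t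
  proof -
    have "(CLINT \<omega>|M. iexp (1 * (s * \<xi> \<omega> + t * \<eta> \<omega>))) = complex_of_real (exp (- ((s\<^sup>2 + 2 * \<rho> * s * t + t\<^sup>2) * 1\<^sup>2 / 2)))"
      using law[of s t] unfolding gaussian_law_def by blast
    then show ?thesis by (simp add: exp_add[symmetric] algebra_simps)
  qed
  let ?b = "\<lambda>x \<mu>. complex_of_real (exp (- ((x - \<mu>)\<^sup>2 / \<epsilon>\<^sup>2)))"
  let ?q = "\<lambda>s t. complex_of_real (exp (- (r\<^sup>2 * (s\<^sup>2 + 2 * \<rho> * s * t + t\<^sup>2) / 2)))"
  let ?p = "\<lambda>s. complex_of_real (exp (- (r\<^sup>2 * s\<^sup>2 / 2)))"
  let ?e = "\<lambda>s \<mu>. iexp (- (r * s * \<mu>))"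
  have b1: "norm (?b x \<mu>) \<le> 1" for x \<mu> by (simp add: norm_of_real del: of_real_exp exp_of_real)
  have one: "(CLINT \<omega>|M. ?b (\<xi> \<omega>) \<mu> * 1) = (CLINT s|?G. ?e s \<mu> * ?p s)"
  proof -
    have "(CLINT \<omega>|M. iexp (r * s * \<xi> \<omega>) * 1) = ?p s" for s
      using ch[of "r * s" 0] by (simp add: power_mult_distrib)
    then show ?thesis
      by (subst expectation_bump_fourier[OF \<epsilon>]) (simp_all only: r_def[symmetric], auto)
  qed
  have two: "(CLINT \<omega>|M. ?b (\<eta> \<omega>) \<nu> * 1) = (CLINT s|?G. ?e s \<nu> * ?p s)"
  proof -
    have "(CLINT \<omega>|M. iexp (r * s * \<eta> \<omega>) * 1) = ?p s" for s
      using ch[of 0 "r * s"] by (simp add: power_mult_distrib)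
    then show ?thesis
      by (subst expectation_bump_fourier[OF \<epsilon>]) (simp_all only: r_def[symmetric], auto)
  qed
  have inner: "(CLINT \<omega>|M. iexp (r * s * \<xi> \<omega>) * ?b (\<eta> \<omega>) \<nu>) = (CLINT t|?G. ?e t \<nu> * ?q s t)" for s
  proof -
    have "(CLINT \<omega>|M. iexp (r * s * \<xi> \<omega>) * ?b (\<eta> \<omega>) \<nu>) = (CLINT \<omega>|M. ?b (\<eta> \<omega>) \<nu> * iexp (r * s * \<xi> \<omega>))"
      by (simp add: mult.commute)
    also have "\<dots> = (CLINT t|?G. ?e t \<nu> * (CLINT \<omega>|M. iexp (r * t * \<eta> \<omega>) * iexp (r * s * \<xi> \<omega>)))"
      unfolding r_def by (rule expectation_bump_fourier[OF \<epsilon>]) auto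
    also have "\<dots> = (CLINT t|?G. ?e t \<nu> * ?q s t)"
    proof (intro Bochner_Integration.integral_cong refl arg_cong2[where f = "(*)"])
      fix t
      have "(CLINT \<omega>|M. iexp (r * t * \<eta> \<omega>) * iexp (r * s * \<xi> \<omega>)) = (CLINT \<omega>|M. iexp (r * s * \<xi> \<omega>) * iexp (r * t * \<eta> \<omega>))"
        by (simp add: mult.commute)
      also have "\<dots> = ?q s t"
        unfolding ch by (simp add: power_mult_distrib algebra_simps power2_eq_square del: exp_of_real of_real_exp)
      finally show "(CLINT \<omega>|M. iexp (r * t * \<eta> \<omega>) * iexp (r * s * \<xi> \<omega>)) = ?q s t" .
    qed
    finally show ?thesis .
  qed
  have joint: "(CLINT \<omega>|M. ?b (\<xi> \<omega>) \<mu> * ?b (\<eta> \<omega>) \<nu>) = (CLINT s|?G. ?e s \<mu> * (CLINT t|?G. ?e t \<nu> * ?q s t))"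
    unfolding inner[symmetric] unfolding r_def
    by (rule expectation_bump_fourier[OF \<epsilon>]) (use b1 in auto)
  have prod: "(CLINT s|?G. ?e s \<mu> * ?p s) * (CLINT s|?G. ?e s \<nu> * ?p s)
     = (CLINT s|?G. ?e s \<mu> * (CLINT t|?G. ?e t \<nu> * (?p s * ?p t)))"
  proof -
    have "(CLINT t|?G. ?e t \<nu> * (?p s * ?p t)) = ?p s * (CLINT t|?G. ?e t \<nu> * ?p t)" for s
      by (subst integral_mult_right_zero[symmetric]) (simp add: ac_simps)
    then show ?thesis
      by (subst integral_mult_left_zero[symmetric]) (simp add: ac_simps)
  qed
  have normp: "norm (?p s) \<le> 1" for s
    by (simp add: norm_of_real del: of_real_exp exp_of_real)
  have normq: "norm (?q s t) \<le> 1" for s t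
    using nonneg[of s t] by (simp add: norm_of_real del: of_real_exp exp_of_real)
  have nrm: "norm (?e s \<mu>) = 1" for s \<mu>
    by (simp only: norm_exp_i_times)
  have normpp: "norm (?e t \<nu> * (?p s * ?p t)) \<le> 1" for s t
    unfolding norm_mult nrm using mult_le_one[OF normp norm_ge_zero normp] by simp
  have i1: "integrable ?G (\<lambda>t. ?e t \<nu> * ?q s t)" for s
    by (rule S.integrable_const_bound[where B = 1]) (use normq in \<open>auto simp only: norm_mult nrm, auto\<close>)
  have i2: "integrable ?G (\<lambda>t. ?e t \<nu> * (?p s * ?p t))" for s
    by (rule S.integrable_const_bound[where B = 1])
       (use normpp in \<open>auto simp del: norm_mult norm_exp_eq_Re of_real_exp exp_of_real\<close>)
  \<comment> \<open>\<open>J\<close> is the inner average for the joint law, \<open>K\<close> the one for independent variables.\<close>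
  define J where "J s = (CLINT t|?G. ?e t \<nu> * ?q s t)" for s
  define K where "K s = (CLINT t|?G. ?e t \<nu> * (?p s * ?p t))" for s
  have [measurable]: "J \<in> borel_measurable borel" "K \<in> borel_measurable borel"
    unfolding J_def K_def by measurable
  have JK: "norm (J s - K s) \<le> r\<^sup>2 * \<bar>\<rho>\<bar> * \<bar>s\<bar>" for s
  proof -
    have "norm (J s - K s) = norm (CLINT t|?G. ?e t \<nu> * ?q s t - ?e t \<nu> * (?p s * ?p t))"
      unfolding J_def K_def by (subst Bochner_Integration.integral_diff[OF i1 i2]) simp
    also have "\<dots> \<le> (LINT t|?G. norm (?e t \<nu> * ?q s t - ?e t \<nu> * (?p s * ?p t)))"
      by (rule integral_norm_bound)
    also have "\<dots> \<le> (LINT t|?G. r\<^sup>2 * \<bar>\<rho>\<bar> * \<bar>s\<bar> * \<bar>t\<bar>)"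
    proof (rule integral_mono)
      show "integrable ?G (\<lambda>t. norm (?e t \<nu> * ?q s t - ?e t \<nu> * (?p s * ?p t)))"
        using i1 i2 by (intro integrable_norm Bochner_Integration.integrable_diff)
      show "integrable ?G (\<lambda>t. r\<^sup>2 * \<bar>\<rho>\<bar> * \<bar>s\<bar> * \<bar>t\<bar>)"
        using std_normal_abs_moment by simp
      fix t
      have "norm (?e t \<nu> * ?q s t - ?e t \<nu> * (?p s * ?p t)) = norm (?q s t - ?p s * ?p t)"
        unfolding right_diff_distrib[symmetric] norm_mult nrm by simp
      also have "\<dots> = \<bar>exp (- (r\<^sup>2 * (s\<^sup>2 + 2 * \<rho> * s * t + t\<^sup>2) / 2)) - exp (- (r\<^sup>2 * s\<^sup>2 / 2 + r\<^sup>2 * t\<^sup>2 / 2))\<bar>"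
        unfolding of_real_mult[symmetric] of_real_diff[symmetric] norm_of_real real_norm_def
        by (simp flip: exp_add)
      also have "\<dots> \<le> \<bar>r\<^sup>2 * (s\<^sup>2 + 2 * \<rho> * s * t + t\<^sup>2) / 2 - (r\<^sup>2 * s\<^sup>2 / 2 + r\<^sup>2 * t\<^sup>2 / 2)\<bar>"
        by (rule exp_neg_diff_le) (use nonneg[of s t] in auto)
      also have "\<dots> = \<bar>r\<^sup>2 * (\<rho> * s * t)\<bar>"
        by (rule arg_cong[where f = abs]) (simp add: field_simps)
      also have "\<dots> = r\<^sup>2 * \<bar>\<rho>\<bar> * \<bar>s\<bar> * \<bar>t\<bar>" by (simp add: abs_mult)
      finally show "norm (?e t \<nu> * ?q s t - ?e t \<nu> * (?p s * ?p t)) \<le> r\<^sup>2 * \<bar>\<rho>\<bar> * \<bar>s\<bar> * \<bar>t\<bar>" .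
    qed
    also have "\<dots> = r\<^sup>2 * \<bar>\<rho>\<bar> * \<bar>s\<bar> * (LINT t|?G. \<bar>t\<bar>)" by (rule integral_mult_right_zero)
    also have "\<dots> \<le> r\<^sup>2 * \<bar>\<rho>\<bar> * \<bar>s\<bar> * 1"
      using std_normal_abs_moment by (intro mult_left_mono) auto
    finally show ?thesis by simp
  qed
  have JB: "norm (J s) \<le> 1" "norm (K s) \<le> 1" for s
  proof -
    have "norm (J s) \<le> (LINT t|?G. norm (?e t \<nu> * ?q s t))" unfolding J_def by (rule integral_norm_bound)
    also have "\<dots> \<le> (LINT t|?G. 1)"
      using i1 normq by (intro integral_mono integrable_norm) (auto simp only: norm_mult nrm, auto)
    finally show "norm (J s) \<le> 1" using S.prob_space by simp
    have "norm (K s) \<le> (LINT t|?G. norm (?e t \<nu> * (?p s * ?p t)))" unfolding K_def by (rule integral_norm_bound)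
    also have "\<dots> \<le> (LINT t|?G. 1)"
      using normpp by (intro integral_mono integrable_norm i2) auto
    finally show "norm (K s) \<le> 1" using S.prob_space by simp
  qed
  have i3: "integrable ?G (\<lambda>s. ?e s \<mu> * J s)" "integrable ?G (\<lambda>s. ?e s \<mu> * K s)"
    subgoal by (rule S.integrable_const_bound[where B = 1]) (use JB in \<open>auto simp only: norm_mult nrm, auto\<close>)
    subgoal by (rule S.integrable_const_bound[where B = 1]) (use JB in \<open>auto simp only: norm_mult nrm, auto\<close>)
    done
  have "norm ((CLINT s|?G. ?e s \<mu> * J s) - (CLINT s|?G. ?e s \<mu> * K s))
      \<le> (LINT s|?G. norm (?e s \<mu> * J s - ?e s \<mu> * K s))"
    by (subst Bochner_Integration.integral_diff[OF i3, symmetric]) (rule integral_norm_bound)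
  also have "\<dots> \<le> (LINT s|?G. r\<^sup>2 * \<bar>\<rho>\<bar> * \<bar>s\<bar>)"
  proof (rule integral_mono)
    show "integrable ?G (\<lambda>s. norm (?e s \<mu> * J s - ?e s \<mu> * K s))"
      using i3 by (intro integrable_norm Bochner_Integration.integrable_diff)
    show "integrable ?G (\<lambda>s. r\<^sup>2 * \<bar>\<rho>\<bar> * \<bar>s\<bar>)"
      using std_normal_abs_moment by simp
    show "norm (?e s \<mu> * J s - ?e s \<mu> * K s) \<le> r\<^sup>2 * \<bar>\<rho>\<bar> * \<bar>s\<bar>" for s
      unfolding right_diff_distrib[symmetric] norm_mult nrm using JK[of s] by simp
  qed
  also have "\<dots> = r\<^sup>2 * \<bar>\<rho>\<bar> * (LINT t|?G. \<bar>t\<bar>)" by (rule integral_mult_right_zero)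
  also have "\<dots> \<le> r\<^sup>2 * \<bar>\<rho>\<bar> * 1"
    using std_normal_abs_moment by (intro mult_left_mono) auto
  finally have main: "norm ((CLINT \<omega>|M. ?b (\<xi> \<omega>) \<mu> * ?b (\<eta> \<omega>) \<nu>) - (CLINT \<omega>|M. ?b (\<xi> \<omega>) \<mu>) * (CLINT \<omega>|M. ?b (\<eta> \<omega>) \<nu>)) \<le> r\<^sup>2 * \<bar>\<rho>\<bar>"
    using one two by (simp only: joint prod J_def K_def mult_1_right)
  show ?thesis
    using main unfolding of_real_mult[symmetric] integral_complex_of_real of_real_diff[symmetric] norm_of_real real_norm_def r2 .
qed

text \<open>A second Borel-Cantelli lemma for \<open>[0, 1]\<close>-valued variables in place of events. Since \<open>B\<^sup>2 \<le> B\<close>, the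
variance of a partial sum is at most its mean \<open>e N\<close> plus the bounded total \<open>R\<close> of the covariances, which is
negligible against \<open>(e N)\<^sup>2\<close>; Chebyshev's inequality then excludes every finite bound for the sum.\<close>

lemma (in prob_space) nearly_uncorrelated_sum_diverges:
  fixes B :: "nat \<Rightarrow> 'a \<Rightarrow> real"
  assumes meas[measurable]: "\<And>n. B n \<in> borel_measurable M"
    and B: "\<And>n \<omega>. 0 \<le> B n \<omega>" "\<And>n \<omega>. B n \<omega> \<le> 1"
    and cov: "\<And>n m. n < m \<Longrightarrow>
      expectation (\<lambda>\<omega>. B n \<omega> * B m \<omega>) - expectation (B n) * expectation (B m) \<le> D * q ^ n * q ^ m"
    and q: "0 \<le> q" "q < 1" and D: "0 \<le> D"
    and diverges: "\<not> summable (\<lambda>n. expectation (B n))"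
  shows "AE \<omega> in M. \<not> summable (\<lambda>n. B n \<omega>)"
proof -
  define e where "e N = (\<Sum>n<N. expectation (B n))" for N
  define R where "R = D * (1 / (1 - q))\<^sup>2"
  have int: "integrable M (B n)" for n
    by (rule integrable_const_bound[where B = 1]) (use B in auto)
  have int2: "integrable M (\<lambda>\<omega>. B n \<omega> * B m \<omega>)" for n m
    by (rule integrable_const_bound[where B = 1]) (use B in \<open>auto intro!: mult_le_one\<close>)
  have E0: "0 \<le> expectation (B n)" for n using B by (intro integral_nonneg_AE) auto
  have e_top: "filterlim e at_top sequentially"
  proof -
    have inc: "incseq e" unfolding e_def by (intro incseq_SucI) (simp add: E0)
    have "\<exists>N. Z < e N" for Z
    proof (rule ccontr)
      assume "\<not> (\<exists>N. Z < e N)"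
      then obtain L where "e \<longlonglongrightarrow> L"
        using incseq_convergent[OF inc, of Z] by (metis not_less)
      then show False
        using diverges unfolding e_def summable_iff_convergent convergent_def by blast
    qed
    then show ?thesis
      unfolding filterlim_at_top eventually_sequentially
      using inc by (meson incseqD less_imp_le order_trans)
  qed
  have cov': "expectation (\<lambda>\<omega>. B n \<omega> * B m \<omega>) - expectation (B n) * expectation (B m)
     \<le> (if n = m then expectation (B n) else 0) + D * q ^ n * q ^ m" for n m
  proof -
    consider "n < m" | "m < n" | "n = m" by linarith
    then show ?thesis
    proof cases
      case 1 then show ?thesis using cov[of n m] by simp
    next
      case 2 then show ?thesis using cov[of m n] by (simp add: mult.commute mult.left_commute)
    next
      case 3
      have "expectation (\<lambda>\<omega>. B n \<omega> * B n \<omega>) \<le> expectation (B n)"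
        by (intro integral_mono int int2 mult_left_le B)
      moreover have "0 \<le> D * q ^ n * q ^ n" using D q by simp
      moreover have "0 \<le> expectation (B n) * expectation (B n)" by simp
      ultimately have "expectation (\<lambda>\<omega>. B n \<omega> * B n \<omega>) - expectation (B n) * expectation (B n)
          \<le> expectation (B n) + D * q ^ n * q ^ n" by linarith
      then show ?thesis using 3 by simp
    qed
  qed
  have geo: "(\<Sum>n<N. q ^ n) \<le> 1 / (1 - q)" for N
    using sum_le_suminf[OF summable_geometric[of q], of "{..<N}"] suminf_geometric[of q] q by simp
  have var: "expectation (\<lambda>\<omega>. ((\<Sum>n<N. B n \<omega>) - e N)\<^sup>2) \<le> e N + R" for N
  proof -
    have "expectation (\<lambda>\<omega>. ((\<Sum>n<N. B n \<omega>) - e N)\<^sup>2)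
        = expectation (\<lambda>\<omega>. \<Sum>n<N. \<Sum>m<N. (B n \<omega> - expectation (B n)) * (B m \<omega> - expectation (B m)))"
      by (simp add: e_def sum_subtractf[symmetric] power2_eq_square sum_product)
    also have "\<dots> = (\<Sum>n<N. \<Sum>m<N. expectation (\<lambda>\<omega>. B n \<omega> * B m \<omega>) - expectation (B n) * expectation (B m))"
    proof -
      have eq: "(B n \<omega> - expectation (B n)) * (B m \<omega> - expectation (B m))
          = B n \<omega> * B m \<omega> - (expectation (B m) * B n \<omega> + expectation (B n) * B m \<omega>)
            + expectation (B n) * expectation (B m)" for n m \<omega>
        by (simp only: algebra_simps)
      have i: "integrable M (\<lambda>\<omega>. (B n \<omega> - expectation (B n)) * (B m \<omega> - expectation (B m)))" for n m
        unfolding eq by (intro Bochner_Integration.integrable_add Bochner_Integration.integrable_diff int2 integrable_mult_right int integrable_const)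
      have "expectation (\<lambda>\<omega>. (B n \<omega> - expectation (B n)) * (B m \<omega> - expectation (B m)))
          = expectation (\<lambda>\<omega>. B n \<omega> * B m \<omega>) - expectation (B n) * expectation (B m)" for n m
        unfolding eq by (simp add: int int2 prob_space)
      then show ?thesis
        by (simp add: Bochner_Integration.integral_sum i)
    qed
    also have "\<dots> \<le> (\<Sum>n<N. \<Sum>m<N. (if n = m then expectation (B n) else 0) + D * q ^ n * q ^ m)"
      by (intro sum_mono cov')
    also have "\<dots> = e N + D * (\<Sum>n<N. q ^ n)\<^sup>2"
      by (simp add: sum.distrib e_def power2_eq_square sum_product sum_distrib_left mult_ac)
    also have "\<dots> \<le> e N + R"
      unfolding R_def using geo[of N] q D by (intro add_left_mono mult_left_mono power_mono) (auto intro: sum_nonneg)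
    finally show ?thesis .
  qed
  have small: "prob {\<omega> \<in> space M. \<forall>N. (\<Sum>n<N. B n \<omega>) \<le> c} = 0" for c
  proof -
    let ?A = "{\<omega> \<in> space M. \<forall>N. (\<Sum>n<N. B n \<omega>) \<le> c}"
    have "prob ?A \<le> (e N + R) / (e N - c)\<^sup>2" if N: "c < e N" for N
    proof -
      let ?Y = "\<lambda>\<omega>. ((\<Sum>n<N. B n \<omega>) - e N)\<^sup>2"
      have S_le: "(\<Sum>n<N. B n \<omega>) \<le> real N" for \<omega>
        using sum_mono[of "{..<N}" "\<lambda>n. B n \<omega>" "\<lambda>_. 1"] B by simp
      have iY: "integrable M ?Y"
      proof (rule integrable_const_bound[where B = "(real N + \<bar>e N\<bar>)\<^sup>2"])
        have "norm (?Y \<omega>) \<le> (real N + \<bar>e N\<bar>)\<^sup>2" for \<omega>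
        proof -
          have "0 \<le> (\<Sum>n<N. B n \<omega>)" using B by (intro sum_nonneg)
          then have "\<bar>(\<Sum>n<N. B n \<omega>) - e N\<bar> \<le> real N + \<bar>e N\<bar>" using S_le[of \<omega>] by linarith
          then show ?thesis using power_mono[of "\<bar>(\<Sum>n<N. B n \<omega>) - e N\<bar>" _ 2] by simp
        qed
        then show "AE \<omega> in M. norm (?Y \<omega>) \<le> (real N + \<bar>e N\<bar>)\<^sup>2" by simp
      qed simp
      have "prob ?A \<le> prob {\<omega> \<in> space M. (e N - c)\<^sup>2 \<le> ?Y \<omega>}"
      proof (rule finite_measure_mono)
        show "?A \<subseteq> {\<omega> \<in> space M. (e N - c)\<^sup>2 \<le> ?Y \<omega>}"
        proof safe
          fix \<omega> assume "\<forall>N. (\<Sum>n<N. B n \<omega>) \<le> c"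
          then have "e N - c \<le> e N - (\<Sum>n<N. B n \<omega>)" by simp
          then have "(e N - c)\<^sup>2 \<le> (e N - (\<Sum>n<N. B n \<omega>))\<^sup>2" using N by (intro power_mono) auto
          then show "(e N - c)\<^sup>2 \<le> ?Y \<omega>" by (simp add: power2_commute)
        qed
      qed simp
      also have "\<dots> \<le> expectation ?Y / (e N - c)\<^sup>2"
        by (rule integral_Markov_inequality_measure[OF iY, where A = "{}"]) (use N in auto)
      also have "\<dots> \<le> (e N + R) / (e N - c)\<^sup>2" by (intro divide_right_mono var) simp
      finally show ?thesis .
    qed
    moreover have "eventually (\<lambda>N. c < e N) sequentially"
      using e_top by (simp add: filterlim_at_top_dense)
    ultimately have "eventually (\<lambda>N. prob ?A \<le> (e N + R) / (e N - c)\<^sup>2) sequentially"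
      by (auto elim: eventually_mono)
    moreover have "((\<lambda>x. (x + R) / (x - c)\<^sup>2) \<longlongrightarrow> 0) at_top" by real_asymp
    then have "(\<lambda>N. (e N + R) / (e N - c)\<^sup>2) \<longlonglongrightarrow> 0"
      by (rule filterlim_compose[OF _ e_top])
    ultimately have "prob ?A \<le> 0"
      by (intro tendsto_lowerbound[where F = sequentially]) auto
    then show ?thesis by (simp add: measure_le_0_iff)
  qed
  have "AE \<omega> in M. \<forall>j::nat. \<not> (\<forall>N. (\<Sum>n<N. B n \<omega>) \<le> real j)"
    unfolding AE_all_countable
  proof
    fix j :: nat
    show "AE \<omega> in M. \<not> (\<forall>N. (\<Sum>n<N. B n \<omega>) \<le> real j)"
      by (rule AE_I[of _ _ "{\<omega> \<in> space M. \<forall>N. (\<Sum>n<N. B n \<omega>) \<le> real j}"])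
         (use small[of "real j"] in \<open>auto simp: emeasure_eq_measure\<close>)
  qed
  then show ?thesis
  proof eventually_elim
    case (elim \<omega>)
    show ?case
    proof
      assume s: "summable (\<lambda>n. B n \<omega>)"
      obtain j :: nat where j: "suminf (\<lambda>n. B n \<omega>) \<le> real j" using real_arch_simple by blast
      have "(\<Sum>n<N. B n \<omega>) \<le> real j" for N
        using sum_le_suminf[OF s, of "{..<N}"] B j by auto
      with elim show False by blast
    qed
  qed
qed

text \<open>On the interval from \<open>\<mu> - 1\<close> to \<open>\<mu>\<close> the bump is at least \<open>exp (- 1 / \<epsilon>\<^sup>2)\<close> and the normal density is at least its
value at \<open>\<mu>\<close>.\<close>

lemma (in prob_space) bump_expectation_ge:
  assumes X: "gaussian_law M X 1" and \<epsilon>: "0 < \<epsilon>" and \<mu>: "1 \<le> \<mu>"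
  shows "exp (- (1 / \<epsilon>\<^sup>2)) * std_normal_density \<mu> \<le> expectation (\<lambda>\<omega>. exp (- ((X \<omega> - \<mu>)\<^sup>2 / \<epsilon>\<^sup>2)))"
proof -
  let ?b = "\<lambda>x. exp (- ((x - \<mu>)\<^sup>2 / \<epsilon>\<^sup>2))"
  have [measurable]: "X \<in> borel_measurable M" using X by (simp add: gaussian_law_def)
  interpret S: real_distribution std_normal_distribution by (rule real_dist_normal_dist)
  have "exp (- (1 / \<epsilon>\<^sup>2)) * std_normal_density \<mu>
      = (LINT x|lborel. exp (- (1 / \<epsilon>\<^sup>2)) * std_normal_density \<mu> * indicator {\<mu> - 1..\<mu>} x)"
    by simp
  also have "\<dots> \<le> (LINT x|lborel. std_normal_density x * ?b x)"
  proof (rule integral_mono)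
    have "integrable lborel (\<lambda>x. ?b x * std_normal_density x)"
      by (rule Bochner_Integration.integrable_bound[OF integrable_normal_density[of 1 0]])
         (auto simp: abs_mult intro!: mult_left_le_one_le)
    then show "integrable lborel (\<lambda>x. std_normal_density x * ?b x)" by (simp add: mult.commute)
    fix x
    show "exp (- (1 / \<epsilon>\<^sup>2)) * std_normal_density \<mu> * indicator {\<mu> - 1..\<mu>} x \<le> std_normal_density x * ?b x"
    proof (cases "x \<in> {\<mu> - 1..\<mu>}")
      case True
      then have "(x - \<mu>)\<^sup>2 \<le> 1" by (simp add: abs_square_le_1)
      then have "exp (- (1 / \<epsilon>\<^sup>2)) \<le> ?b x" using \<epsilon> by (simp add: divide_right_mono)
      moreover have "x\<^sup>2 \<le> \<mu>\<^sup>2" using True \<mu> by (intro power_mono) auto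
      then have "std_normal_density \<mu> \<le> std_normal_density x"
        by (simp add: std_normal_density_def divide_right_mono)
      ultimately have "exp (- (1 / \<epsilon>\<^sup>2)) * std_normal_density \<mu> \<le> ?b x * std_normal_density x"
        by (intro mult_mono) auto
      then show ?thesis using True by (simp add: mult.commute)
    qed simp
  qed simp
  also have "\<dots> = (LINT x|std_normal_distribution. ?b x)"
    by (subst integral_density) auto
  also have "\<dots> = (LINT x|distr M borel X. ?b x)"
    unfolding gaussian_law_distr[OF X] by (subst integral_distr) auto
  also have "\<dots> = expectation (\<lambda>\<omega>. ?b (X \<omega>))"
    by (subst integral_distr) auto
  finally show ?thesis .
qed

text \<open>Center the \<open>n\<close>-th bump at \<open>\<mu> n = (1 - \<epsilon>) sqrt (2 ln n)\<close>. Its mean is of order at least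
\<open>n powr - (1 - \<epsilon>)\<^sup>2\<close>, which is not summable, so the bumps have an almost surely divergent sum. If
\<open>\<xi> n\<close> stayed below the level \<open>(1 - 2 \<epsilon>) sqrt (2 ln n)\<close>, it would miss the center by at least
\<open>\<epsilon> sqrt (2 ln n)\<close>; with bumps of width \<open>\<epsilon>\<close> this bounds the \<open>n\<close>-th bump by \<open>n powr - 2\<close>, and the sum would converge.\<close>

lemma (in prob_space) nearly_uncorrelated_gaussian_lower:
  fixes \<xi> :: "nat \<Rightarrow> 'a \<Rightarrow> real"
  assumes law: "\<And>n m s t. n < m \<Longrightarrow>
      gaussian_law M (\<lambda>\<omega>. s * \<xi> n \<omega> + t * \<xi> m \<omega>) (s\<^sup>2 + 2 * \<rho> n m * s * t + t\<^sup>2)"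
    and \<rho>: "\<And>n m. n < m \<Longrightarrow> \<bar>\<rho> n m\<bar> \<le> D * q ^ n * q ^ m"
    and q: "0 \<le> q" "q < 1" and \<epsilon>: "0 < \<epsilon>" "\<epsilon> < 1"
  shows "AE \<omega> in M. frequently (\<lambda>n. (1 - 2 * \<epsilon>) * sqrt (2 * ln (real n)) < \<xi> n \<omega>) sequentially"
proof -
  define \<mu> where "\<mu> n = (1 - \<epsilon>) * sqrt (2 * ln (real n))" for n
  define B where "B n \<omega> = exp (- ((\<xi> n \<omega> - \<mu> n)\<^sup>2 / \<epsilon>\<^sup>2))" for n \<omega>
  have law1: "gaussian_law M (\<xi> n) 1" for n
    using law[of n "Suc n" 1 0] by simp
  then have [measurable]: "\<xi> n \<in> borel_measurable M" for n by (simp add: gaussian_law_def)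
  have D: "0 \<le> D * q ^ 0 * q ^ 1" using \<rho>[of 0 1] by linarith
  have cov: "expectation (\<lambda>\<omega>. B n \<omega> * B m \<omega>) - expectation (B n) * expectation (B m)
      \<le> 2 / \<epsilon>\<^sup>2 * \<bar>D\<bar> * q ^ n * q ^ m" if "n < m" for n m
  proof -
    have "expectation (\<lambda>\<omega>. B n \<omega> * B m \<omega>) - expectation (B n) * expectation (B m) \<le> 2 / \<epsilon>\<^sup>2 * \<bar>\<rho> n m\<bar>"
      using bump_covariance_le[OF \<epsilon>(1) law[OF that], of "\<mu> n" "\<mu> m"] unfolding B_def by linarith
    also have "\<dots> \<le> 2 / \<epsilon>\<^sup>2 * (\<bar>D\<bar> * q ^ n * q ^ m)"
    proof (intro mult_left_mono)
      have "D * q ^ n * q ^ m \<le> \<bar>D\<bar> * q ^ n * q ^ m" using q by (intro mult_right_mono) auto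
      then show "\<bar>\<rho> n m\<bar> \<le> \<bar>D\<bar> * q ^ n * q ^ m" using \<rho>[OF that] by linarith
    qed simp
    finally show ?thesis by (simp add: mult.assoc)
  qed
  have div: "\<not> summable (\<lambda>n. expectation (B n))"
  proof
    assume s: "summable (\<lambda>n. expectation (B n))"
    define c where "c = exp (- (1 / \<epsilon>\<^sup>2)) / sqrt (2 * pi)"
    have c: "0 < c" by (simp add: c_def)
    have "filterlim (\<lambda>n. (1 - \<epsilon>) * sqrt (2 * ln (real n))) at_top sequentially"
      using \<epsilon> by real_asymp
    then have "eventually (\<lambda>n. 1 \<le> \<mu> n) sequentially" unfolding \<mu>_def filterlim_at_top by blast
    then have "eventually (\<lambda>n. norm (real n powr - ((1 - \<epsilon>)\<^sup>2)) \<le> expectation (B n) / c) sequentially"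
      using eventually_ge_at_top[of 1]
    proof eventually_elim
      case (elim n)
      have "c * real n powr - ((1 - \<epsilon>)\<^sup>2) = exp (- (1 / \<epsilon>\<^sup>2)) * std_normal_density (\<mu> n)"
        using elim(2) by (simp add: c_def std_normal_density_def \<mu>_def power_mult_distrib powr_def)
      also have "\<dots> \<le> expectation (B n)"
        unfolding B_def by (rule bump_expectation_ge[OF law1 \<epsilon>(1) elim(1)])
      finally show ?case using c by (simp add: field_simps)
    qed
    then have "summable (\<lambda>n. real n powr - ((1 - \<epsilon>)\<^sup>2))"
      by (rule summable_comparison_test_ev) (intro summable_divide s)
    then have "1 < (1 - \<epsilon>)\<^sup>2" by (simp add: summable_real_powr_iff)
    moreover have "(1 - \<epsilon>)\<^sup>2 \<le> 1" using \<epsilon> by (intro power_le_one) auto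
    ultimately show False by simp
  qed
  have "AE \<omega> in M. \<not> summable (\<lambda>n. B n \<omega>)"
  proof (rule nearly_uncorrelated_sum_diverges[OF _ _ _ cov q _ div])
    show "B n \<in> borel_measurable M" for n unfolding B_def[abs_def] by measurable
  qed (auto simp: B_def)
  then show ?thesis
  proof eventually_elim
    case (elim \<omega>)
    show ?case
    proof (rule ccontr)
      assume "\<not> frequently (\<lambda>n. (1 - 2 * \<epsilon>) * sqrt (2 * ln (real n)) < \<xi> n \<omega>) sequentially"
      then have "eventually (\<lambda>n. \<xi> n \<omega> \<le> (1 - 2 * \<epsilon>) * sqrt (2 * ln (real n))) sequentially"
        by (simp add: frequently_def not_less)
      then have "eventually (\<lambda>n. norm (B n \<omega>) \<le> real n powr - 2) sequentially"
        using eventually_ge_at_top[of 1]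
      proof eventually_elim
        case (elim n)
        have "0 \<le> \<epsilon> * sqrt (2 * ln (real n))" using elim(2) \<epsilon> by simp
        moreover have "\<epsilon> * sqrt (2 * ln (real n)) \<le> \<mu> n - \<xi> n \<omega>"
          using elim(1) by (simp add: \<mu>_def algebra_simps)
        ultimately have "(\<epsilon> * sqrt (2 * ln (real n)))\<^sup>2 \<le> (\<mu> n - \<xi> n \<omega>)\<^sup>2"
          by (intro power_mono)
        then have "\<epsilon>\<^sup>2 * (2 * ln (real n)) \<le> (\<xi> n \<omega> - \<mu> n)\<^sup>2"
          using elim(2) by (simp add: power_mult_distrib power2_commute)
        then have "2 * ln (real n) \<le> (\<xi> n \<omega> - \<mu> n)\<^sup>2 / \<epsilon>\<^sup>2"
          using \<epsilon> by (simp add: field_simps)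
        then show ?case using elim(2) by (simp add: B_def powr_def)
      qed
      then have "summable (\<lambda>n. B n \<omega>)"
        by (rule summable_comparison_test_ev) (simp add: summable_real_powr_iff)
      with elim show False by simp
    qed
  qed
qed

lemma (in prob_space) gaussian_sequence_upper:
  assumes law: "\<And>n. gaussian_law M (Y n) (v n)"
    and v: "eventually (\<lambda>n. v n \<le> V n) sequentially" and V: "\<And>n. 0 < V n" and p: "1 < p"
  shows "AE \<omega> in M. eventually (\<lambda>n. \<bar>Y n \<omega>\<bar> \<le> sqrt (2 * p * V n * ln (real n))) sequentially"
proof -
  let ?l = "\<lambda>n. sqrt (2 * p * V n * ln (real n))"
  let ?A = "\<lambda>n. {\<omega> \<in> space M. ?l n \<le> \<bar>Y n \<omega>\<bar>}"
  have [measurable]: "Y n \<in> borel_measurable M" for n using law by (simp add: gaussian_law_def)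
  have "eventually (\<lambda>n. norm (prob (?A n)) \<le> 2 * real n powr - p) sequentially"
    using v eventually_ge_at_top[of 2]
  proof eventually_elim
    case (elim n)
    have "prob (?A n) \<le> 2 * exp (- ((?l n)\<^sup>2 / (2 * V n)))"
      using elim V[of n] p by (intro gaussian_law_tail[OF law]) auto
    also have "(?l n)\<^sup>2 / (2 * V n) = p * ln (real n)"
      using elim V[of n] p by (simp add: less_imp_le)
    finally show ?case using elim by (simp add: powr_def)
  qed
  then have "summable (\<lambda>n. prob (?A n))"
    by (rule summable_comparison_test_ev) (use p in \<open>auto simp: summable_real_powr_iff\<close>)
  then have "AE \<omega> in M. eventually (\<lambda>n. \<omega> \<in> space M - ?A n) sequentially"
    by (intro borel_cantelli_AE1) (auto simp: emeasure_eq_measure)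
  then show ?thesis
  proof eventually_elim
    case (elim \<omega>)
    then show ?case by eventually_elim auto
  qed
qed

section \<open>Chaining\<close>

text \<open>The dyadic approximations \<open>z k\<close> of \<open>x\<close> from below start at \<open>l\<close>, and consecutive ones are equal or neighbours
on the finer grid; the telescoping sum passes to the limit by continuity.\<close>

lemma dyadic_chaining:
  fixes f :: "real \<Rightarrow> real"
  assumes cont: "continuous_on {l..l + d} f" and d: "0 < d"
    and step: "\<And>k i. i < 2 ^ Suc k \<Longrightarrow>
      \<bar>f (l + d * real (Suc i) / 2 ^ Suc k) - f (l + d * real i / 2 ^ Suc k)\<bar> \<le> \<epsilon> k"
    and eps: "summable \<epsilon>" and x: "l \<le> x" "x < l + d"
  shows "\<bar>f x - f l\<bar> \<le> suminf \<epsilon>"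
proof -
  have \<epsilon>0: "0 \<le> \<epsilon> k" for k using step[of 0 k] by simp
  define y where "y = (x - l) / d"
  have y: "0 \<le> y" "y < 1" "x = l + d * y" using x d by (auto simp: y_def field_simps)
  define j where "j k = nat \<lfloor>2 ^ k * y\<rfloor>" for k
  define z where "z k = l + d * real (j k) / 2 ^ k" for k
  have jr: "real (j k) = of_int \<lfloor>2 ^ k * y\<rfloor>" for k using y by (simp add: j_def)
  have j_le: "real (j k) \<le> 2 ^ k * y" "2 ^ k * y < real (j k) + 1" for k
    unfolding jr by linarith+
  have j_less: "j k < 2 ^ k" for k
  proof -
    have "real (j k) \<le> 2 ^ k * y" by (rule j_le)
    also have "\<dots> < 2 ^ k" using y by simp
    finally show ?thesis by (metis of_nat_less_iff of_nat_numeral of_nat_power)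
  qed
  have z_close: "x - d / 2 ^ k \<le> z k" "z k \<le> x" for k
  proof -
    have "d * (2 ^ k * y - 1) / 2 ^ k \<le> d * real (j k) / 2 ^ k"
      using j_le(2)[of k] d by (intro divide_right_mono mult_left_mono) auto
    moreover have "d * (2 ^ k * y - 1) / 2 ^ k = d * y - d / 2 ^ k" by (simp add: field_simps)
    ultimately show "x - d / 2 ^ k \<le> z k" unfolding z_def y(3) by linarith
    have "d * real (j k) / 2 ^ k \<le> d * (2 ^ k * y) / 2 ^ k"
      using j_le(1)[of k] d by (intro divide_right_mono mult_left_mono) auto
    then show "z k \<le> x" unfolding z_def y(3) by simp
  qed
  have "l \<le> z k" for k using d by (simp add: z_def)
  then have z_in: "z k \<in> {l..l + d}" for k using z_close(2)[of k] x by auto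
  have zstep: "\<bar>f (z (Suc k)) - f (z k)\<bar> \<le> \<epsilon> k" for k
  proof -
    have "real (j (Suc k)) < 2 * real (j k) + 2" "2 * real (j k) < real (j (Suc k)) + 1"
      using j_le[of k] j_le[of "Suc k"] by auto
    then have "j (Suc k) = 2 * j k \<or> j (Suc k) = Suc (2 * j k)" by linarith
    moreover have "z k = l + d * real (2 * j k) / 2 ^ Suc k" by (simp add: z_def)
    moreover have "2 * j k < 2 ^ Suc k" using j_less[of k] by simp
    ultimately show ?thesis
      using step[of "2 * j k" k] \<epsilon>0[of k] unfolding z_def[of "Suc k"] by auto
  qed
  have "\<bar>f (z k) - f l\<bar> \<le> (\<Sum>i<k. \<epsilon> i)" for k
  proof (induction k)
    case 0
    have "j 0 = 0" using j_less[of 0] by simp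
    then show ?case by (simp add: z_def)
  next
    case (Suc k) then show ?case using zstep[of k] by simp
  qed
  moreover have "(\<Sum>i<k. \<epsilon> i) \<le> suminf \<epsilon>" for k
    by (rule sum_le_suminf[OF eps]) (use \<epsilon>0 in auto)
  ultimately have bound: "\<bar>f (z k) - f l\<bar> \<le> suminf \<epsilon>" for k by (meson order_trans)
  have "z \<longlonglongrightarrow> x"
  proof (rule tendsto_sandwich[of "\<lambda>k. x - d / 2 ^ k" _ _ "\<lambda>_. x"])
    show "(\<lambda>k. x - d / 2 ^ k) \<longlonglongrightarrow> x" by real_asymp
  qed (use z_close in auto)
  then have "(\<lambda>k. f (z k)) \<longlonglongrightarrow> f x"
    using continuous_on_tendsto_compose[OF cont, of z x sequentially] z_in x by auto
  then have "(\<lambda>k. \<bar>f (z k) - f l\<bar>) \<longlonglongrightarrow> \<bar>f x - f l\<bar>" by (intro tendsto_intros)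
  then show ?thesis by (rule tendsto_upperbound) (use bound in auto)
qed

definition chaining_const :: real where
  "chaining_const = (\<Sum>k. sqrt (real (Suc k) / 2 ^ Suc k))"

lemma summable_chaining: "summable (\<lambda>k. sqrt (real (Suc k) / 2 ^ Suc k))"
proof (rule summable_comparison_test_bigo)
  show "summable (\<lambda>k. norm ((3 / 4 :: real) ^ k))" by simp
  have "sqrt (real (Suc k) / 2 ^ Suc k) / (3 / 4) ^ k = sqrt (real (k + 1) / 2 * (8 / 9) ^ k)" for k
  proof -
    have "(3 / 4 :: real) ^ k = sqrt ((9 / 16) ^ k)"
      by (simp add: real_sqrt_power real_sqrt_divide)
    then show ?thesis
      by (simp add: real_sqrt_divide[symmetric] power_divide power_mult_distrib field_simps del: real_sqrt_divide)
         (simp add: power_mult_distrib[symmetric])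
  qed
  moreover have "(\<lambda>k. sqrt (real (k + 1) / 2 * (8 / 9) ^ k)) \<longlonglongrightarrow> 0" by real_asymp
  ultimately have "(\<lambda>k. sqrt (real (Suc k) / 2 ^ Suc k) / (3 / 4 :: real) ^ k) \<longlonglongrightarrow> 0" by simp
  then show "(\<lambda>k. sqrt (real (Suc k) / 2 ^ Suc k)) \<in> O(\<lambda>k. (3 / 4) ^ k)"
    by (intro landau_o.small_imp_big smalloI_tendsto) auto
qed

lemma chaining_const_nonneg: "0 \<le> chaining_const"
  unfolding chaining_const_def by (intro suminf_nonneg summable_chaining) simp

text \<open>On level \<open>k\<close> there are \<open>2 ^ Suc k\<close> increments of variance at most \<open>C * d / 2 ^ Suc k\<close>. Allowing each of them the
size \<open>u * sqrt d * sqrt (Suc k / 2 ^ Suc k)\<close> makes the thresholds summable and costs probability at most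
\<open>2 * q ^ Suc k\<close> per increment with \<open>q = exp (- u\<^sup>2 / (2 * C))\<close>, so that the levels form a geometric series of
ratio \<open>2 * q \<le> 1 / 2\<close>. The exceptional set is a countable union, hence measurable.\<close>

lemma (in prob_space) gaussian_increments_maximal:
  fixes X :: "real \<Rightarrow> 'a \<Rightarrow> real"
  assumes law: "\<And>x y. l \<le> x \<Longrightarrow> x \<le> y \<Longrightarrow> y \<le> l + d \<Longrightarrow>
      \<exists>v\<le>C * (y - x). gaussian_law M (\<lambda>\<omega>. X y \<omega> - X x \<omega>) v"
    and d: "0 < d" and C: "0 < C" and u: "0 < u" "4 * exp (- (u\<^sup>2 / (2 * C))) \<le> 1"
  shows "\<exists>E\<in>events. prob E \<le> 8 * exp (- (u\<^sup>2 / (2 * C))) \<and>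
    (\<forall>\<omega>\<in>space M - E. continuous_on {l..l + d} (\<lambda>x. X x \<omega>) \<longrightarrow>
      (\<forall>x\<in>{l..<l + d}. \<bar>X x \<omega> - X l \<omega>\<bar> \<le> u * sqrt d * chaining_const))"
proof -
  define q where "q = exp (- (u\<^sup>2 / (2 * C)))"
  have q: "0 < q" "4 * q \<le> 1" using u by (auto simp: q_def)
  define pt where "pt k i = l + d * real i / 2 ^ Suc k" for k i :: nat
  define \<epsilon> where "\<epsilon> k = u * sqrt d * sqrt (real (Suc k) / 2 ^ Suc k)" for k
  define A where "A k i = {\<omega> \<in> space M. \<epsilon> k \<le> \<bar>X (pt k (Suc i)) \<omega> - X (pt k i) \<omega>\<bar>}" for k i
  define E where "E = (\<Union>k. \<Union>i<2 ^ Suc k. A k i)"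
  have \<epsilon>_pos: "0 < \<epsilon> k" for k using u d by (simp add: \<epsilon>_def)
  have A: "A k i \<in> events \<and> prob (A k i) \<le> 2 * q ^ Suc k" if i: "i < 2 ^ Suc k" for k i
  proof -
    have pt: "l \<le> pt k i" "pt k i \<le> pt k (Suc i)" "pt k (Suc i) - pt k i = d / 2 ^ Suc k"
      using d by (auto simp: pt_def field_simps)
    have "real (Suc i) \<le> 2 ^ Suc k" using i by (metis Suc_leI of_nat_le_iff of_nat_numeral of_nat_power)
    then have "d * real (Suc i) \<le> d * 2 ^ Suc k" using d by (intro mult_left_mono) auto
    then have "d * real (Suc i) / 2 ^ Suc k \<le> d" by (simp add: divide_le_eq)
    then have "pt k (Suc i) \<le> l + d" by (simp add: pt_def)
    then obtain v where v: "v \<le> C * (d / 2 ^ Suc k)"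
      "gaussian_law M (\<lambda>\<omega>. X (pt k (Suc i)) \<omega> - X (pt k i) \<omega>) v"
      using law[OF pt(1,2)] pt(3) by metis
    then have [measurable]: "(\<lambda>\<omega>. X (pt k (Suc i)) \<omega> - X (pt k i) \<omega>) \<in> borel_measurable M"
      by (simp add: gaussian_law_def)
    have "prob (A k i) \<le> 2 * exp (- ((\<epsilon> k)\<^sup>2 / (2 * (C * (d / 2 ^ Suc k)))))"
      unfolding A_def using C d \<epsilon>_pos by (intro gaussian_law_tail[OF v(2,1)]) auto
    also have "(\<epsilon> k)\<^sup>2 / (2 * (C * (d / 2 ^ Suc k))) = real (Suc k) * (u\<^sup>2 / (2 * C))"
      using d C by (simp add: \<epsilon>_def power_mult_distrib field_simps)
    also have "exp (- (real (Suc k) * (u\<^sup>2 / (2 * C)))) = q ^ Suc k"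
      unfolding q_def by (subst exp_of_nat_mult[symmetric]) simp
    finally show ?thesis unfolding A_def by simp
  qed
  have E_meas: "E \<in> events" using A unfolding E_def by auto
  have level: "(\<Union>i<2 ^ Suc k. A k i) \<in> events \<and> prob (\<Union>i<2 ^ Suc k. A k i) \<le> 4 * q * (2 * q) ^ k" for k
  proof -
    have "prob (\<Union>i<2 ^ Suc k. A k i) \<le> (\<Sum>i<2 ^ Suc k. prob (A k i))"
      by (rule finite_measure_subadditive_finite) (use A in auto)
    also have "\<dots> \<le> (\<Sum>i<(2::nat) ^ Suc k. 2 * q ^ Suc k)" using A by (intro sum_mono) auto
    also have "\<dots> = 4 * q * (2 * q) ^ k" by (simp add: power_mult_distrib)
    finally show ?thesis using A by auto
  qed
  have geo: "summable (\<lambda>k. 4 * q * (2 * q) ^ k)"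
    using q by (intro summable_mult summable_geometric) auto
  have "prob E \<le> (\<Sum>k. prob (\<Union>i<2 ^ Suc k. A k i))"
    unfolding E_def
    by (rule finite_measure_subadditive_countably)
       (use level in \<open>auto intro!: summable_comparison_test'[OF geo, of 0]\<close>)
  also have "\<dots> \<le> (\<Sum>k. 4 * q * (2 * q) ^ k)"
    by (intro suminf_le geo summable_comparison_test'[OF geo, of 0]) (use level in auto)
  also have "\<dots> = 4 * q * (1 / (1 - 2 * q))"
    using q by (subst suminf_mult) (auto simp: suminf_geometric intro!: summable_geometric)
  also have "\<dots> \<le> 8 * q" using q by (simp add: field_simps)
  finally have "prob E \<le> 8 * q" .
  moreover have "\<bar>X x \<omega> - X l \<omega>\<bar> \<le> u * sqrt d * chaining_const"
    if \<omega>: "\<omega> \<in> space M - E" and cont: "continuous_on {l..l + d} (\<lambda>x. X x \<omega>)" and x: "x \<in> {l..<l + d}" for \<omega> x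
  proof -
    have "\<bar>X x \<omega> - X l \<omega>\<bar> \<le> suminf \<epsilon>"
    proof (rule dyadic_chaining[OF cont d])
      fix k i :: nat assume "i < 2 ^ Suc k"
      then have "\<omega> \<notin> A k i" using \<omega> by (auto simp: E_def)
      then show "\<bar>X (l + d * real (Suc i) / 2 ^ Suc k) \<omega> - X (l + d * real i / 2 ^ Suc k) \<omega>\<bar> \<le> \<epsilon> k"
        using \<omega> by (simp add: A_def pt_def)
    next
      show "summable \<epsilon>" unfolding \<epsilon>_def by (intro summable_mult summable_chaining)
    qed (use x in auto)
    also have "\<dots> = u * sqrt d * chaining_const"
      unfolding \<epsilon>_def chaining_const_def by (rule suminf_mult[OF summable_chaining])
    finally show ?thesis .
  qed
  ultimately show ?thesis
    using E_meas unfolding q_def by (intro bexI[of _ E]) auto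
qed

section \<open>The law of the iterated logarithm\<close>

lemma geometric_bracket:
  fixes \<theta> h :: real
  assumes \<theta>: "0 < \<theta>" "\<theta> < 1" and h: "0 < h" "h < \<theta> ^ N"
  obtains n where "N \<le> n" "\<theta> ^ Suc n \<le> h" "h < \<theta> ^ n"
proof -
  obtain m0 where m0: "\<theta> ^ m0 < h" using real_arch_pow_inv[OF h(1) \<theta>(2)] by blast
  define m where "m = (LEAST m. \<theta> ^ m \<le> h)"
  have m: "\<theta> ^ m \<le> h" unfolding m_def by (rule LeastI[of _ m0]) (use m0 in simp)
  have least: "h < \<theta> ^ k" if "k < m" for k
    using not_less_Least[of k "\<lambda>m. \<theta> ^ m \<le> h"] that unfolding m_def by simp
  have "N < m"
  proof (rule ccontr)
    assume "\<not> N < m"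
    then have "\<theta> ^ N \<le> \<theta> ^ m" using \<theta> by (intro power_decreasing) auto
    with m h show False by simp
  qed
  then obtain n where n: "m = Suc n" "N \<le> n" by (cases m) auto
  show thesis using that[of n] n m least[of n] by auto
qed

definition lil_gauge :: "real \<Rightarrow> real" where
  "lil_gauge h = sqrt (h * ln (ln (1 / h)))"

text \<open>\<open>c h1 h2 h3 h4\<close> is the covariance of \<open>X h1 - X h2\<close> and \<open>X h3 - X h4\<close>; the law of all linear combinations of
two increments is what joint normality amounts to for pairs.\<close>

locale near_brownian_increments = prob_space M for M :: "'w measure" +
  fixes X :: "real \<Rightarrow> 'w \<Rightarrow> real" and c :: "real \<Rightarrow> real \<Rightarrow> real \<Rightarrow> real \<Rightarrow> real" and \<sigma> C :: real
  assumes law: "\<And>h1 h2 h3 h4 s t. {h1, h2, h3, h4} \<subseteq> {0..1} \<Longrightarrow>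
      gaussian_law M (\<lambda>\<omega>. s * (X h1 \<omega> - X h2 \<omega>) + t * (X h3 \<omega> - X h4 \<omega>))
        (s\<^sup>2 * c h1 h2 h1 h2 + 2 * s * t * c h1 h2 h3 h4 + t\<^sup>2 * c h3 h4 h3 h4)"
    and paths: "AE \<omega> in M. continuous_on {0..1} (\<lambda>h. X h \<omega>)"
    and \<sigma>: "0 < \<sigma>" and C: "0 < C"
    and var_le: "\<And>h k. 0 \<le> k \<Longrightarrow> k \<le> h \<Longrightarrow> h \<le> 1 \<Longrightarrow> c h k h k \<le> C * (h - k)"
    and var_approx: "\<And>h k. 0 \<le> k \<Longrightarrow> k \<le> h \<Longrightarrow> h \<le> 1 \<Longrightarrow>
      \<bar>sqrt (c h k h k) - \<sigma> * sqrt (h - k)\<bar> \<le> C * h"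
    and cov_le: "\<And>h1 h2 h3 h4. 0 \<le> h4 \<Longrightarrow> h4 \<le> h3 \<Longrightarrow> h3 \<le> h2 \<Longrightarrow> h2 \<le> h1 \<Longrightarrow> h1 \<le> 1 \<Longrightarrow>
      \<bar>c h1 h2 h3 h4\<bar> \<le> C * (h1 - h2) * (h3 - h4)"
begin

lemma increment_law:
  assumes "h \<in> {0..1}" "k \<in> {0..1}"
  shows "gaussian_law M (\<lambda>\<omega>. X h \<omega> - X k \<omega>) (c h k h k)"
  using law[of h k h k 1 0] assms by simp

lemma var_nonneg:
  assumes "h \<in> {0..1}" "k \<in> {0..1}"
  shows "0 \<le> c h k h k"
  using increment_law[OF assms] by (simp add: gaussian_law_def)

lemma geometric_sequence_upper:
  assumes \<theta>: "0 < \<theta>" "\<theta> < 1" and p: "1 < p"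
  shows "AE \<omega> in M. eventually (\<lambda>n.
    \<bar>X (\<theta> ^ n) \<omega> - X 0 \<omega>\<bar> \<le> p * \<sigma> * sqrt (2 * \<theta> ^ n * ln (real n))) sequentially"
proof -
  have \<theta>n: "\<theta> ^ n \<in> {0..1}" for n using \<theta> by (auto intro: power_le_one)
  have "eventually (\<lambda>n. c (\<theta> ^ n) 0 (\<theta> ^ n) 0 \<le> p * \<sigma>\<^sup>2 * \<theta> ^ n) sequentially"
  proof -
    have "(\<lambda>n. C * sqrt (\<theta> ^ n)) \<longlonglongrightarrow> C * sqrt 0"
      using \<theta> by (intro tendsto_intros LIMSEQ_power_zero) auto
    moreover have "0 < (sqrt p - 1) * \<sigma>" using p \<sigma> by simp
    ultimately have "eventually (\<lambda>n. C * sqrt (\<theta> ^ n) < (sqrt p - 1) * \<sigma>) sequentially"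
      by (intro order_tendstoD(2)) auto
    then show ?thesis
    proof eventually_elim
      case (elim n)
      let ?h = "\<theta> ^ n"
      have "sqrt (c ?h 0 ?h 0) \<le> \<sigma> * sqrt ?h + C * ?h"
        using var_approx[of 0 ?h] \<theta>n[of n] by auto
      also have "C * ?h = C * sqrt ?h * sqrt ?h" using \<theta> by (simp add: power_mult_distrib)
      also have "\<dots> \<le> (sqrt p - 1) * \<sigma> * sqrt ?h"
        using elim \<theta> by (intro mult_right_mono) auto
      finally have *: "sqrt (c ?h 0 ?h 0) \<le> sqrt p * \<sigma> * sqrt ?h" by (simp add: algebra_simps)
      have "(sqrt (c ?h 0 ?h 0))\<^sup>2 \<le> (sqrt p * \<sigma> * sqrt ?h)\<^sup>2"
        using * var_nonneg[of ?h 0] \<theta>n[of n] by (intro power_mono) auto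
      then show ?case
        using var_nonneg[of ?h 0] \<theta>n[of n] p by (simp add: power_mult_distrib)
    qed
  qed
  then have "AE \<omega> in M. eventually (\<lambda>n. \<bar>X (\<theta> ^ n) \<omega> - X 0 \<omega>\<bar>
      \<le> sqrt (2 * p * (p * \<sigma>\<^sup>2 * \<theta> ^ n) * ln (real n))) sequentially"
    using p \<theta> \<sigma> increment_law[OF \<theta>n, of 0]
    by (intro gaussian_sequence_upper[where v = "\<lambda>n. c (\<theta> ^ n) 0 (\<theta> ^ n) 0"]) auto
  moreover have "sqrt (2 * p * (p * \<sigma>\<^sup>2 * \<theta> ^ n) * ln (real n)) = p * \<sigma> * sqrt (2 * \<theta> ^ n * ln (real n))" for n
  proof -
    have "2 * p * (p * \<sigma>\<^sup>2 * \<theta> ^ n) * ln (real n) = (p * \<sigma>)\<^sup>2 * (2 * \<theta> ^ n * ln (real n))"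
      by (simp add: power2_eq_square)
    then show ?thesis using p \<sigma> by (simp add: real_sqrt_mult)
  qed
  ultimately show ?thesis by simp
qed

text \<open>The choice \<open>u n = 2 sqrt (C ln n)\<close> turns the exceptional probability of the \<open>n\<close>-th block into \<open>8 / n\<^sup>2\<close>. The
oscillation carries the factor \<open>sqrt (1 - \<theta>)\<close>, so it is negligible against the gauge once \<open>\<theta>\<close> is near 1.\<close>

lemma geometric_block_oscillation:
  assumes \<theta>: "0 < \<theta>" "\<theta> < 1"
  shows "AE \<omega> in M. eventually (\<lambda>n. \<forall>x\<in>{\<theta> ^ Suc n..<\<theta> ^ n}.
    \<bar>X x \<omega> - X (\<theta> ^ Suc n) \<omega>\<bar> \<le> 2 * sqrt C * chaining_const * sqrt (ln (real n) * \<theta> ^ n * (1 - \<theta>))) sequentially"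
proof -
  define u where "u n = 2 * sqrt C * sqrt (ln (real n))" for n
  have d: "\<theta> ^ n - \<theta> ^ Suc n = \<theta> ^ n * (1 - \<theta>)" for n by (simp add: algebra_simps)
  have \<theta>n: "0 \<le> \<theta> ^ n" "\<theta> ^ n \<le> 1" for n using \<theta> by (auto intro: power_le_one)
  define good where "good n E \<longleftrightarrow> E \<in> events \<and> prob E \<le> 8 * real n powr - 2 \<and>
      (\<forall>\<omega>\<in>space M - E. continuous_on {\<theta> ^ Suc n..\<theta> ^ n} (\<lambda>x. X x \<omega>) \<longrightarrow>
        (\<forall>x\<in>{\<theta> ^ Suc n..<\<theta> ^ n}.
          \<bar>X x \<omega> - X (\<theta> ^ Suc n) \<omega>\<bar> \<le> u n * sqrt (\<theta> ^ n * (1 - \<theta>)) * chaining_const))"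
    for n :: nat and E
  have ex: "\<exists>E. good n E" if n: "2 \<le> n" for n
  proof -
    have un: "(u n)\<^sup>2 / (2 * C) = 2 * ln (real n)"
      using n C by (simp add: u_def power_mult_distrib)
    have exp_eq: "exp (- ((u n)\<^sup>2 / (2 * C))) = real n powr - 2"
      using n unfolding un by (simp add: powr_def)
    have le4: "4 * real n powr - 2 \<le> 1"
    proof -
      have "(2::real) powr 2 \<le> real n powr 2" using n by (intro powr_mono2) auto
      then show ?thesis using n by (simp add: powr_minus field_simps)
    qed
    have u_pos: "0 < u n" using n C by (simp add: u_def)
    have eq: "\<theta> ^ Suc n + \<theta> ^ n * (1 - \<theta>) = \<theta> ^ n" using d[of n] by linarith
    have inc: "\<exists>v\<le>C * (y - x). gaussian_law M (\<lambda>\<omega>. X y \<omega> - X x \<omega>) v"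
      if "\<theta> ^ Suc n \<le> x" "x \<le> y" "y \<le> \<theta> ^ Suc n + \<theta> ^ n * (1 - \<theta>)" for x y
    proof -
      have "0 \<le> x" using that(1) \<theta>n(1)[of "Suc n"] by linarith
      moreover have "y \<le> 1" using that(3) d[of n] \<theta>n(2)[of n] by linarith
      ultimately show ?thesis
        using that by (intro exI[of _ "c y x y x"] conjI var_le increment_law) auto
    qed
    have "\<exists>E\<in>events. prob E \<le> 8 * exp (- ((u n)\<^sup>2 / (2 * C))) \<and>
      (\<forall>\<omega>\<in>space M - E. continuous_on {\<theta> ^ Suc n..\<theta> ^ Suc n + \<theta> ^ n * (1 - \<theta>)} (\<lambda>x. X x \<omega>) \<longrightarrow>
        (\<forall>x\<in>{\<theta> ^ Suc n..<\<theta> ^ Suc n + \<theta> ^ n * (1 - \<theta>)}.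
          \<bar>X x \<omega> - X (\<theta> ^ Suc n) \<omega>\<bar> \<le> u n * sqrt (\<theta> ^ n * (1 - \<theta>)) * chaining_const))"
    proof (rule gaussian_increments_maximal)
      show "0 < \<theta> ^ n * (1 - \<theta>)" using \<theta> by simp
      show "4 * exp (- ((u n)\<^sup>2 / (2 * C))) \<le> 1" unfolding exp_eq by (rule le4)
    qed (fact inc C u_pos)+
    then show ?thesis unfolding good_def eq exp_eq Bex_def .
  qed
  then have "\<exists>E. \<forall>n. 2 \<le> n \<longrightarrow> good n (E n)" by (intro choice) auto
  then obtain E where E: "\<And>n. 2 \<le> n \<Longrightarrow> good n (E n)" by auto
  define F where "F n = (if 2 \<le> n then E n else {})" for n :: nat
  have F: "F n \<in> events" for n using E[of n] by (auto simp: F_def good_def)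
  have "summable (\<lambda>n. prob (F n))"
  proof (rule summable_comparison_test_ev)
    show "eventually (\<lambda>n. norm (prob (F n)) \<le> 8 * real n powr - 2) sequentially"
      using eventually_ge_at_top[of 2] by eventually_elim (use E in \<open>auto simp: F_def good_def\<close>)
    show "summable (\<lambda>n. 8 * real n powr - 2)" by (intro summable_mult) (simp add: summable_real_powr_iff)
  qed
  then have "AE \<omega> in M. eventually (\<lambda>n. \<omega> \<in> space M - F n) sequentially"
    by (intro borel_cantelli_AE1 F) (auto simp: emeasure_eq_measure)
  with paths show ?thesis
  proof eventually_elim
    case (elim \<omega>)
    show ?case using elim(2) eventually_ge_at_top[of 2]
    proof eventually_elim
      case (elim n)
      have "continuous_on {\<theta> ^ Suc n..\<theta> ^ n} (\<lambda>x. X x \<omega>)"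
        by (rule continuous_on_subset[OF \<open>continuous_on {0..1} (\<lambda>h. X h \<omega>)\<close>])
           (use \<theta>n(1)[of "Suc n"] \<theta>n(2)[of n] in auto)
      moreover have "u n * sqrt (\<theta> ^ n * (1 - \<theta>)) * chaining_const
          = 2 * sqrt C * chaining_const * sqrt (ln (real n) * \<theta> ^ n * (1 - \<theta>))"
        by (simp add: u_def real_sqrt_mult)
      moreover have "good n (F n)" using E[of n] elim(2) by (simp add: F_def)
      ultimately show ?case using elim(1) unfolding good_def by metis
    qed
  qed
qed

lemma lil_upper:
  assumes \<eta>: "0 < \<eta>"
  shows "AE \<omega> in M. eventually (\<lambda>h. \<bar>X h \<omega> - X 0 \<omega>\<bar> / lil_gauge h \<le> sqrt 2 * \<sigma> + \<eta>) (at_right 0)"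
proof -
  \<comment> \<open>With \<open>\<theta> = 1 / (1 + \<delta>\<^sup>2)\<close> one has \<open>1 - \<theta> = \<theta> * \<delta>\<^sup>2\<close>: relative to \<open>sqrt (\<theta> ^ Suc n)\<close>
    the oscillation on a block costs \<open>S * \<delta>\<close>, and \<open>p\<close> absorbs the slack of the Gaussian tail.\<close>
  define S where "S = 2 * sqrt C * chaining_const"
  define \<delta> where "\<delta> = \<eta> / (4 * (S + 1))"
  define \<theta> where "\<theta> = 1 / (1 + \<delta>\<^sup>2)"
  define p where "p = 1 + \<eta> / (4 * (sqrt 2 * \<sigma>))"
  have S: "0 \<le> S" using C chaining_const_nonneg by (simp add: S_def)
  have \<delta>: "0 < \<delta>" using \<eta> S by (simp add: \<delta>_def)
  have \<theta>: "0 < \<theta>" "\<theta> < 1" using \<delta> by (simp_all add: \<theta>_def add_pos_pos)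
  have p: "1 < p" using \<eta> \<sigma> by (simp add: p_def)
  define b where "b = sqrt 2 * p * \<sigma> + S * \<delta>"
  have b: "b < sqrt 2 * \<sigma> + \<eta>" "0 \<le> b"
  proof -
    have "S * \<delta> \<le> \<eta> / 4"
      using S \<eta> by (simp add: \<delta>_def field_simps)
    moreover have "sqrt 2 * p * \<sigma> = sqrt 2 * \<sigma> + \<eta> / 4"
      using \<sigma> by (simp add: p_def field_simps)
    ultimately show "b < sqrt 2 * \<sigma> + \<eta>" unfolding b_def using \<eta> by linarith
    show "0 \<le> b" unfolding b_def using S \<delta> \<sigma> p by simp
  qed
  define L where "L = ln (1 / \<theta>)"
  have L: "0 < L" using \<theta> by (simp add: L_def)
  have "(\<lambda>n. b * sqrt (ln (real (Suc n)) / ln (real n * L))) \<longlonglongrightarrow> b"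
    using L by real_asymp
  then have ev: "eventually (\<lambda>n. b * sqrt (ln (real (Suc n)) / ln (real n * L)) < sqrt 2 * \<sigma> + \<eta>) sequentially"
    using b(1) by (rule order_tendstoD(2))
  have "filterlim (\<lambda>n. real n * L) at_top sequentially" using L by real_asymp
  then have evL: "eventually (\<lambda>n. 1 < real n * L) sequentially" by (simp add: filterlim_at_top_dense)
  have "AE \<omega> in M. eventually (\<lambda>n. \<bar>X (\<theta> ^ Suc n) \<omega> - X 0 \<omega>\<bar>
      \<le> p * \<sigma> * sqrt (2 * \<theta> ^ Suc n * ln (real (Suc n)))) sequentially"
    using geometric_sequence_upper[OF \<theta> p]
  proof eventually_elim
    case (elim \<omega>)
    then show ?case
      using eventually_sequentially_Suc[of "\<lambda>n. \<bar>X (\<theta> ^ n) \<omega> - X 0 \<omega>\<bar> \<le> p * \<sigma> * sqrt (2 * \<theta> ^ n * ln (real n))"] by simp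
  qed
  with geometric_block_oscillation[OF \<theta>] show ?thesis
  proof eventually_elim
    case (elim \<omega>)
    from elim(1,2) ev evL eventually_ge_at_top[of 1]
    have "eventually (\<lambda>n. \<forall>x\<in>{\<theta> ^ Suc n..<\<theta> ^ n}. \<bar>X x \<omega> - X 0 \<omega>\<bar> / lil_gauge x \<le> sqrt 2 * \<sigma> + \<eta>) sequentially"
    proof eventually_elim
      case (elim n)
      show ?case
      proof
        fix x assume x: "x \<in> {\<theta> ^ Suc n..<\<theta> ^ n}"
        have lnn: "0 \<le> ln (real n)" "ln (real n) \<le> ln (real (Suc n))" using elim(5) by auto
        have r: "\<theta> ^ n * (1 - \<theta>) = \<theta> ^ Suc n * \<delta>\<^sup>2"
        proof -
          have "0 < 1 + \<delta>\<^sup>2" by (simp add: add_pos_nonneg)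
          then have "\<theta> * (1 + \<delta>\<^sup>2) = 1" by (simp add: \<theta>_def)
          then have "1 - \<theta> = \<theta> * \<delta>\<^sup>2" by (simp add: distrib_left)
          then show ?thesis by simp
        qed
        have "\<bar>X x \<omega> - X (\<theta> ^ Suc n) \<omega>\<bar> \<le> S * sqrt (ln (real n) * \<theta> ^ n * (1 - \<theta>))"
          using elim(1) x unfolding S_def by blast
        also have "ln (real n) * \<theta> ^ n * (1 - \<theta>) = ln (real n) * \<theta> ^ Suc n * \<delta>\<^sup>2"
          using r by (simp add: mult.assoc)
        also have "S * sqrt \<dots> \<le> S * sqrt (ln (real (Suc n)) * \<theta> ^ Suc n * \<delta>\<^sup>2)"
          using S \<theta> lnn by (intro mult_left_mono real_sqrt_le_mono mult_right_mono) auto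
        also have "\<dots> = S * \<delta> * (sqrt (\<theta> ^ Suc n) * sqrt (ln (real (Suc n))))"
          using \<delta> by (simp add: real_sqrt_mult)
        finally have 1: "\<bar>X x \<omega> - X (\<theta> ^ Suc n) \<omega>\<bar> \<le> S * \<delta> * (sqrt (\<theta> ^ Suc n) * sqrt (ln (real (Suc n))))" .
        have "p * \<sigma> * sqrt (2 * \<theta> ^ Suc n * ln (real (Suc n)))
            = sqrt 2 * p * \<sigma> * (sqrt (\<theta> ^ Suc n) * sqrt (ln (real (Suc n))))"
          by (simp only: real_sqrt_mult mult_ac)
        with 1 elim(2) have num: "\<bar>X x \<omega> - X 0 \<omega>\<bar> \<le> b * (sqrt (\<theta> ^ Suc n) * sqrt (ln (real (Suc n))))"
          unfolding b_def distrib_right by linarith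
        have x0: "0 < x" using x \<theta> by (auto intro: less_le_trans[of 0 "\<theta> ^ Suc n"])
        have "real n * L = ln (1 / \<theta> ^ n)" using \<theta> by (simp add: L_def ln_div ln_realpow)
        also have "\<dots> \<le> ln (1 / x)" using x x0 \<theta> by (intro ln_mono) (auto simp: field_simps)
        finally have lnx: "real n * L \<le> ln (1 / x)" .
        have lnL: "0 < ln (real n * L)" using elim(4) by simp
        have g: "sqrt (\<theta> ^ Suc n) * sqrt (ln (real n * L)) \<le> lil_gauge x"
          unfolding lil_gauge_def real_sqrt_mult[symmetric]
          using x \<theta> lnx lnL elim(4) x0 by (intro real_sqrt_le_mono mult_mono ln_mono) auto
        have "\<bar>X x \<omega> - X 0 \<omega>\<bar> / lil_gauge x
            \<le> b * (sqrt (\<theta> ^ Suc n) * sqrt (ln (real (Suc n)))) / (sqrt (\<theta> ^ Suc n) * sqrt (ln (real n * L)))"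
          using g num lnL \<theta> b by (intro frac_le mult_nonneg_nonneg) auto
        also have "\<dots> = b * sqrt (ln (real (Suc n)) / ln (real n * L))"
          using \<theta> by (simp add: real_sqrt_divide)
        finally show "\<bar>X x \<omega> - X 0 \<omega>\<bar> / lil_gauge x \<le> sqrt 2 * \<sigma> + \<eta>"
          using elim(3) by linarith
      qed
    qed
    then obtain N where N: "\<And>n x. N \<le> n \<Longrightarrow> x \<in> {\<theta> ^ Suc n..<\<theta> ^ n} \<Longrightarrow>
        \<bar>X x \<omega> - X 0 \<omega>\<bar> / lil_gauge x \<le> sqrt 2 * \<sigma> + \<eta>"
      unfolding eventually_sequentially by blast
    show ?case
      unfolding eventually_at_right_field
    proof (intro exI[of _ "\<theta> ^ N"] conjI allI impI)
      show "0 < \<theta> ^ N" using \<theta> by simp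
      fix h assume h: "0 < h" "h < \<theta> ^ N"
      obtain n where "N \<le> n" "\<theta> ^ Suc n \<le> h" "h < \<theta> ^ n"
        using geometric_bracket[OF \<theta> h] .
      then show "\<bar>X h \<omega> - X 0 \<omega>\<bar> / lil_gauge h \<le> sqrt 2 * \<sigma> + \<eta>"
        using N[of n h] by simp
    qed
  qed
qed

text \<open>Let \<open>\<theta>\<close> be small. The normalised increments from \<open>\<theta> ^ Suc n\<close> to \<open>\<theta> ^ n\<close> have correlations of order
\<open>sqrt (\<theta> ^ n * \<theta> ^ m)\<close>, since the covariance bound carries both lengths and each standard deviation only a square
root. So they exceed \<open>(1 - 2 \<delta>) sqrt (2 ln n)\<close> infinitely often, while the remaining part \<open>X (\<theta> ^ Suc n) - X 0\<close> is smaller by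
a factor of order \<open>sqrt \<theta>\<close> by the upper bound.\<close>

lemma lil_lower:
  assumes \<eta>: "0 < \<eta>"
  shows "AE \<omega> in M. frequently (\<lambda>h. sqrt 2 * \<sigma> - \<eta> \<le> \<bar>X h \<omega> - X 0 \<omega>\<bar> / lil_gauge h) (at_right 0)"
proof -
  \<comment> \<open>The factors of \<open>?A\<close> are the losses from the bumps, from the comparison of standard deviations and
    from the length \<open>\<theta> ^ n * (1 - \<theta>)\<close> of the increments; the term \<open>2 * \<delta>\<close> bounds the remaining part. Taking \<open>\<theta> = \<delta>\<^sup>2\<close> makes
    \<open>sqrt (\<theta> ^ n)\<close> a power of \<open>\<delta>\<close>.\<close>
  let ?A = "\<lambda>\<delta>. (1 - 2 * \<delta>) * ((1 - \<delta>) * sqrt (1 - \<delta>\<^sup>2))"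
  have "((\<lambda>\<delta>. sqrt 2 * \<sigma> * (?A \<delta> - 2 * \<delta>)) \<longlongrightarrow> sqrt 2 * \<sigma>) (at_right 0)"
    by (auto intro!: tendsto_eq_intros)
  then have "eventually (\<lambda>\<delta>. sqrt 2 * \<sigma> - \<eta> < sqrt 2 * \<sigma> * (?A \<delta> - 2 * \<delta>)) (at_right 0)"
    using \<eta> by (intro order_tendstoD(1)) auto
  moreover have "eventually (\<lambda>\<delta>::real. 0 < \<delta> \<and> \<delta> < 1 / 2) (at_right 0)"
    unfolding eventually_at_right_field by (intro exI[of _ "1 / 2"]) auto
  ultimately have "eventually (\<lambda>\<delta>. sqrt 2 * \<sigma> - \<eta> < sqrt 2 * \<sigma> * (?A \<delta> - 2 * \<delta>) \<and> 0 < \<delta> \<and> \<delta> < 1 / 2) (at_right 0)"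
    by eventually_elim auto
  then obtain \<delta> where \<delta>_lim: "sqrt 2 * \<sigma> - \<eta> < sqrt 2 * \<sigma> * (?A \<delta> - 2 * \<delta>)" and \<delta>: "0 < \<delta>" "\<delta> < 1 / 2"
    using eventually_happens'[OF trivial_limit_at_right_real] by blast
  define \<theta> where "\<theta> = \<delta>\<^sup>2"
  have \<theta>: "0 < \<theta>" "\<theta> < 1" using \<delta> by (auto simp: \<theta>_def power_less_one_iff)
  have \<theta>n: "\<theta> ^ n \<in> {0..1}" for n using \<theta> by (auto intro: power_le_one)
  have sqrt_\<theta>: "sqrt (\<theta> ^ n) = \<delta> ^ n" for n
    using \<delta> by (simp add: \<theta>_def real_sqrt_power)
  have \<theta>_sq: "\<theta> ^ n = \<delta> ^ n * \<delta> ^ n" for n by (simp add: \<theta>_def power2_eq_square power_mult_distrib)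
  have dec: "\<theta> ^ m \<le> \<theta> ^ n" if "n \<le> m" for n m
    using that \<theta> by (intro power_decreasing) auto
  define v where "v n = c (\<theta> ^ n) (\<theta> ^ Suc n) (\<theta> ^ n) (\<theta> ^ Suc n)" for n
  define \<kappa> where "\<kappa> = (1 - \<delta>) * (\<sigma> * sqrt (1 - \<theta>))"
  have \<kappa>: "0 < \<kappa>" using \<delta> \<sigma> \<theta> by (simp add: \<kappa>_def)
  have "(\<lambda>n. C * \<delta> ^ n) \<longlonglongrightarrow> C * 0"
    using \<delta> by (intro tendsto_intros LIMSEQ_power_zero) auto
  moreover have "0 < \<delta> * (\<sigma> * sqrt (1 - \<theta>))" using \<delta> \<sigma> \<theta> by simp
  ultimately have "eventually (\<lambda>n. C * \<delta> ^ n < \<delta> * (\<sigma> * sqrt (1 - \<theta>))) sequentially"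
    by (intro order_tendstoD(2)) auto
  then obtain N where N: "\<And>n. N \<le> n \<Longrightarrow> C * \<delta> ^ n < \<delta> * (\<sigma> * sqrt (1 - \<theta>))"
    by (auto simp: eventually_sequentially)
  have v_ge: "\<kappa> * \<delta> ^ n \<le> sqrt (v n)" if n: "N \<le> n" for n
  proof -
    have "\<bar>sqrt (v n) - \<sigma> * sqrt (\<theta> ^ n - \<theta> ^ Suc n)\<bar> \<le> C * \<theta> ^ n"
      unfolding v_def using \<theta>n[of n] \<theta>n[of "Suc n"] dec[of n "Suc n"] by (intro var_approx) auto
    moreover have "\<theta> ^ n - \<theta> ^ Suc n = \<theta> ^ n * (1 - \<theta>)" by (simp add: algebra_simps)
    moreover have "C * \<theta> ^ n \<le> \<delta> * (\<sigma> * sqrt (1 - \<theta>)) * \<delta> ^ n"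
      unfolding \<theta>_sq mult.assoc[symmetric] using N[OF n] \<delta> by (intro mult_right_mono) (auto simp: mult.assoc)
    ultimately have "\<sigma> * (\<delta> ^ n * sqrt (1 - \<theta>)) - \<delta> * (\<sigma> * sqrt (1 - \<theta>)) * \<delta> ^ n \<le> sqrt (v n)"
      by (simp add: real_sqrt_mult sqrt_\<theta> del: power_Suc)
    then show ?thesis by (simp add: \<kappa>_def algebra_simps)
  qed
  have v_pos: "0 < sqrt (v n)" if "N \<le> n" for n
    by (rule less_le_trans[OF _ v_ge[OF that]]) (use \<kappa> \<delta> in simp)
  define Y where "Y n \<omega> = X (\<theta> ^ n) \<omega> - X (\<theta> ^ Suc n) \<omega>" for n \<omega>
  \<comment> \<open>The shift by \<open>N\<close> skips the finitely many increments without a lower variance bound; it does not change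
    \<open>ln n\<close> to leading order.\<close>
  define \<xi> where "\<xi> n \<omega> = Y (n + N) \<omega> / sqrt (v (n + N))" for n \<omega>
  define cv where "cv n m = c (\<theta> ^ n) (\<theta> ^ Suc n) (\<theta> ^ m) (\<theta> ^ Suc m)" for n m
  define \<rho> where "\<rho> n m = cv (n + N) (m + N) / (sqrt (v (n + N)) * sqrt (v (m + N)))" for n m
  have "AE \<omega> in M. frequently (\<lambda>n. (1 - 2 * \<delta>) * sqrt (2 * ln (real n)) < \<xi> n \<omega>) sequentially"
  proof (rule nearly_uncorrelated_gaussian_lower[where \<rho> = \<rho> and D = "C / \<kappa>\<^sup>2" and q = \<delta>])
    fix n m :: nat and s t :: real assume "n < m"
    let ?a = "sqrt (v (n + N))" and ?b = "sqrt (v (m + N))"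
    have pos: "0 < ?a" "0 < ?b" using v_pos by auto
    have "gaussian_law M (\<lambda>\<omega>. (s / ?a) * Y (n + N) \<omega> + (t / ?b) * Y (m + N) \<omega>)
       ((s / ?a)\<^sup>2 * v (n + N) + 2 * (s / ?a) * (t / ?b) * cv (n + N) (m + N) + (t / ?b)\<^sup>2 * v (m + N))"
      unfolding Y_def v_def cv_def by (rule law) (use \<theta>n in blast)
    moreover have "(s / ?a)\<^sup>2 * v (n + N) = s\<^sup>2" "(t / ?b)\<^sup>2 * v (m + N) = t\<^sup>2"
      using pos by (auto simp: power_divide)
    ultimately show "gaussian_law M (\<lambda>\<omega>. s * \<xi> n \<omega> + t * \<xi> m \<omega>) (s\<^sup>2 + 2 * \<rho> n m * s * t + t\<^sup>2)"
      by (simp add: \<xi>_def \<rho>_def mult_ac)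
  next
    fix n m :: nat assume nm: "n < m"
    let ?n = "n + N" and ?m = "m + N"
    have "\<bar>cv ?n ?m\<bar> \<le> C * (\<theta> ^ ?n - \<theta> ^ Suc ?n) * (\<theta> ^ ?m - \<theta> ^ Suc ?m)"
      unfolding cv_def using \<theta>n[of ?n] \<theta>n[of "Suc ?m"] dec[of ?n "Suc ?n"] dec[of ?m "Suc ?m"] dec[of "Suc ?n" ?m] nm
      by (intro cov_le) auto
    also have "\<dots> \<le> C * \<theta> ^ ?n * \<theta> ^ ?m"
      using \<theta> C dec[of ?m "Suc ?m"] dec[of ?n "Suc ?n"] by (intro mult_mono mult_left_mono) auto
    also have "\<dots> = C * (\<delta> ^ ?n * \<delta> ^ ?m) * (\<delta> ^ ?n * \<delta> ^ ?m)"
      unfolding \<theta>_sq by (simp only: mult_ac)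
    finally have 1: "\<bar>cv ?n ?m\<bar> \<le> C * (\<delta> ^ ?n * \<delta> ^ ?m) * (\<delta> ^ ?n * \<delta> ^ ?m)" .
    have 2: "(\<kappa> * \<delta> ^ ?n) * (\<kappa> * \<delta> ^ ?m) \<le> sqrt (v ?n) * sqrt (v ?m)"
      using \<kappa> \<delta> v_pos[of ?n] by (intro mult_mono v_ge) auto
    have "\<bar>\<rho> n m\<bar> = \<bar>cv ?n ?m\<bar> / (sqrt (v ?n) * sqrt (v ?m))"
      using v_pos[of ?n] v_pos[of ?m] by (simp add: \<rho>_def abs_mult)
    also have "\<dots> \<le> C * (\<delta> ^ ?n * \<delta> ^ ?m) * (\<delta> ^ ?n * \<delta> ^ ?m) / ((\<kappa> * \<delta> ^ ?n) * (\<kappa> * \<delta> ^ ?m))"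
      using 1 2 \<kappa> \<delta> C by (intro frac_le) auto
    also have "\<dots> = C / \<kappa>\<^sup>2 * (\<delta> ^ ?n * \<delta> ^ ?m)"
      using \<kappa> \<delta> by (simp add: power2_eq_square field_simps)
    also have "\<dots> \<le> C / \<kappa>\<^sup>2 * (\<delta> ^ n * \<delta> ^ m)"
      using C \<delta> by (intro mult_left_mono mult_mono power_decreasing) auto
    finally show "\<bar>\<rho> n m\<bar> \<le> C / \<kappa>\<^sup>2 * \<delta> ^ n * \<delta> ^ m" by (simp add: mult.assoc)
  qed (use \<delta> in auto)
  moreover have "AE \<omega> in M. eventually (\<lambda>n.
      \<bar>X (\<theta> ^ n) \<omega> - X 0 \<omega>\<bar> \<le> 2 * \<sigma> * sqrt (2 * \<theta> ^ n * ln (real n))) sequentially"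
    by (rule geometric_sequence_upper) (use \<theta> in auto)
  ultimately show ?thesis
  proof eventually_elim
    case (elim \<omega>)
    define L where "L = ln (1 / \<theta>)"
    have L: "0 < L" using \<theta> by (simp add: L_def)
    define A where "A = ?A \<delta>"
    have "(\<lambda>n. sqrt 2 * \<sigma> * (A * sqrt (ln (real n) / ln (real (n + N) * L))
        - 2 * \<delta> * sqrt (ln (real (n + N + 1)) / ln (real (n + N) * L)))) \<longlonglongrightarrow> sqrt 2 * \<sigma> * (A * 1 - 2 * \<delta> * 1)"
    proof (intro tendsto_intros)
      show "(\<lambda>n. sqrt (ln (real n) / ln (real (n + N) * L))) \<longlonglongrightarrow> 1"
        "(\<lambda>n. sqrt (ln (real (n + N + 1)) / ln (real (n + N) * L))) \<longlonglongrightarrow> 1"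
        using L by real_asymp+
    qed
    then have lim: "eventually (\<lambda>n. sqrt 2 * \<sigma> - \<eta> < sqrt 2 * \<sigma> * (A * sqrt (ln (real n) / ln (real (n + N) * L))
        - 2 * \<delta> * sqrt (ln (real (n + N + 1)) / ln (real (n + N) * L)))) sequentially"
      by (rule order_tendstoD(1)) (use \<delta>_lim in \<open>simp add: A_def\<close>)
    have "filterlim (\<lambda>n. real (n + N) * L) at_top sequentially" using L by real_asymp
    then have evL: "eventually (\<lambda>n. 1 < real (n + N) * L) sequentially" by (simp add: filterlim_at_top_dense)
    have "filterlim (\<lambda>n. n + N + 1) sequentially sequentially" by real_asymp
    then have up: "eventually (\<lambda>n. \<bar>X (\<theta> ^ (n + N + 1)) \<omega> - X 0 \<omega>\<bar>
        \<le> 2 * \<sigma> * sqrt (2 * \<theta> ^ (n + N + 1) * ln (real (n + N + 1)))) sequentially"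
      using elim(2) by (rule eventually_compose_filterlim[rotated])
    have "eventually (\<lambda>n. (1 - 2 * \<delta>) * sqrt (2 * ln (real n)) < \<xi> n \<omega> \<longrightarrow>
        sqrt 2 * \<sigma> - \<eta> \<le> \<bar>X (\<theta> ^ (n + N)) \<omega> - X 0 \<omega>\<bar> / lil_gauge (\<theta> ^ (n + N))) sequentially"
      using lim evL up eventually_ge_at_top[of 1]
    proof eventually_elim
      case (elim n)
      show ?case
      proof
        assume big: "(1 - 2 * \<delta>) * sqrt (2 * ln (real n)) < \<xi> n \<omega>"
        let ?k = "n + N"
        let ?g = "sqrt (ln (real ?k * L))"
        have lnL: "0 < ln (real ?k * L)" using elim(2) by simp
        have "(1 - 2 * \<delta>) * sqrt (2 * ln (real n)) * (\<kappa> * \<delta> ^ ?k) \<le> \<xi> n \<omega> * sqrt (v ?k)"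
          using big v_ge[of ?k] \<delta> \<kappa> elim(4) by (intro mult_mono) (auto intro: order_trans[OF _ less_imp_le[OF big]])
        also have "\<dots> = Y ?k \<omega>" using v_pos[of ?k] by (simp add: \<xi>_def)
        finally have low: "(1 - 2 * \<delta>) * sqrt (2 * ln (real n)) * (\<kappa> * \<delta> ^ ?k) \<le> Y ?k \<omega>" .
        have e1: "(1 - 2 * \<delta>) * sqrt (2 * ln (real n)) * (\<kappa> * \<delta> ^ ?k) = \<delta> ^ ?k * (sqrt 2 * \<sigma> * (A * sqrt (ln (real n))))"
          by (simp add: \<kappa>_def A_def \<theta>_def real_sqrt_mult mult_ac)
        have e2: "2 * \<sigma> * sqrt (2 * \<theta> ^ (?k + 1) * ln (real (?k + 1)))
            = \<delta> ^ ?k * (sqrt 2 * \<sigma> * (2 * \<delta> * sqrt (ln (real (?k + 1)))))"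
          unfolding real_sqrt_mult sqrt_\<theta> by simp
        have "\<delta> ^ ?k * (sqrt 2 * \<sigma> * (A * sqrt (ln (real n)) - 2 * \<delta> * sqrt (ln (real (?k + 1)))))
            \<le> X (\<theta> ^ ?k) \<omega> - X 0 \<omega>"
          using low elim(3) unfolding e1 e2 unfolding Y_def right_diff_distrib Suc_eq_plus1 by linarith
        then have num: "\<delta> ^ ?k * (sqrt 2 * \<sigma> * (A * sqrt (ln (real n)) - 2 * \<delta> * sqrt (ln (real (?k + 1)))))
            \<le> \<bar>X (\<theta> ^ ?k) \<omega> - X 0 \<omega>\<bar>" by linarith
        have "real ?k * L = ln (1 / \<theta> ^ ?k)" using \<theta> by (simp add: L_def ln_div ln_realpow)
        then have g: "lil_gauge (\<theta> ^ ?k) = \<delta> ^ ?k * ?g"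
          unfolding lil_gauge_def real_sqrt_mult sqrt_\<theta> by simp
        have "sqrt 2 * \<sigma> - \<eta> \<le> sqrt 2 * \<sigma> * (A * sqrt (ln (real n) / ln (real ?k * L))
            - 2 * \<delta> * sqrt (ln (real (?k + 1)) / ln (real ?k * L)))"
          using elim(1) by simp
        also have "\<dots> = \<delta> ^ ?k * (sqrt 2 * \<sigma> * (A * sqrt (ln (real n)) - 2 * \<delta> * sqrt (ln (real (?k + 1))))) / (\<delta> ^ ?k * ?g)"
          using \<delta> lnL unfolding real_sqrt_divide by (simp add: right_diff_distrib diff_divide_distrib)
        also have "\<dots> \<le> \<bar>X (\<theta> ^ ?k) \<omega> - X 0 \<omega>\<bar> / lil_gauge (\<theta> ^ ?k)"
          unfolding g using \<delta> lnL by (intro divide_right_mono num) auto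
        finally show "sqrt 2 * \<sigma> - \<eta> \<le> \<bar>X (\<theta> ^ ?k) \<omega> - X 0 \<omega>\<bar> / lil_gauge (\<theta> ^ ?k)" .
      qed
    qed
    with elim(1) have freq: "frequently (\<lambda>n. sqrt 2 * \<sigma> - \<eta> \<le> \<bar>X (\<theta> ^ (n + N)) \<omega> - X 0 \<omega>\<bar> / lil_gauge (\<theta> ^ (n + N))) sequentially"
      by (rule frequently_rev_mp)
    have "(\<lambda>n. \<theta> ^ (n + N)) \<longlonglongrightarrow> 0"
      using LIMSEQ_ignore_initial_segment[OF LIMSEQ_power_zero[of \<theta>], of N] \<theta> by simp
    then have "filterlim (\<lambda>n. \<theta> ^ (n + N)) (at_right 0) sequentially"
      using \<theta> by (intro tendsto_imp_filterlim_at_right) auto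
    then show ?case
      using freq unfolding frequently_def by (auto dest: eventually_compose_filterlim)
  qed
qed

theorem law_of_iterated_logarithm:
  "AE \<omega> in M. Limsup (at_right 0) (\<lambda>h. ereal (\<bar>X h \<omega> - X 0 \<omega>\<bar> / lil_gauge h)) = ereal (sqrt 2 * \<sigma>)"
proof -
  have "AE \<omega> in M. \<forall>j::nat. eventually (\<lambda>h. \<bar>X h \<omega> - X 0 \<omega>\<bar> / lil_gauge h \<le> sqrt 2 * \<sigma> + inverse (real (Suc j))) (at_right 0)"
    unfolding AE_all_countable by (intro allI lil_upper) simp
  moreover have "AE \<omega> in M. \<forall>j::nat. frequently (\<lambda>h. sqrt 2 * \<sigma> - inverse (real (Suc j)) \<le> \<bar>X h \<omega> - X 0 \<omega>\<bar> / lil_gauge h) (at_right 0)"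
    unfolding AE_all_countable by (intro allI lil_lower) simp
  ultimately show ?thesis
  proof eventually_elim
    case (elim \<omega>)
    let ?r = "\<lambda>h. ereal (\<bar>X h \<omega> - X 0 \<omega>\<bar> / lil_gauge h)"
    have up: "Limsup (at_right 0) ?r \<le> ereal (sqrt 2 * \<sigma> + inverse (real (Suc j)))" for j
      by (rule Limsup_bounded) (use elim(1) in \<open>auto\<close>)
    have low: "ereal (sqrt 2 * \<sigma> - inverse (real (Suc j))) \<le> Limsup (at_right 0) ?r" for j
    proof (rule ccontr)
      assume "\<not> ?thesis"
      then have "eventually (\<lambda>h. ?r h < ereal (sqrt 2 * \<sigma> - inverse (real (Suc j)))) (at_right 0)"
        by (intro Limsup_lessD) auto
      then show False using elim(2)[rule_format, of j] by (auto simp: frequently_def not_le)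
    qed
    have lim1: "(\<lambda>j. ereal (sqrt 2 * \<sigma> + inverse (real (Suc j)))) \<longlonglongrightarrow> ereal (sqrt 2 * \<sigma>)"
      using tendsto_add[OF tendsto_const LIMSEQ_inverse_real_of_nat, of "sqrt 2 * \<sigma>"] by simp
    have lim2: "(\<lambda>j. ereal (sqrt 2 * \<sigma> - inverse (real (Suc j)))) \<longlonglongrightarrow> ereal (sqrt 2 * \<sigma>)"
      using tendsto_diff[OF tendsto_const LIMSEQ_inverse_real_of_nat, of "sqrt 2 * \<sigma>"] by simp
    show ?case
      by (intro antisym LIMSEQ_le_const[OF lim1] LIMSEQ_le_const2[OF lim2]) (use up low in auto)
  qed
qed

end

section \<open>The Walsh integral\<close>

definition square_integrable :: "'a measure \<Rightarrow> ('a \<Rightarrow> real) \<Rightarrow> bool" where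
  "square_integrable M f \<longleftrightarrow> f \<in> borel_measurable M \<and> integrable M (\<lambda>x. (f x)\<^sup>2)"

definition l2_norm :: "'a measure \<Rightarrow> ('a \<Rightarrow> real) \<Rightarrow> real" where
  "l2_norm M f = sqrt (LINT x|M. (f x)\<^sup>2)"

lemma square_integrable_mult:
  assumes "square_integrable M f" "square_integrable M g"
  shows "integrable M (\<lambda>x. f x * g x)"
proof (rule Bochner_Integration.integrable_bound)
  show "integrable M (\<lambda>x. (f x)\<^sup>2 + (g x)\<^sup>2)"
    using assms by (auto simp: square_integrable_def)
  show "(\<lambda>x. f x * g x) \<in> borel_measurable M"
    using assms by (auto simp: square_integrable_def)
  have "\<bar>a * b\<bar> \<le> \<bar>a\<^sup>2 + b\<^sup>2\<bar>" for a b :: real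
  proof -
    have "2 * (\<bar>a\<bar> * \<bar>b\<bar>) \<le> a\<^sup>2 + b\<^sup>2"
      using sum_squares_bound[of "\<bar>a\<bar>" "\<bar>b\<bar>"] by simp
    moreover have "0 \<le> \<bar>a\<bar> * \<bar>b\<bar>" by simp
    ultimately have "\<bar>a\<bar> * \<bar>b\<bar> \<le> a\<^sup>2 + b\<^sup>2" by linarith
    then show ?thesis by (simp add: abs_mult)
  qed
  then show "AE x in M. norm (f x * g x) \<le> norm ((f x)\<^sup>2 + (g x)\<^sup>2)" by simp
qed

lemma square_integrable_lincomb:
  assumes "square_integrable M f" "square_integrable M g"
  shows "square_integrable M (\<lambda>x. a * f x + b * g x)"
    and "(LINT x|M. (a * f x + b * g x)\<^sup>2)
      = a\<^sup>2 * (LINT x|M. (f x)\<^sup>2) + 2 * a * b * (LINT x|M. f x * g x) + b\<^sup>2 * (LINT x|M. (g x)\<^sup>2)"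
proof -
  have eq: "(a * f x + b * g x)\<^sup>2 = a\<^sup>2 * (f x)\<^sup>2 + 2 * a * b * (f x * g x) + b\<^sup>2 * (g x)\<^sup>2" for x
    by (simp add: power2_eq_square algebra_simps)
  note i = square_integrable_mult[OF assms]
  show "square_integrable M (\<lambda>x. a * f x + b * g x)"
    using assms i by (auto simp: square_integrable_def eq)
  show "(LINT x|M. (a * f x + b * g x)\<^sup>2)
      = a\<^sup>2 * (LINT x|M. (f x)\<^sup>2) + 2 * a * b * (LINT x|M. f x * g x) + b\<^sup>2 * (LINT x|M. (g x)\<^sup>2)"
    using assms i by (simp add: square_integrable_def eq)
qed

lemma square_integrable_diff:
  assumes "square_integrable M f" "square_integrable M g"
  shows "square_integrable M (\<lambda>x. f x - g x)"
  using square_integrable_lincomb(1)[OF assms, of 1 "-1"] by simp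

lemma square_integrable_add:
  assumes "square_integrable M f" "square_integrable M g"
  shows "square_integrable M (\<lambda>x. f x + g x)"
  using square_integrable_lincomb(1)[OF assms, of 1 1] by simp

lemma l2_norm_nonneg: "0 \<le> l2_norm M f"
  by (simp add: l2_norm_def)

lemma l2_norm_triangle:
  assumes f: "square_integrable M f" and g: "square_integrable M g"
  shows "l2_norm M (\<lambda>x. f x + g x) \<le> l2_norm M f + l2_norm M g"
proof -
  define A B P where "A = (LINT x|M. (f x)\<^sup>2)" and "B = (LINT x|M. (g x)\<^sup>2)" and "P = (LINT x|M. f x * g x)"
  have A: "0 \<le> A" and B: "0 \<le> B" by (simp_all add: A_def B_def)
  have quad: "0 \<le> a\<^sup>2 * A + 2 * a * b * P + b\<^sup>2 * B" for a b
    unfolding A_def B_def P_def square_integrable_lincomb(2)[OF f g, symmetric] by simp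
  have CS: "P \<le> sqrt A * sqrt B"
  proof (cases "A = 0 \<or> B = 0")
    case True
    have "P \<le> 0"
    proof (rule ccontr)
      assume P: "\<not> P \<le> 0"
      show False
      proof (cases "A = 0")
        case True
        then show False using quad[of "- (B + 1) / (2 * P)" 1] P by (simp add: field_simps)
      next
        case False
        then show False using quad[of 1 "- (A + 1) / (2 * P)"] P True by (simp add: field_simps)
      qed
    qed
    then show ?thesis using True by auto
  next
    case False
    then have "0 \<le> (sqrt B)\<^sup>2 * A + 2 * sqrt B * (- sqrt A) * P + (- sqrt A)\<^sup>2 * B"
      by (intro quad)
    also have "\<dots> = 2 * (A * B) - 2 * (sqrt A * sqrt B) * P" using A B by simp
    also have "A * B = (sqrt A * sqrt B) * (sqrt A * sqrt B)" using A B by (simp add: mult_ac)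
    finally have "(sqrt A * sqrt B) * P \<le> (sqrt A * sqrt B) * (sqrt A * sqrt B)" by simp
    moreover have "0 < sqrt A * sqrt B" using False A B by simp
    ultimately show ?thesis by (simp only: mult_le_cancel_left_pos)
  qed
  have "(LINT x|M. (f x + g x)\<^sup>2) = A + 2 * P + B"
    using square_integrable_lincomb(2)[OF f g, of 1 1] by (simp add: A_def B_def P_def)
  also have "\<dots> \<le> (sqrt A + sqrt B)\<^sup>2" using CS A B by (simp add: power2_sum)
  finally show ?thesis
    unfolding l2_norm_def A_def[symmetric] B_def[symmetric] using A B by (intro real_le_lsqrt) auto
qed

lemma l2_norm_diff_commute: "l2_norm M (\<lambda>x. f x - g x) = l2_norm M (\<lambda>x. g x - f x)"
  by (simp add: l2_norm_def power2_commute)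

lemma l2_norm_diff_le:
  assumes f: "square_integrable M f" and g: "square_integrable M g"
  shows "\<bar>l2_norm M f - l2_norm M g\<bar> \<le> l2_norm M (\<lambda>x. f x - g x)"
proof -
  have "l2_norm M f \<le> l2_norm M g + l2_norm M (\<lambda>x. f x - g x)"
    using l2_norm_triangle[OF g square_integrable_diff[OF f g]] by simp
  moreover have "l2_norm M g \<le> l2_norm M f + l2_norm M (\<lambda>x. g x - f x)"
    using l2_norm_triangle[OF f square_integrable_diff[OF g f]] by simp
  ultimately show ?thesis unfolding l2_norm_diff_commute[of M g f] by linarith
qed

lemma square_integrable_iff_nn_integral:
  assumes "f \<in> borel_measurable M"
  shows "square_integrable M f \<longleftrightarrow> (\<integral>\<^sup>+x. ennreal ((f x)\<^sup>2) \<partial>M) < \<infinity>"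
  using assms by (auto simp: square_integrable_def integrable_iff_bounded)

lemma l2_norm_eq_nn_integral:
  assumes "square_integrable M f"
  shows "(\<integral>\<^sup>+x. ennreal ((f x)\<^sup>2) \<partial>M) = ennreal ((l2_norm M f)\<^sup>2)"
  using assms by (subst nn_integral_eq_integral) (auto simp: square_integrable_def l2_norm_def)

text \<open>Convergence in the sense used by the Walsh integral is convergence of \<open>l2_norm\<close>: a finite nonnegative
integral for one large \<open>n\<close> already makes the limit square integrable.\<close>

lemma l2_limit:
  assumes f: "f \<in> borel_measurable M" and g: "\<And>n. square_integrable M (g n)"
    and lim: "(\<lambda>n. \<integral>\<^sup>+ x. ennreal ((f x - g n x)\<^sup>2) \<partial>M) \<longlonglongrightarrow> 0"
  shows "square_integrable M f" "(\<lambda>n. l2_norm M (\<lambda>x. f x - g n x)) \<longlonglongrightarrow> 0"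
proof -
  have gm[measurable]: "g n \<in> borel_measurable M" for n using g by (simp add: square_integrable_def)
  note f[measurable]
  have "eventually (\<lambda>n. (\<integral>\<^sup>+ x. ennreal ((f x - g n x)\<^sup>2) \<partial>M) < 1) sequentially"
    using lim by (rule order_tendstoD) simp
  then obtain n where "(\<integral>\<^sup>+ x. ennreal ((f x - g n x)\<^sup>2) \<partial>M) < 1"
    by (auto simp: eventually_sequentially)
  then have "square_integrable M (\<lambda>x. f x - g n x)"
    by (subst square_integrable_iff_nn_integral) (auto intro: less_trans simp: ennreal_one_less_top)
  from square_integrable_add[OF this g[of n]] show sf: "square_integrable M f" by simp
  have "(\<lambda>n. ennreal ((l2_norm M (\<lambda>x. f x - g n x))\<^sup>2)) \<longlonglongrightarrow> ennreal 0"
    using lim l2_norm_eq_nn_integral[OF square_integrable_diff[OF sf g]] by simp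
  then have "(\<lambda>n. (l2_norm M (\<lambda>x. f x - g n x))\<^sup>2) \<longlonglongrightarrow> 0"
    by (subst (asm) tendsto_ennreal_iff) auto
  then have "(\<lambda>n. sqrt ((l2_norm M (\<lambda>x. f x - g n x))\<^sup>2)) \<longlonglongrightarrow> sqrt 0"
    by (rule tendsto_real_sqrt)
  then show "(\<lambda>n. l2_norm M (\<lambda>x. f x - g n x)) \<longlonglongrightarrow> 0" by (simp add: l2_norm_nonneg)
qed

lemma (in prob_space) l1_le_l2:
  assumes "square_integrable M f"
  shows "expectation (\<lambda>x. \<bar>f x\<bar>) \<le> l2_norm M f" "integrable M f"
proof -
  have one: "square_integrable M (\<lambda>x. 1)" by (simp add: square_integrable_def)
  show i: "integrable M f" using square_integrable_mult[OF assms one] by simp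
  have "0 \<le> expectation (\<lambda>x. (\<bar>f x\<bar> - expectation (\<lambda>x. \<bar>f x\<bar>))\<^sup>2)" by simp
  also have "\<dots> = expectation (\<lambda>x. \<bar>f x\<bar>\<^sup>2) - (expectation (\<lambda>x. \<bar>f x\<bar>))\<^sup>2"
    by (rule variance_eq) (use i assms in \<open>auto simp: square_integrable_def\<close>)
  finally have "(expectation (\<lambda>x. \<bar>f x\<bar>))\<^sup>2 \<le> expectation (\<lambda>x. (f x)\<^sup>2)" by simp
  then show "expectation (\<lambda>x. \<bar>f x\<bar>) \<le> l2_norm M f"
    unfolding l2_norm_def by (rule real_le_rsqrt)
qed

lemma (in prob_space) centered_gaussian_law:
  assumes "centered_gaussian M X"
  shows "square_integrable M X" "gaussian_law M X (expectation (\<lambda>\<omega>. (X \<omega>)\<^sup>2))"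
proof -
  have [measurable]: "X \<in> borel_measurable M" using assms by (simp add: centered_gaussian_def)
  have *: "square_integrable M X \<and> gaussian_law M X (expectation (\<lambda>\<omega>. (X \<omega>)\<^sup>2))"
  proof (cases "AE \<omega> in M. X \<omega> = 0")
    case True
    then have sq: "AE \<omega> in M. (X \<omega>)\<^sup>2 = 0" by auto
    have "integrable M (\<lambda>\<omega>. (X \<omega>)\<^sup>2) \<longleftrightarrow> integrable M (\<lambda>\<omega>. 0::real)"
      by (rule integrable_cong_AE) (use sq in auto)
    moreover have "expectation (\<lambda>\<omega>. (X \<omega>)\<^sup>2) = expectation (\<lambda>\<omega>. 0)"
      by (rule integral_cong_AE) (use sq in auto)
    moreover have "(CLINT \<omega>|M. iexp (s * X \<omega>)) = (CLINT \<omega>|M. 1)" for s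
      by (rule integral_cong_AE) (use True in auto)
    ultimately show ?thesis
      by (simp add: square_integrable_def gaussian_law_def prob_space)
  next
    case False
    then obtain \<sigma> where \<sigma>: "0 < \<sigma>" and D: "distributed M lborel X (normal_density 0 \<sigma>)"
      using assms by (auto simp: centered_gaussian_def)
    define Y where "Y \<omega> = X \<omega> / \<sigma>" for \<omega>
    have "distributed M lborel (\<lambda>x. (X x - 0) / \<sigma>) std_normal_density"
      using D normal_standard_normal_convert[OF \<sigma>] by blast
    then have DY: "distributed M lborel Y std_normal_density" unfolding Y_def by simp
    have [measurable]: "Y \<in> borel_measurable M" unfolding Y_def by measurable
    have distr: "distr M borel Y = std_normal_distribution"
      using distributed_distr_eq_density[OF DY] by (simp cong: distr_cong)
    have XY: "X \<omega> = \<sigma> * Y \<omega>" for \<omega> using \<sigma> by (simp add: Y_def)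
    have "integrable (distr M borel Y) (\<lambda>x. x\<^sup>2)"
      unfolding distr by (rule integrable_std_normal_distribution_moment)
    then have iY: "integrable M (\<lambda>\<omega>. (Y \<omega>)\<^sup>2)" by (subst (asm) integrable_distr_eq) auto
    have "(LINT x|distr M borel Y. x\<^sup>2) = 1"
      unfolding distr using std_normal_distribution_even_moments(1)[of 1] by simp
    then have EY: "expectation (\<lambda>\<omega>. (Y \<omega>)\<^sup>2) = 1" by (subst (asm) integral_distr) auto
    have EX: "expectation (\<lambda>\<omega>. (X \<omega>)\<^sup>2) = \<sigma>\<^sup>2" by (simp add: XY power_mult_distrib EY)
    have "(CLINT \<omega>|M. iexp (s * X \<omega>)) = complex_of_real (exp (- (\<sigma>\<^sup>2 * s\<^sup>2 / 2)))" for s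
    proof -
      have "(CLINT \<omega>|M. iexp (s * X \<omega>)) = (CLINT \<omega>|M. iexp (s * \<sigma> * Y \<omega>))" by (simp add: XY mult.assoc)
      also have "\<dots> = char (distr M borel Y) (s * \<sigma>)" unfolding char_def by (subst integral_distr) auto
      also have "\<dots> = complex_of_real (exp (- (\<sigma>\<^sup>2 * s\<^sup>2 / 2)))"
        unfolding distr char_std_normal_distribution by (simp add: power_mult_distrib mult.commute)
      finally show ?thesis .
    qed
    moreover have "integrable M (\<lambda>\<omega>. (X \<omega>)\<^sup>2)" by (simp add: XY power_mult_distrib iY)
    ultimately show ?thesis by (simp add: square_integrable_def gaussian_law_def EX)
  qed
  then show "square_integrable M X" "gaussian_law M X (expectation (\<lambda>\<omega>. (X \<omega>)\<^sup>2))" by auto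
qed

lemma iexp_diff_le: "norm (iexp x - iexp y) \<le> \<bar>x - y\<bar>"
proof -
  have "iexp x - iexp y = iexp y * (iexp (x - y) - 1)"
    by (simp add: right_diff_distrib flip: exp_add)
  then have "norm (iexp x - iexp y) = norm (iexp (x - y) - 1)" by (simp add: norm_mult)
  also have "\<dots> \<le> \<bar>x - y\<bar>" using iexp_approx1[of "x - y" 0] by simp
  finally show ?thesis .
qed

text \<open>Convergence in \<open>L\<^sup>2\<close> gives convergence of characteristic functions, because \<open>iexp\<close> is 1-Lipschitz and the \<open>L\<^sup>1\<close> norm
is dominated by the \<open>L\<^sup>2\<close> norm.\<close>

lemma (in prob_space) gaussian_law_l2_limit:
  assumes X: "X \<in> borel_measurable M" and Y: "\<And>n. square_integrable M (Y n)"
    and law: "\<And>n. gaussian_law M (Y n) (v n)" and v: "v \<longlonglongrightarrow> w"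
    and lim: "(\<lambda>n. \<integral>\<^sup>+ \<omega>. ennreal ((X \<omega> - Y n \<omega>)\<^sup>2) \<partial>M) \<longlonglongrightarrow> 0"
  shows "gaussian_law M X w"
  unfolding gaussian_law_def
proof (intro conjI allI)
  show "X \<in> borel_measurable M" by (rule X)
  show "0 \<le> w" by (rule LIMSEQ_le_const[OF v]) (use law in \<open>auto simp: gaussian_law_def\<close>)
  fix s
  note X[measurable]
  have [measurable]: "Y n \<in> borel_measurable M" for n using Y by (simp add: square_integrable_def)
  note sX = l2_limit(1)[OF X Y lim]
  have "(\<lambda>n. (CLINT \<omega>|M. iexp (s * X \<omega>)) - (CLINT \<omega>|M. iexp (s * Y n \<omega>))) \<longlonglongrightarrow> 0"
  proof (rule Lim_null_comparison)
    show "eventually (\<lambda>n. norm ((CLINT \<omega>|M. iexp (s * X \<omega>)) - (CLINT \<omega>|M. iexp (s * Y n \<omega>)))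
        \<le> \<bar>s\<bar> * l2_norm M (\<lambda>\<omega>. X \<omega> - Y n \<omega>)) sequentially"
    proof (intro always_eventually allI)
      fix n
      have i: "integrable M (\<lambda>\<omega>. iexp (s * X \<omega>))" "integrable M (\<lambda>\<omega>. iexp (s * Y n \<omega>))"
        by (auto intro!: integrable_iexp simp del: of_real_mult)
      note d = square_integrable_diff[OF sX Y[of n]]
      have "norm ((CLINT \<omega>|M. iexp (s * X \<omega>)) - (CLINT \<omega>|M. iexp (s * Y n \<omega>)))
          = norm (CLINT \<omega>|M. iexp (s * X \<omega>) - iexp (s * Y n \<omega>))"
        using i by simp
      also have "\<dots> \<le> expectation (\<lambda>\<omega>. norm (iexp (s * X \<omega>) - iexp (s * Y n \<omega>)))"
        by (rule integral_norm_bound)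
      also have "\<dots> \<le> expectation (\<lambda>\<omega>. \<bar>s\<bar> * \<bar>X \<omega> - Y n \<omega>\<bar>)"
      proof (rule integral_mono)
        show "integrable M (\<lambda>\<omega>. norm (iexp (s * X \<omega>) - iexp (s * Y n \<omega>)))"
          using i by (intro integrable_norm Bochner_Integration.integrable_diff)
        show "integrable M (\<lambda>\<omega>. \<bar>s\<bar> * \<bar>X \<omega> - Y n \<omega>\<bar>)"
          using l1_le_l2(2)[OF d] by auto
        show "norm (iexp (s * X \<omega>) - iexp (s * Y n \<omega>)) \<le> \<bar>s\<bar> * \<bar>X \<omega> - Y n \<omega>\<bar>" for \<omega>
          using iexp_diff_le[of "s * X \<omega>" "s * Y n \<omega>"] by (simp add: abs_mult flip: right_diff_distrib)
      qed
      also have "\<dots> = \<bar>s\<bar> * expectation (\<lambda>\<omega>. \<bar>X \<omega> - Y n \<omega>\<bar>)" by simp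
      also have "\<dots> \<le> \<bar>s\<bar> * l2_norm M (\<lambda>\<omega>. X \<omega> - Y n \<omega>)"
        by (intro mult_left_mono l1_le_l2(1)[OF d]) simp
      finally show "norm ((CLINT \<omega>|M. iexp (s * X \<omega>)) - (CLINT \<omega>|M. iexp (s * Y n \<omega>)))
        \<le> \<bar>s\<bar> * l2_norm M (\<lambda>\<omega>. X \<omega> - Y n \<omega>)" .
    qed
    show "(\<lambda>n. \<bar>s\<bar> * l2_norm M (\<lambda>\<omega>. X \<omega> - Y n \<omega>)) \<longlonglongrightarrow> 0"
      using tendsto_mult_left[OF l2_limit(2)[OF X Y lim], of "\<bar>s\<bar>"] by simp
  qed
  moreover have "(\<lambda>n. (CLINT \<omega>|M. iexp (s * Y n \<omega>))) \<longlonglongrightarrow> complex_of_real (exp (- (w * s\<^sup>2 / 2)))"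
  proof -
    have "(CLINT \<omega>|M. iexp (s * Y n \<omega>)) = complex_of_real (exp (- (v n * s\<^sup>2 / 2)))" for n
      using law unfolding gaussian_law_def by blast
    moreover have "(\<lambda>n. complex_of_real (exp (- (v n * s\<^sup>2 / 2)))) \<longlonglongrightarrow> complex_of_real (exp (- (w * s\<^sup>2 / 2)))"
      by (intro tendsto_intros v) auto
    ultimately show ?thesis by (simp only:)
  qed
  ultimately have "(\<lambda>n. CLINT \<omega>|M. iexp (s * X \<omega>)) \<longlonglongrightarrow> 0 + complex_of_real (exp (- (w * s\<^sup>2 / 2)))"
    by (auto dest: tendsto_add)
  then show "(CLINT \<omega>|M. iexp (s * X \<omega>)) = complex_of_real (exp (- (w * s\<^sup>2 / 2)))"
    by (simp add: LIMSEQ_const_iff)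
qed

lemma square_integrable_step:
  assumes "S \<subseteq> noise_sets" "finite S"
  shows "square_integrable lborel (\<lambda>p. \<Sum>A\<in>S. c A * indicator A p)"
proof -
  have *: "square_integrable lborel (\<lambda>p. c * indicator A p)" if "A \<in> noise_sets" for A :: "(real \<times> real) set" and c :: real
  proof -
    have "(c * indicator A p)\<^sup>2 = c\<^sup>2 * indicator A p" for p by (simp add: indicator_def)
    then show ?thesis using that by (auto simp: square_integrable_def noise_sets_def)
  qed
  show ?thesis
    using assms(2,1)
  proof (induction S rule: finite_induct)
    case empty then show ?case by (simp add: square_integrable_def)
  next
    case (insert A S)
    then have "square_integrable lborel (\<lambda>p. c A * indicator A p + (\<Sum>B\<in>S. c B * indicator B p))"
      by (intro square_integrable_add * insert.IH) auto
    then show ?case by (simp only: sum.insert[OF insert.hyps])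
  qed
qed

lemma integral_double_sum:
  fixes f :: "'b \<Rightarrow> 'b \<Rightarrow> 'a \<Rightarrow> real"
  assumes "\<And>A B. A \<in> S \<Longrightarrow> B \<in> S \<Longrightarrow> integrable M (f A B)"
  shows "(LINT x|M. (\<Sum>A\<in>S. \<Sum>B\<in>S. f A B x)) = (\<Sum>A\<in>S. \<Sum>B\<in>S. (LINT x|M. f A B x))"
  using assms by (simp add: Bochner_Integration.integral_sum)

text \<open>Both sides are the quadratic form of the matrix \<open>measure lborel (A \<inter> B)\<close> in the coefficients \<open>c\<close>; the sets of \<open>S\<close> may overlap.\<close>

lemma (in prob_space) white_noise_isometry:
  assumes W: "white_noise M W" and S: "finite S" "S \<subseteq> noise_sets"
  shows "expectation (\<lambda>\<omega>. (\<Sum>A\<in>S. c A * W A \<omega>)\<^sup>2) = (LINT p|lborel. (\<Sum>A\<in>S. c A * indicator A p)\<^sup>2)"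
proof -
  have gauss: "centered_gaussian M (\<lambda>\<omega>. \<Sum>A\<in>T. d A * W A \<omega>)"
    if "finite T" "T \<subseteq> noise_sets" for T d
    using W that unfolding white_noise_def by blast
  have cov: "expectation (\<lambda>\<omega>. W A \<omega> * W B \<omega>) = measure lborel (A \<inter> B)"
    if "A \<in> noise_sets" "B \<in> noise_sets" for A B
    using W that unfolding white_noise_def by blast
  have W2: "square_integrable M (W A)" if "A \<in> noise_sets" for A
  proof -
    have "centered_gaussian M (\<lambda>\<omega>. \<Sum>B\<in>{A}. 1 * W B \<omega>)"
      using that by (intro gauss) auto
    then show ?thesis using centered_gaussian_law(1) by simp
  qed
  have "expectation (\<lambda>\<omega>. (\<Sum>A\<in>S. c A * W A \<omega>)\<^sup>2)
      = expectation (\<lambda>\<omega>. \<Sum>A\<in>S. \<Sum>B\<in>S. c A * c B * (W A \<omega> * W B \<omega>))"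
    by (simp only: power2_eq_square sum_product mult_ac)
  also have "\<dots> = (\<Sum>A\<in>S. \<Sum>B\<in>S. expectation (\<lambda>\<omega>. c A * c B * (W A \<omega> * W B \<omega>)))"
    using S by (intro integral_double_sum integrable_mult_right square_integrable_mult W2) auto
  also have "\<dots> = (\<Sum>A\<in>S. \<Sum>B\<in>S. c A * c B * expectation (\<lambda>\<omega>. W A \<omega> * W B \<omega>))"
    by (simp only: integral_mult_right_zero)
  also have "\<dots> = (\<Sum>A\<in>S. \<Sum>B\<in>S. c A * c B * measure lborel (A \<inter> B))"
    using S by (intro sum.cong refl arg_cong2[where f = "(*)"] cov) auto
  also have "\<dots> = (\<Sum>A\<in>S. \<Sum>B\<in>S. (LINT p|lborel. c A * c B * indicator (A \<inter> B) p))"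
    by (simp only: integral_mult_right_zero integral_indicator) simp
  also have "\<dots> = (LINT p|lborel. (\<Sum>A\<in>S. \<Sum>B\<in>S. c A * c B * indicator (A \<inter> B) p))"
  proof (rule integral_double_sum[symmetric])
    fix A B assume "A \<in> S" "B \<in> S"
    then have "A \<in> noise_sets" "B \<in> noise_sets" using S by auto
    then have "A \<inter> B \<in> sets lborel" "emeasure lborel (A \<inter> B) \<le> emeasure lborel A" "emeasure lborel A < \<infinity>"
      by (auto simp: noise_sets_def intro!: emeasure_mono)
    then have "integrable lborel (indicator (A \<inter> B) :: _ \<Rightarrow> real)" by (auto intro: le_less_trans)
    then show "integrable lborel (\<lambda>p. c A * c B * indicator (A \<inter> B) p)"
      by (rule integrable_mult_right)
  qed
  also have "\<dots> = (LINT p|lborel. (\<Sum>A\<in>S. c A * indicator A p)\<^sup>2)"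
    by (simp only: power2_eq_square sum_product indicator_inter_arith mult_ac)
  finally show ?thesis .
qed

lemma has_walsh_integralE:
  assumes "has_walsh_integral M W f X"
  obtains S c where "f \<in> borel_measurable borel" "X \<in> borel_measurable M"
    "\<forall>n::nat. finite (S n) \<and> S n \<subseteq> noise_sets"
    "(\<lambda>n. \<integral>\<^sup>+ p. ennreal ((f p - (\<Sum>A\<in>S n. c n A * indicator A p))\<^sup>2) \<partial>lborel) \<longlonglongrightarrow> 0"
    "(\<lambda>n. \<integral>\<^sup>+ \<omega>. ennreal ((X \<omega> - (\<Sum>A\<in>S n. c n A * W A \<omega>))\<^sup>2) \<partial>M) \<longlonglongrightarrow> 0"
  using assms unfolding has_walsh_integral_def
  apply (elim conjE exE)
  subgoal premises prems for S c
    by (rule that[OF prems(2,3,4,5,6)])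
  done

lemma white_noise_sum_gaussian:
  assumes "white_noise M W" "finite S" "S \<subseteq> noise_sets"
  shows "centered_gaussian M (\<lambda>\<omega>. \<Sum>A\<in>S. c A * W A \<omega>)"
  using assms(1) unfolding white_noise_def
  by (elim conjE allE[of _ S] allE[of _ c]) (use assms(2,3) in simp)

text \<open>Simple integrals are Gaussian with variance the squared norm of the step function by
\<open>white_noise_isometry\<close>; the step functions converge to \<open>f\<close> in norm, and the integrals to \<open>X\<close>.\<close>

theorem (in prob_space) walsh_integral_law:
  assumes W: "white_noise M W" and X: "has_walsh_integral M W f X"
  shows "square_integrable lborel f" "gaussian_law M X (LINT p|lborel. (f p)\<^sup>2)"
proof -
  obtain S c where f': "f \<in> borel_measurable borel" and Xm: "X \<in> borel_measurable M"
    and S': "\<forall>n::nat. finite (S n) \<and> S n \<subseteq> noise_sets"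
    and flim: "(\<lambda>n. \<integral>\<^sup>+ p. ennreal ((f p - (\<Sum>A\<in>S n. c n A * indicator A p))\<^sup>2) \<partial>lborel) \<longlonglongrightarrow> 0"
    and Xlim: "(\<lambda>n. \<integral>\<^sup>+ \<omega>. ennreal ((X \<omega> - (\<Sum>A\<in>S n. c n A * W A \<omega>))\<^sup>2) \<partial>M) \<longlonglongrightarrow> 0"
    by (rule has_walsh_integralE[OF X], rule that)
  have S: "finite (S n)" "S n \<subseteq> noise_sets" for n using S' by auto
  have fm: "f \<in> borel_measurable lborel" using f' by simp
  let ?s = "\<lambda>n p. \<Sum>A\<in>S n. c n A * indicator A p"
  have s: "square_integrable lborel (?s n)" for n
    using S by (intro square_integrable_step)
  show sf: "square_integrable lborel f" using l2_limit(1)[OF fm s flim] .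
  have "(\<lambda>n. l2_norm lborel (?s n) - l2_norm lborel f) \<longlonglongrightarrow> 0"
    by (rule Lim_null_comparison[OF always_eventually l2_limit(2)[OF fm s flim]])
       (simp only: l2_norm_diff_commute[of lborel f] real_norm_def l2_norm_diff_le[OF s sf] simp_thms)
  then have "(\<lambda>n. l2_norm lborel (?s n)) \<longlonglongrightarrow> l2_norm lborel f" by (simp add: LIM_zero_iff)
  then have "(\<lambda>n. (l2_norm lborel (?s n))\<^sup>2) \<longlonglongrightarrow> (l2_norm lborel f)\<^sup>2" by (intro tendsto_intros)
  then have v: "(\<lambda>n. LINT p|lborel. (?s n p)\<^sup>2) \<longlonglongrightarrow> (LINT p|lborel. (f p)\<^sup>2)"
    by (simp add: l2_norm_def)
  have g: "centered_gaussian M (\<lambda>\<omega>. \<Sum>A\<in>S n. c n A * W A \<omega>)" for n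
    by (rule white_noise_sum_gaussian[OF W S])
  have law: "gaussian_law M (\<lambda>\<omega>. \<Sum>A\<in>S n. c n A * W A \<omega>) (LINT p|lborel. (?s n p)\<^sup>2)" for n
    using centered_gaussian_law(2)[OF g[of n]] unfolding white_noise_isometry[OF W S] .
  show "gaussian_law M X (LINT p|lborel. (f p)\<^sup>2)"
    by (rule gaussian_law_l2_limit[OF Xm centered_gaussian_law(1)[OF g] law v Xlim])
qed

lemma nn_square_sum_tendsto_0:
  fixes u v :: "nat \<Rightarrow> 'a \<Rightarrow> real" and a b :: real
  assumes [measurable]: "\<And>n. u n \<in> borel_measurable M" "\<And>n. v n \<in> borel_measurable M"
    and u: "(\<lambda>n. \<integral>\<^sup>+ x. ennreal ((u n x)\<^sup>2) \<partial>M) \<longlonglongrightarrow> 0"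
    and v: "(\<lambda>n. \<integral>\<^sup>+ x. ennreal ((v n x)\<^sup>2) \<partial>M) \<longlonglongrightarrow> 0"
  shows "(\<lambda>n. \<integral>\<^sup>+ x. ennreal ((a * u n x + b * v n x)\<^sup>2) \<partial>M) \<longlonglongrightarrow> 0"
proof -
  let ?B = "\<lambda>n. ennreal (2 * a\<^sup>2) * (\<integral>\<^sup>+ x. ennreal ((u n x)\<^sup>2) \<partial>M) + ennreal (2 * b\<^sup>2) * (\<integral>\<^sup>+ x. ennreal ((v n x)\<^sup>2) \<partial>M)"
  have "?B \<longlonglongrightarrow> ennreal (2 * a\<^sup>2) * 0 + ennreal (2 * b\<^sup>2) * 0"
    by (intro tendsto_add ennreal_tendsto_cmult u v) simp_all
  then have B: "?B \<longlonglongrightarrow> 0" by simp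
  have le: "(\<integral>\<^sup>+ x. ennreal ((a * u n x + b * v n x)\<^sup>2) \<partial>M) \<le> ?B n" for n
  proof -
    have "(\<integral>\<^sup>+ x. ennreal ((a * u n x + b * v n x)\<^sup>2) \<partial>M)
        \<le> (\<integral>\<^sup>+ x. ennreal (2 * a\<^sup>2) * ennreal ((u n x)\<^sup>2) + ennreal (2 * b\<^sup>2) * ennreal ((v n x)\<^sup>2) \<partial>M)"
    proof (rule nn_integral_mono)
      fix x
      have "(a * u n x + b * v n x)\<^sup>2 \<le> 2 * a\<^sup>2 * (u n x)\<^sup>2 + 2 * b\<^sup>2 * (v n x)\<^sup>2"
        using sum_squares_bound[of "a * u n x" "b * v n x"] by (simp add: power2_sum power_mult_distrib)
      then have "ennreal ((a * u n x + b * v n x)\<^sup>2) \<le> ennreal (2 * a\<^sup>2 * (u n x)\<^sup>2 + 2 * b\<^sup>2 * (v n x)\<^sup>2)"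
        by (rule ennreal_leI)
      also have "\<dots> = ennreal (2 * a\<^sup>2 * (u n x)\<^sup>2) + ennreal (2 * b\<^sup>2 * (v n x)\<^sup>2)"
        by (rule ennreal_plus) auto
      also have "ennreal (2 * a\<^sup>2 * (u n x)\<^sup>2) = ennreal (2 * a\<^sup>2) * ennreal ((u n x)\<^sup>2)"
        by (rule ennreal_mult) auto
      also have "ennreal (2 * b\<^sup>2 * (v n x)\<^sup>2) = ennreal (2 * b\<^sup>2) * ennreal ((v n x)\<^sup>2)"
        by (rule ennreal_mult) auto
      finally show "ennreal ((a * u n x + b * v n x)\<^sup>2)
          \<le> ennreal (2 * a\<^sup>2) * ennreal ((u n x)\<^sup>2) + ennreal (2 * b\<^sup>2) * ennreal ((v n x)\<^sup>2)" .
    qed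
    also have "\<dots> = ?B n"
      by (subst nn_integral_add, simp, simp, subst (1 2) nn_integral_cmult) simp_all
    finally show ?thesis .
  qed
  show ?thesis
    by (rule tendsto_sandwich[OF _ _ tendsto_const B]) (simp_all only: le zero_le eventually_True)
qed

text \<open>Simple integrands are indexed by sets rather than lists of sets, so adding two of them means merging
the coefficients over the union of the index sets.\<close>

lemma sum_union_coefficients:
  fixes F :: "'a \<Rightarrow> real"
  assumes "finite S" "finite T"
  shows "(\<Sum>A\<in>S \<union> T. (a * (if A \<in> S then c A else 0) + b * (if A \<in> T then d A else 0)) * F A)
    = a * (\<Sum>A\<in>S. c A * F A) + b * (\<Sum>A\<in>T. d A * F A)"
proof -
  have "(\<Sum>A\<in>S \<union> T. (if A \<in> S then c A else 0) * F A) = (\<Sum>A\<in>S. c A * F A)"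
    using assms by (intro sum.mono_neutral_cong_right) auto
  moreover have "(\<Sum>A\<in>S \<union> T. (if A \<in> T then d A else 0) * F A) = (\<Sum>A\<in>T. d A * F A)"
    using assms by (intro sum.mono_neutral_cong_right) auto
  ultimately show ?thesis
    by (simp add: distrib_right sum.distrib mult.assoc flip: sum_distrib_left)
qed

lemma (in prob_space) walsh_integral_lincomb:
  fixes f g :: "real \<times> real \<Rightarrow> real" and X Y :: "'a \<Rightarrow> real" and a b :: real
  assumes W: "white_noise M W" and X: "has_walsh_integral M W f X" and Y: "has_walsh_integral M W g Y"
  shows "has_walsh_integral M W (\<lambda>p. a * f p + b * g p) (\<lambda>\<omega>. a * X \<omega> + b * Y \<omega>)"
proof -
  obtain S c where [measurable]: "f \<in> borel_measurable borel" "X \<in> borel_measurable M"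
    and S: "\<forall>n::nat. finite (S n) \<and> S n \<subseteq> noise_sets"
      "(\<lambda>n. \<integral>\<^sup>+ p. ennreal ((f p - (\<Sum>A\<in>S n. c n A * indicator A p))\<^sup>2) \<partial>lborel) \<longlonglongrightarrow> 0"
      "(\<lambda>n. \<integral>\<^sup>+ \<omega>. ennreal ((X \<omega> - (\<Sum>A\<in>S n. c n A * W A \<omega>))\<^sup>2) \<partial>M) \<longlonglongrightarrow> 0"
    by (rule has_walsh_integralE[OF X], rule that)
  obtain T d where [measurable]: "g \<in> borel_measurable borel" "Y \<in> borel_measurable M"
    and T: "\<forall>n::nat. finite (T n) \<and> T n \<subseteq> noise_sets"
      "(\<lambda>n. \<integral>\<^sup>+ p. ennreal ((g p - (\<Sum>A\<in>T n. d n A * indicator A p))\<^sup>2) \<partial>lborel) \<longlonglongrightarrow> 0"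
      "(\<lambda>n. \<integral>\<^sup>+ \<omega>. ennreal ((Y \<omega> - (\<Sum>A\<in>T n. d n A * W A \<omega>))\<^sup>2) \<partial>M) \<longlonglongrightarrow> 0"
    by (rule has_walsh_integralE[OF Y], rule that)
  have noise_meas: "(\<lambda>\<omega>. \<Sum>A\<in>U. e A * W A \<omega>) \<in> borel_measurable M" if "finite U" "U \<subseteq> noise_sets" for U and e :: "(real \<times> real) set \<Rightarrow> real"
    using white_noise_sum_gaussian[OF W that] by (simp add: centered_gaussian_def)
  have step_meas: "(\<lambda>p. \<Sum>A\<in>U. e A * indicator A p) \<in> borel_measurable lborel"
    if "finite U" "U \<subseteq> noise_sets" for U and e :: "(real \<times> real) set \<Rightarrow> real"
    using square_integrable_step[of U e] that by (simp add: square_integrable_def)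
  have ST: "finite (S n)" "S n \<subseteq> noise_sets" "finite (T n)" "T n \<subseteq> noise_sets" for n
    using S(1) T(1) by auto
  note step = step_meas[OF ST(1,2)] step_meas[OF ST(3,4)]
    and noise = noise_meas[OF ST(1,2)] noise_meas[OF ST(3,4)]
  have fg: "f \<in> borel_measurable lborel" "g \<in> borel_measurable lborel"
    and XY: "X \<in> borel_measurable M" "Y \<in> borel_measurable M" by simp_all
  define e where "e n A = a * (if A \<in> S n then c n A else 0) + b * (if A \<in> T n then d n A else 0)" for n A
  have comb: "(\<Sum>A\<in>S n \<union> T n. e n A * F A) = a * (\<Sum>A\<in>S n. c n A * F A) + b * (\<Sum>A\<in>T n. d n A * F A)" for n F
    unfolding e_def using S(1) T(1) by (intro sum_union_coefficients) auto
  have diff: "a * x + b * y - (a * s + b * t) = a * (x - s) + b * (y - t)" for x y s t :: real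
    by (simp add: algebra_simps)
  show ?thesis
    unfolding has_walsh_integral_def
  proof (intro conjI exI[of _ "\<lambda>n. S n \<union> T n"] exI[of _ e] allI)
    show "finite (S n \<union> T n)" "S n \<union> T n \<subseteq> noise_sets" for n using S(1) T(1) by auto
    show "(\<lambda>n. \<integral>\<^sup>+ p. ennreal ((a * f p + b * g p - (\<Sum>A\<in>S n \<union> T n. e n A * indicator A p))\<^sup>2) \<partial>lborel) \<longlonglongrightarrow> 0"
      unfolding comb diff
      by (rule nn_square_sum_tendsto_0[OF _ _ S(2) T(2)]; intro borel_measurable_diff fg step)
    show "(\<lambda>n. \<integral>\<^sup>+ \<omega>. ennreal ((a * X \<omega> + b * Y \<omega> - (\<Sum>A\<in>S n \<union> T n. e n A * W A \<omega>))\<^sup>2) \<partial>M) \<longlonglongrightarrow> 0"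
      unfolding comb diff
      by (rule nn_square_sum_tendsto_0[OF _ _ S(3) T(3)]; intro borel_measurable_diff XY noise)
  qed auto
qed

lemma walsh_integral_cong_AE:
  fixes f g :: "real \<times> real \<Rightarrow> real"
  assumes X: "has_walsh_integral M W f X" and eq: "AE p in lborel. f p = g p"
    and g: "g \<in> borel_measurable borel"
  shows "has_walsh_integral M W g X"
proof -
  have "(\<integral>\<^sup>+ p. ennreal ((f p - h p)\<^sup>2) \<partial>lborel) = (\<integral>\<^sup>+ p. ennreal ((g p - h p)\<^sup>2) \<partial>lborel)" for h :: "real \<times> real \<Rightarrow> real"
    by (rule nn_integral_cong_AE) (use eq in auto)
  then show ?thesis using X g unfolding has_walsh_integral_def by (simp only: simp_thms)
qed

section \<open>The fundamental solution\<close>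

text \<open>The power series of \<open>J\<^sub>0 (sqrt (\<gamma> z))\<close>, which stays real and entire for every sign of \<open>\<gamma>\<close> and \<open>z\<close>.\<close>

definition kg_profile :: "real \<Rightarrow> real \<Rightarrow> real" where
  "kg_profile \<gamma> z = (\<Sum>k. ((- \<gamma> / 4) ^ k / (fact k)\<^sup>2) * z ^ k)"

lemma kg_coeff_bound:
  fixes \<gamma> z :: real
  shows "norm ((- \<gamma> / 4) ^ k / (fact k)\<^sup>2 * z ^ k) \<le> (\<bar>\<gamma>\<bar> / 4 * \<bar>z\<bar>) ^ k / fact k"
proof -
  have "norm ((- \<gamma> / 4) ^ k / (fact k)\<^sup>2 * z ^ k) = (\<bar>\<gamma>\<bar> / 4 * \<bar>z\<bar>) ^ k / (fact k)\<^sup>2"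
    unfolding norm_mult norm_divide norm_power by (simp add: power_mult_distrib power_divide)
  also have "\<dots> \<le> (\<bar>\<gamma>\<bar> / 4 * \<bar>z\<bar>) ^ k / fact k"
    by (intro divide_left_mono) (auto simp: power2_eq_square fact_ge_1)
  finally show ?thesis .
qed

lemma summable_power_fact: "summable (\<lambda>k. (x::real) ^ k / fact k)"
  using summable_exp[of x] by (simp add: divide_inverse mult.commute)

lemma kg_summable_norm:
  fixes \<gamma> z :: real
  shows "summable (\<lambda>k. norm ((- \<gamma> / 4) ^ k / (fact k)\<^sup>2 * z ^ k))"
  by (rule summable_comparison_test'[OF summable_power_fact, of 0])
     (use kg_coeff_bound[of \<gamma> _ z] in simp)

lemma kg_summable:
  fixes \<gamma> z :: real
  shows "summable (\<lambda>k. (- \<gamma> / 4) ^ k / (fact k)\<^sup>2 * z ^ k)"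
  by (rule summable_norm_cancel[OF kg_summable_norm])

definition kg_profile' :: "real \<Rightarrow> real \<Rightarrow> real" where
  "kg_profile' \<gamma> z = (\<Sum>k. diffs (\<lambda>k. (- \<gamma> / 4) ^ k / (fact k)\<^sup>2) k * z ^ k)"

lemma kg_profile_deriv: "(kg_profile \<gamma> has_real_derivative kg_profile' \<gamma> z) (at z)"
  unfolding kg_profile_def kg_profile'_def
  by (rule termdiffs_strong_converges_everywhere[OF kg_summable])

lemma kg_profile_isCont: "isCont (kg_profile \<gamma>) z"
  using kg_profile_deriv by (rule DERIV_isCont)

lemma kg_profile'_isCont: "isCont (kg_profile' \<gamma>) z"
proof -
  let ?d = "diffs (\<lambda>k. (- \<gamma> / 4) ^ k / (fact k)\<^sup>2)"
  have s: "summable (\<lambda>n. ?d n * y ^ n)" for y :: real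
    by (rule termdiff_converges_all[OF kg_summable])
  have "((\<lambda>x. \<Sum>n. ?d n * x ^ n) has_real_derivative (\<Sum>n. diffs ?d n * z ^ n)) (at z)"
    by (rule termdiffs_strong_converges_everywhere[OF s])
  then show ?thesis unfolding kg_profile'_def[abs_def] by (rule DERIV_isCont)
qed

lemma kg_profile_0: "kg_profile \<gamma> 0 = 1"
proof -
  have "(\<lambda>k. ((- \<gamma> / 4) ^ k / (fact k)\<^sup>2) * 0 ^ k) sums ((- \<gamma> / 4) ^ 0 / (fact 0)\<^sup>2)"
    by (rule powser_sums_zero)
  then show ?thesis unfolding kg_profile_def by (simp add: sums_iff)
qed

lemma kg_profile_measurable [measurable]: "kg_profile \<gamma> \<in> borel_measurable borel"
  by (intro borel_measurable_continuous_onI continuous_at_imp_continuous_on ballI kg_profile_isCont)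

lemma integrable_cts_interval:
  fixes f :: "real \<Rightarrow> real"
  assumes "\<And>x. isCont f x"
  shows "integrable lborel (\<lambda>x. f x * indicator {a..b} x)"
  using assms by (rule borel_integrable_atLeastAtMost)

text \<open>A Beta integral. Induction on \<open>k\<close> through \<open>(t\<^sup>2 - x\<^sup>2) ^ Suc k = t\<^sup>2 (t\<^sup>2 - x\<^sup>2) ^ k - x\<^sup>2 (t\<^sup>2 - x\<^sup>2) ^ k\<close> avoids the
Gamma function at half-integers.\<close>

lemma beta_moment:
  fixes t :: real
  assumes "0 \<le> t"
  shows "(LINT x|lborel. (t\<^sup>2 - x\<^sup>2) ^ k * x ^ (2 * j) * indicator {- t..t} x)
    = 2 * 4 ^ k * fact k * fact (2 * j) * fact (j + k) * t ^ (2 * (j + k) + 1) / (fact j * fact (2 * (j + k) + 1))"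
proof (induction k arbitrary: j)
  case 0
  have "(LINT x|lborel. x ^ (2 * j) * indicator {- t..t} x) = (t ^ Suc (2 * j) - (- t) ^ Suc (2 * j)) / Suc (2 * j)"
    using assms by (intro integral_power) simp
  also have "\<dots> = 2 * t ^ (2 * j + 1) / (2 * real j + 1)" by simp
  also have "\<dots> = 2 * 4 ^ 0 * fact 0 * fact (2 * j) * fact (j + 0) * t ^ (2 * (j + 0) + 1) / (fact j * fact (2 * (j + 0) + 1))"
  proof -
    have "(fact (2 * j + 1) :: real) = (2 * real j + 1) * fact (2 * j)" by simp
    moreover have "2 * real j + 1 \<noteq> 0" by linarith
    ultimately show ?thesis by (simp only: add_0_right) simp
  qed
  finally show ?case by simp
next
  case (Suc k)
  let ?J = "\<lambda>k j. LINT x|lborel. (t\<^sup>2 - x\<^sup>2) ^ k * x ^ (2 * j) * indicator {- t..t} x"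
  have int: "integrable lborel (\<lambda>x. (t\<^sup>2 - x\<^sup>2) ^ k * x ^ (2 * j) * indicator {- t..t} x)" for j
    by (rule integrable_cts_interval) (intro continuous_intros)
  have eq: "(t\<^sup>2 - x\<^sup>2) ^ Suc k * x ^ (2 * j) * i
      = t\<^sup>2 * ((t\<^sup>2 - x\<^sup>2) ^ k * x ^ (2 * j) * i) - (t\<^sup>2 - x\<^sup>2) ^ k * x ^ (2 * Suc j) * i" for x i :: real
  proof -
    have "x ^ (2 * Suc j) = x\<^sup>2 * x ^ (2 * j)" by (simp add: power2_eq_square)
    then show ?thesis by (simp only: power_Suc left_diff_distrib right_diff_distrib mult_ac)
  qed
  have "?J (Suc k) j = t\<^sup>2 * ?J k j - ?J k (Suc j)"
    unfolding eq by (subst Bochner_Integration.integral_diff[OF integrable_mult_right[OF int] int]) (simp only: integral_mult_right_zero)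
  also have "\<dots> = 2 * 4 ^ Suc k * fact (Suc k) * fact (2 * j) * fact (j + Suc k) * t ^ (2 * (j + Suc k) + 1)
      / (fact j * fact (2 * (j + Suc k) + 1))"
  proof -
    define n where "n = j + k"
    define F :: real where "F = 2 * 4 ^ k * fact k * fact (2 * j) * fact n * t ^ (2 * n + 3) / (fact j * fact (2 * n + 1))"
    have f2: "fact (2 * n + 3) = (2 * real n + 3) * (2 * real n + 2) * fact (2 * n + 1)"
      by (simp add: numeral_3_eq_3 algebra_simps)
    have "t\<^sup>2 * ?J k j = F"
      unfolding Suc.IH F_def n_def by (simp add: power_add power2_eq_square numeral_3_eq_3)
    moreover have "?J k (Suc j) = F * ((2 * real j + 1) / (2 * real n + 3))"
    proof -
      have a: "Suc j + k = Suc n" "2 * Suc n + 1 = 2 * n + 3" by (auto simp: n_def)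
      have b: "fact (2 * Suc j) = (2 * real j + 2) * (2 * real j + 1) * fact (2 * j)"
        by (simp add: algebra_simps)
      have c: "fact (Suc n) = (real n + 1) * fact n" "fact (Suc j) = (real j + 1) * fact j"
        by (simp_all add: algebra_simps)
      have "?J k (Suc j) = 2 * 4 ^ k * fact k * ((2 * real j + 2) * (2 * real j + 1) * fact (2 * j))
          * ((real n + 1) * fact n) * t ^ (2 * n + 3) / ((real j + 1) * fact j * ((2 * real n + 3) * (2 * real n + 2) * fact (2 * n + 1)))"
        unfolding Suc.IH a b c f2 by simp
      also have "\<dots> = F * ((2 * real j + 1) / (2 * real n + 3))"
      proof -
        have "(2 * real j + 2) = 2 * (real j + 1)" "(2 * real n + 2) = 2 * (real n + 1)" by auto
        moreover have "real j + 1 \<noteq> 0" "real n + 1 \<noteq> 0" "2 * real n + 3 \<noteq> 0" by linarith+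
        ultimately show ?thesis unfolding F_def by (simp add: divide_simps) (simp add: algebra_simps)
      qed
      finally show ?thesis .
    qed
    moreover have "F - F * ((2 * real j + 1) / (2 * real n + 3)) = F * (2 * (real k + 1) / (2 * real n + 3))"
    proof -
      have "2 * real n + 3 \<noteq> 0" "real n = real j + real k" by (auto simp: n_def)
      then have "1 - (2 * real j + 1) / (2 * real n + 3) = 2 * (real k + 1) / (2 * real n + 3)"
        by (simp add: field_simps)
      then show ?thesis by (metis mult_1_right right_diff_distrib)
    qed
    moreover have "2 * 4 ^ Suc k * fact (Suc k) * fact (2 * j) * fact (j + Suc k) * t ^ (2 * (j + Suc k) + 1)
        / (fact j * fact (2 * (j + Suc k) + 1)) = F * (2 * (real k + 1) / (2 * real n + 3))"
    proof -
      have a: "j + Suc k = Suc n" "2 * Suc n + 1 = 2 * n + 3" by (auto simp: n_def)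
      have c: "fact (Suc n) = (real n + 1) * fact n" "fact (Suc k) = (real k + 1) * fact k"
        by (simp_all add: algebra_simps)
      have "(2 * real n + 2) = 2 * (real n + 1)" by simp
      moreover have "real n + 1 \<noteq> 0" "2 * real n + 3 \<noteq> 0" by linarith+
      ultimately show ?thesis unfolding F_def a c f2 by (simp add: divide_simps) (simp add: algebra_simps)
    qed
    ultimately show ?thesis by simp
  qed
  finally show ?case .
qed

text \<open>The three cases of the symbol are one entire function of \<open>w = \<xi>\<^sup>2 + m\<^sup>2 - a\<^sup>2 / 4\<close>, the power series of
\<open>sin (t sqrt w) / sqrt w\<close>.\<close>

lemma kg_symbol_sums:
  fixes a m t \<xi> :: real
  shows "(\<lambda>n. exp (- a * t / 2) * ((- 1) ^ n * (\<xi>\<^sup>2 + (m\<^sup>2 - a\<^sup>2 / 4)) ^ n * t ^ (2 * n + 1) / fact (2 * n + 1)))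
    sums klein_gordon_symbol a m t \<xi>"
proof -
  define w where "w = \<xi>\<^sup>2 + (m\<^sup>2 - a\<^sup>2 / 4)"
  let ?T = "\<lambda>n. (- 1) ^ n * w ^ n * t ^ (2 * n + 1) / fact (2 * n + 1)"
  consider "0 < w" | "w = 0" | "w < 0" by linarith
  then show ?thesis
  proof cases
    case 1
    have c: "\<xi>\<^sup>2 > a\<^sup>2 / 4 - m\<^sup>2" "\<xi>\<^sup>2 + m\<^sup>2 - a\<^sup>2 / 4 = w" using 1 by (auto simp: w_def)
    have "(\<lambda>n. (- 1) ^ n / fact (2 * n + 1) * (t * sqrt w) ^ (2 * n + 1) / sqrt w) sums (sin (t * sqrt w) / sqrt w)"
      by (intro sums_divide sin_paired)
    moreover have "(- 1) ^ n / fact (2 * n + 1) * (t * sqrt w) ^ (2 * n + 1) / sqrt w = ?T n" for n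
    proof -
      have "(t * sqrt w) ^ (2 * n + 1) = t ^ (2 * n + 1) * (w ^ n * sqrt w)"
        using 1 by (simp add: power_mult_distrib power_mult)
      then have "(- 1) ^ n / fact (2 * n + 1) * (t * sqrt w) ^ (2 * n + 1) / sqrt w
          = (- 1) ^ n / fact (2 * n + 1) * (t ^ (2 * n + 1) * (w ^ n * sqrt w)) / sqrt w" by (simp only:)
      then show ?thesis using 1 by (simp add: mult_ac)
    qed
    ultimately have "?T sums (sin (t * sqrt w) / sqrt w)" by (simp only:)
    from sums_mult[OF this, of "exp (- a * t / 2)"] show ?thesis
      unfolding klein_gordon_symbol_def c(2) w_def[symmetric] by (simp only: c(1) if_True)
  next
    case 2
    have "\<not> \<xi>\<^sup>2 > a\<^sup>2 / 4 - m\<^sup>2" "\<xi>\<^sup>2 = a\<^sup>2 / 4 - m\<^sup>2" using 2 by (auto simp: w_def)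
    then have "klein_gordon_symbol a m t \<xi> = exp (- a * t / 2) * t" by (simp add: klein_gordon_symbol_def)
    moreover have "?T sums t"
      using sums_finite[of "{0}" ?T] 2 by simp
    ultimately show ?thesis unfolding w_def[symmetric] by (simp only: sums_mult)
  next
    case 3
    let ?s = "sqrt (- w)"
    have c: "\<not> \<xi>\<^sup>2 > a\<^sup>2 / 4 - m\<^sup>2" "\<xi>\<^sup>2 \<noteq> a\<^sup>2 / 4 - m\<^sup>2" "a\<^sup>2 / 4 - m\<^sup>2 - \<xi>\<^sup>2 = - w" using 3 by (auto simp: w_def)
    have "(\<lambda>n. if even n then 0 else (t * ?s) ^ n /\<^sub>R fact n) sums sinh (t * ?s)"
      by (rule sinh_converges)
    then have "(\<lambda>n. (t * ?s) ^ (2 * n + 1) /\<^sub>R fact (2 * n + 1)) sums sinh (t * ?s)"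
      by (subst (asm) sums_mono_reindex[of "\<lambda>n. 2 * n + 1", symmetric])
         (auto simp: strict_mono_def image_iff elim!: oddE)
    then have "(\<lambda>n. (t * ?s) ^ (2 * n + 1) /\<^sub>R fact (2 * n + 1) / ?s) sums (sinh (t * ?s) / ?s)"
      by (rule sums_divide)
    moreover have "(t * ?s) ^ (2 * n + 1) /\<^sub>R fact (2 * n + 1) / ?s = ?T n" for n
    proof -
      have "?s ^ (2 * n + 1) = (?s ^ 2) ^ n * ?s" by (simp only: power_add power_mult power_one_right)
      then have "?s ^ (2 * n + 1) = (- w) ^ n * ?s" using 3 by simp
      then have "(t * ?s) ^ (2 * n + 1) = t ^ (2 * n + 1) * ((- w) ^ n * ?s)"
        by (simp only: power_mult_distrib)
      moreover have "(- w) ^ n = (- 1) ^ n * w ^ n" by (rule power_minus)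
      ultimately have "(t * ?s) ^ (2 * n + 1) /\<^sub>R fact (2 * n + 1) / ?s
          = (t ^ (2 * n + 1) * ((- 1) ^ n * w ^ n * ?s)) /\<^sub>R fact (2 * n + 1) / ?s" by (simp only:)
      also have "\<dots> = ?T n" using 3 by (simp add: divide_inverse mult_ac)
      finally show ?thesis .
    qed
    ultimately have "?T sums (sinh (t * ?s) / ?s)" by (simp only:)
    from sums_mult[OF this, of "exp (- a * t / 2)"] show ?thesis
      unfolding klein_gordon_symbol_def c(3) w_def[symmetric] by (simp only: c(1,2) if_False)
  qed
qed

text \<open>Multiply the power series of \<open>kg_profile\<close> and of the cosine as a Cauchy product. Its \<open>n\<close>-th term \<open>H n\<close> integrates by
\<open>beta_moment\<close> to a multiple of \<open>\<Sum>k\<le>n. (n choose k) * \<gamma> ^ k * (\<xi>\<^sup>2) ^ (n - k)\<close>, which is where \<open>(\<xi>\<^sup>2 + \<gamma>) ^ n\<close> comes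
from. The series \<open>h\<close> of the absolute bounds dominates the terms uniformly on the interval and justifies
termwise integration.\<close>

lemma kg_cos_transform:
  fixes t \<xi> \<gamma> :: real
  assumes t: "0 \<le> t"
  shows "(\<lambda>n. 2 * ((- 1) ^ n * (\<xi>\<^sup>2 + \<gamma>) ^ n * t ^ (2 * n + 1) / fact (2 * n + 1)))
    sums (LINT x|lborel. kg_profile \<gamma> (t\<^sup>2 - x\<^sup>2) * cos (x * \<xi>) * indicator {- t..t} x)"
proof -
  define A where "A k x = (- \<gamma> / 4) ^ k / (fact k)\<^sup>2 * (t\<^sup>2 - x\<^sup>2) ^ k" for k and x :: real
  define B where "B j x = (- 1) ^ j / fact (2 * j) * (x * \<xi>) ^ (2 * j)" for j and x :: real
  define a where "a k = (\<bar>\<gamma>\<bar> / 4 * t\<^sup>2) ^ k / fact k" for k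
  define b where "b j = (t * \<bar>\<xi>\<bar>) ^ (2 * j) / fact (2 * j)" for j
  have summ_b: "summable (\<lambda>j. (r::real) ^ (2 * j) / fact (2 * j))" for r
  proof (rule summable_comparison_test'[OF summable_power_fact[of "r\<^sup>2"], of 0])
    fix n :: nat
    have "(fact n :: real) \<le> fact (2 * n)" by (rule fact_mono) simp
    then show "norm (r ^ (2 * n) / fact (2 * n)) \<le> (r\<^sup>2) ^ n / fact n"
      by (simp add: power_mult divide_left_mono)
  qed
  have sumA: "summable (\<lambda>k. norm (A k x))" for x unfolding A_def by (rule kg_summable_norm)
  have sumB: "summable (\<lambda>j. norm (B j x))" for x
  proof -
    have "norm (B j x) = (x * \<xi>) ^ (2 * j) / fact (2 * j)" for j
    proof -
      have "norm ((x * \<xi>) ^ (2 * j)) = (x * \<xi>) ^ (2 * j)" by (simp only: real_norm_def abs_of_nonneg zero_le_even_power dvd_triv_left)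
      then show ?thesis
        unfolding B_def norm_mult[of "(- 1) ^ j / fact (2 * j)"] by (simp add: norm_divide norm_power)
    qed
    then show ?thesis using summ_b[of "x * \<xi>"] by (simp only:)
  qed
  define H where "H n x = (\<Sum>k\<le>n. A k x * B (n - k) x)" for n and x :: real
  define h where "h n = (\<Sum>k\<le>n. a k * b (n - k))" for n
  have a0: "0 \<le> a k" for k by (simp add: a_def)
  have b0: "0 \<le> b k" for k using t by (simp add: b_def)
  have Hs: "(\<lambda>n. H n x) sums (kg_profile \<gamma> (t\<^sup>2 - x\<^sup>2) * cos (x * \<xi>))" for x
  proof -
    have "(\<lambda>n. H n x) sums ((\<Sum>k. A k x) * (\<Sum>k. B k x))"
      unfolding H_def by (rule Cauchy_product_sums[OF sumA sumB])
    moreover have "(\<Sum>k. A k x) = kg_profile \<gamma> (t\<^sup>2 - x\<^sup>2)" by (simp add: A_def kg_profile_def)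
    moreover have "(\<Sum>k. B k x) = cos (x * \<xi>)" using cos_paired[of "x * \<xi>"] by (simp add: B_def sums_iff)
    ultimately show ?thesis by simp
  qed
  have hs: "summable h"
    unfolding h_def
  proof (rule summable_Cauchy_product)
    show "summable (\<lambda>k. norm (a k))" using a0 summable_power_fact[of "\<bar>\<gamma>\<bar> / 4 * t\<^sup>2"] by (simp add: a_def)
    show "summable (\<lambda>k. norm (b k))" using b0 summ_b[of "t * \<bar>\<xi>\<bar>"] by (simp add: b_def)
  qed
  have Hh: "norm (H n x) \<le> h n" if x: "x \<in> {- t..t}" for n x
  proof -
    have x2: "x\<^sup>2 \<le> t\<^sup>2" using x by (simp add: abs_le_square_iff[symmetric] abs_le_iff)
    have "norm (A k x) \<le> a k" for k
    proof -
      have "norm (A k x) \<le> (\<bar>\<gamma>\<bar> / 4 * \<bar>t\<^sup>2 - x\<^sup>2\<bar>) ^ k / fact k" unfolding A_def by (rule kg_coeff_bound)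
      also have "\<dots> \<le> a k"
        unfolding a_def using x2 by (intro divide_right_mono power_mono mult_left_mono) auto
      finally show ?thesis .
    qed
    moreover have "norm (B j x) \<le> b j" for j
    proof -
      have "\<bar>x\<bar> * \<bar>\<xi>\<bar> \<le> t * \<bar>\<xi>\<bar>" using x by (intro mult_right_mono) auto
      then have "(\<bar>x\<bar> * \<bar>\<xi>\<bar>) ^ (2 * j) \<le> (t * \<bar>\<xi>\<bar>) ^ (2 * j)" by (rule power_mono) simp
      then have "\<bar>x * \<xi>\<bar> ^ (2 * j) \<le> (t * \<bar>\<xi>\<bar>) ^ (2 * j)" by (simp only: abs_mult)
      then show ?thesis
        unfolding B_def b_def norm_mult norm_divide norm_power by (simp add: divide_right_mono abs_mult)
    qed
    ultimately show ?thesis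
      unfolding H_def h_def
      by (intro order_trans[OF norm_sum] sum_mono) (auto simp: abs_mult intro!: mult_mono a0)
  qed
  have Hc: "isCont (H n) x" for n x
    unfolding H_def A_def B_def by (intro continuous_intros)
  have int: "integrable lborel (\<lambda>x. H n x * indicator {- t..t} x)" for n
    by (rule integrable_cts_interval[OF Hc])
  have bnd: "norm (H n x * indicator {- t..t} x) \<le> h n * indicator {- t..t} x" for n x
    using Hh[of x n] by (auto simp: indicator_def)
  have "(\<lambda>n. LINT x|lborel. H n x * indicator {- t..t} x) sums (LINT x|lborel. (\<Sum>n. H n x * indicator {- t..t} x))"
  proof (rule sums_integral[OF int])
    show "AE x in lborel. summable (\<lambda>n. norm (H n x * indicator {- t..t} x))"
    proof (intro AE_I2)
      fix x :: real
      show "summable (\<lambda>n. norm (H n x * indicator {- t..t} x))"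
        by (rule summable_comparison_test'[OF summable_mult2[OF hs, of "indicator {- t..t} x"], of 0])
           (use bnd in simp)
    qed
    show "summable (\<lambda>n. LINT x|lborel. norm (H n x * indicator {- t..t} x))"
    proof (rule summable_comparison_test'[OF summable_mult2[OF hs, of "2 * t"], of 0])
      fix n :: nat
      have "(LINT x|lborel. norm (H n x * indicator {- t..t} x)) \<le> (LINT x|lborel. h n * indicator {- t..t} x)"
        by (intro integral_mono integrable_norm int bnd integrable_mult_right integrable_real_indicator)
          (auto simp: emeasure_lborel_Icc_eq)
      also have "\<dots> = h n * (2 * t)" using t by simp
      finally show "norm (LINT x|lborel. norm (H n x * indicator {- t..t} x)) \<le> h n * (2 * t)" by simp
    qed
  qed
  moreover have "(\<Sum>n. H n x * indicator {- t..t} x) = kg_profile \<gamma> (t\<^sup>2 - x\<^sup>2) * cos (x * \<xi>) * indicator {- t..t} x" for x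
    using sums_mult2[OF Hs[of x], of "indicator {- t..t} x"] by (simp add: sums_iff)
  moreover have "(LINT x|lborel. H n x * indicator {- t..t} x)
      = 2 * ((- 1) ^ n * (\<xi>\<^sup>2 + \<gamma>) ^ n * t ^ (2 * n + 1) / fact (2 * n + 1))" for n
  proof -
    have eq: "H n x * i = (\<Sum>k\<le>n. ((- \<gamma> / 4) ^ k / (fact k)\<^sup>2 * ((- 1) ^ (n - k) * \<xi> ^ (2 * (n - k)) / fact (2 * (n - k))))
        * ((t\<^sup>2 - x\<^sup>2) ^ k * x ^ (2 * (n - k)) * i))" for x i
      unfolding H_def A_def B_def sum_distrib_right
      by (intro sum.cong refl) (simp add: power_mult_distrib)
    have int2: "integrable lborel (\<lambda>x. (t\<^sup>2 - x\<^sup>2) ^ k * x ^ (2 * j) * indicator {- t..t} x)" for j k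
      by (rule integrable_cts_interval) (intro continuous_intros)
    have "(LINT x|lborel. H n x * indicator {- t..t} x)
      = (\<Sum>k\<le>n. ((- \<gamma> / 4) ^ k / (fact k)\<^sup>2 * ((- 1) ^ (n - k) * \<xi> ^ (2 * (n - k)) / fact (2 * (n - k))))
        * (LINT x|lborel. (t\<^sup>2 - x\<^sup>2) ^ k * x ^ (2 * (n - k)) * indicator {- t..t} x))"
      unfolding eq by (subst Bochner_Integration.integral_sum) (auto intro!: integrable_mult_right int2)
    also have "\<dots> = (\<Sum>k\<le>n. 2 * ((- 1) ^ n * t ^ (2 * n + 1) / fact (2 * n + 1)) * (of_nat (n choose k) * \<gamma> ^ k * (\<xi>\<^sup>2) ^ (n - k)))"
    proof (intro sum.cong refl)
      fix k assume "k \<in> {..n}"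
      then have k: "k \<le> n" by simp
      have s: "(- \<gamma> / 4) ^ k * (- 1) ^ (n - k) = (- 1) ^ n * \<gamma> ^ k / 4 ^ k"
      proof -
        have "(- \<gamma> / 4) ^ k = (- 1) ^ k * \<gamma> ^ k / 4 ^ k" unfolding power_divide power_minus[of \<gamma>] ..
        moreover have "(- 1 :: real) ^ k * (- 1) ^ (n - k) = (- 1) ^ n" using k by (simp flip: power_add)
        ultimately show ?thesis by (simp add: mult_ac)
      qed
      have "((- \<gamma> / 4) ^ k / (fact k)\<^sup>2 * ((- 1) ^ (n - k) * \<xi> ^ (2 * (n - k)) / fact (2 * (n - k))))
        * (LINT x|lborel. (t\<^sup>2 - x\<^sup>2) ^ k * x ^ (2 * (n - k)) * indicator {- t..t} x)
        = ((- \<gamma> / 4) ^ k * (- 1) ^ (n - k)) / (fact k)\<^sup>2 * (\<xi> ^ (2 * (n - k)) / fact (2 * (n - k)))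
          * (2 * 4 ^ k * fact k * fact (2 * (n - k)) * fact n * t ^ (2 * n + 1) / (fact (n - k) * fact (2 * n + 1)))"
        unfolding beta_moment[OF t] using k by simp
      also have "\<dots> = 2 * ((- 1) ^ n * t ^ (2 * n + 1) / fact (2 * n + 1)) * ((fact n / (fact k * fact (n - k))) * \<gamma> ^ k * (\<xi>\<^sup>2) ^ (n - k))"
        unfolding s power_mult by (simp add: power2_eq_square divide_simps)
      also have "fact n / (fact k * fact (n - k)) = real (n choose k)"
        using binomial_fact[OF k, where 'a = real] by simp
      finally show "((- \<gamma> / 4) ^ k / (fact k)\<^sup>2 * ((- 1) ^ (n - k) * \<xi> ^ (2 * (n - k)) / fact (2 * (n - k))))
        * (LINT x|lborel. (t\<^sup>2 - x\<^sup>2) ^ k * x ^ (2 * (n - k)) * indicator {- t..t} x)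
        = 2 * ((- 1) ^ n * t ^ (2 * n + 1) / fact (2 * n + 1)) * (of_nat (n choose k) * \<gamma> ^ k * (\<xi>\<^sup>2) ^ (n - k))" .
    qed
    also have "\<dots> = 2 * ((- 1) ^ n * t ^ (2 * n + 1) / fact (2 * n + 1)) * (\<gamma> + \<xi>\<^sup>2) ^ n"
      by (simp only: binomial_ring sum_distrib_left)
    finally show ?thesis by (simp add: add.commute)
  qed
  ultimately show ?thesis by simp
qed

lemma integrable_mult_iexp:
  fixes f :: "real \<Rightarrow> real"
  assumes f: "integrable lborel f"
  shows "integrable lborel (\<lambda>x. complex_of_real (f x) * iexp (\<xi> * x))"
proof (rule Bochner_Integration.integrable_bound[OF f])
  have "f \<in> borel_measurable borel" using f by (simp add: integrable_iff_bounded)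
  then show "(\<lambda>x. complex_of_real (f x) * iexp (\<xi> * x)) \<in> borel_measurable lborel" by measurable
  show "AE x in lborel. norm (complex_of_real (f x) * iexp (\<xi> * x)) \<le> norm (f x)"
    unfolding norm_mult norm_exp_i_times by simp
qed

text \<open>The positive and negative parts of \<open>h\<close> have the same transform, in particular, at frequency 0, the same mass. Unless both
vanish, normalised by this mass they are
densities of probability laws with equal characteristic functions.\<close>

lemma fourier_transform_eq_0:
  fixes h :: "real \<Rightarrow> real"
  assumes h: "integrable lborel h"
    and zero: "\<And>\<xi>. (CLINT x|lborel. complex_of_real (h x) * iexp (\<xi> * x)) = 0"
  shows "AE x in lborel. h x = 0"
proof -
  define p q where "p x = max 0 (h x)" and "q x = max 0 (- h x)" for x
  have [measurable]: "h \<in> borel_measurable borel" using h by (simp add: integrable_iff_bounded)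
  have p: "integrable lborel p" and q: "integrable lborel q"
    unfolding p_def q_def using h by (auto intro!: integrable_max)
  have [measurable]: "p \<in> borel_measurable borel" "q \<in> borel_measurable borel"
    unfolding p_def q_def by measurable
  have nonneg: "0 \<le> p x" "0 \<le> q x" for x by (auto simp: p_def q_def)
  have hpq: "h x = p x - q x" for x by (auto simp: p_def q_def)
  have eq: "(CLINT x|lborel. complex_of_real (p x) * iexp (\<xi> * x)) = (CLINT x|lborel. complex_of_real (q x) * iexp (\<xi> * x))" for \<xi>
  proof -
    have "complex_of_real (h x) * iexp (\<xi> * x) = complex_of_real (p x) * iexp (\<xi> * x) - complex_of_real (q x) * iexp (\<xi> * x)" for x
      unfolding hpq of_real_diff by (rule left_diff_distrib)
    then have "(CLINT x|lborel. complex_of_real (p x) * iexp (\<xi> * x)) - (CLINT x|lborel. complex_of_real (q x) * iexp (\<xi> * x)) = 0"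
      using zero[of \<xi>] by (simp only: Bochner_Integration.integral_diff[OF integrable_mult_iexp[OF p] integrable_mult_iexp[OF q]])
    then show ?thesis by simp
  qed
  define m where "m = integral\<^sup>L lborel p"
  have m_q: "m = integral\<^sup>L lborel q" using eq[of 0] by (simp add: m_def)
  have m0: "0 \<le> m" unfolding m_def using nonneg by simp
  show ?thesis
  proof (cases "m = 0")
    case True
    have "AE x in lborel. p x = 0" "AE x in lborel. q x = 0"
      using True m_q integral_nonneg_eq_0_iff_AE[OF p] integral_nonneg_eq_0_iff_AE[OF q] nonneg
      by (auto simp: m_def)
    then show ?thesis by eventually_elim (simp add: hpq)
  next
    case False
    then have m: "0 < m" using m0 by simp
    have dist: "real_distribution (density lborel (\<lambda>x. ennreal (f x / m)))"
      if f: "integrable lborel f" "\<And>x. 0 \<le> f x" "integral\<^sup>L lborel f = m" for f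
    proof -
      have [measurable]: "f \<in> borel_measurable borel" using f by (simp add: integrable_iff_bounded)
      have "(\<integral>\<^sup>+ x. ennreal (f x / m) \<partial>lborel) = ennreal (LINT x|lborel. f x / m)"
        by (rule nn_integral_eq_integral) (use f m in auto)
      also have "\<dots> = 1" using f m by simp
      finally have "prob_space (density lborel (\<lambda>x. ennreal (f x / m)))"
        by (intro prob_spaceI) (simp add: emeasure_density)
      then show ?thesis by (simp add: real_distribution_def real_distribution_axioms_def)
    qed
    have ch: "char (density lborel (\<lambda>x. ennreal (f x / m))) \<xi> = (CLINT x|lborel. complex_of_real (f x) * iexp (\<xi> * x)) / complex_of_real m"
      if f: "integrable lborel f" "\<And>x. 0 \<le> f x" for f \<xi>
    proof -
      have [measurable]: "f \<in> borel_measurable borel" using f by (simp add: integrable_iff_bounded)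
      have "char (density lborel (\<lambda>x. ennreal (f x / m))) \<xi> = (CLINT x|lborel. (f x / m) *\<^sub>R iexp (\<xi> * x))"
        unfolding char_def by (rule integral_density) (use f m in auto)
      also have "\<dots> = (CLINT x|lborel. complex_of_real (f x) * iexp (\<xi> * x) / complex_of_real m)"
        by (simp add: scaleR_conv_of_real)
      finally show ?thesis by simp
    qed
    have "density lborel (\<lambda>x. ennreal (p x / m)) = density lborel (\<lambda>x. ennreal (q x / m))"
    proof (intro Levy_uniqueness dist ext)
      show "char (density lborel (\<lambda>x. ennreal (p x / m))) \<xi> = char (density lborel (\<lambda>x. ennreal (q x / m))) \<xi>" for \<xi>
        unfolding ch[OF p nonneg(1)] ch[OF q nonneg(2)] eq ..
    qed (use p q nonneg m_q m_def in auto)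
    then have "AE x in lborel. ennreal (p x / m) = ennreal (q x / m)"
      by (intro sigma_finite_measure.density_unique[OF lborel.sigma_finite_measure_axioms]) auto
    then show ?thesis
    proof eventually_elim
      case (elim x)
      then have "p x / m = q x / m" using nonneg m by (subst (asm) ennreal_inj) auto
      then show ?case using m by (simp add: hpq)
    qed
  qed
qed

lemma fourier_transform_unique:
  fixes f g :: "real \<Rightarrow> real"
  assumes f: "integrable lborel f" and g: "integrable lborel g"
    and eq: "\<And>\<xi>. (CLINT x|lborel. complex_of_real (f x) * exp (- \<i> * complex_of_real (x * \<xi>)))
      = (CLINT x|lborel. complex_of_real (g x) * exp (- \<i> * complex_of_real (x * \<xi>)))"
  shows "AE x in lborel. f x = g x"
proof -
  have e: "exp (- \<i> * complex_of_real (x * - \<xi>)) = iexp (\<xi> * x)" for x \<xi> by (simp add: mult.commute)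
  have "(CLINT x|lborel. complex_of_real (f x - g x) * iexp (\<xi> * x)) = 0" for \<xi>
    using eq[of "- \<xi>"] unfolding e of_real_diff left_diff_distrib
    by (simp only: Bochner_Integration.integral_diff[OF integrable_mult_iexp[OF f] integrable_mult_iexp[OF g]] diff_self)
  then have "AE x in lborel. f x - g x = 0"
    by (intro fourier_transform_eq_0) (use f g in auto)
  then show ?thesis by simp
qed

text \<open>For \<open>t < 0\<close> the interval is empty, so the value is zero there.\<close>

definition kg_green :: "real \<Rightarrow> real \<Rightarrow> real \<Rightarrow> real \<Rightarrow> real" where
  "kg_green a m t x = exp (- a * t / 2) / 2 * kg_profile (m\<^sup>2 - a\<^sup>2 / 4) (t\<^sup>2 - x\<^sup>2) * indicator {- t..t} x"

lemma kg_green_transform: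
  fixes a m t \<xi> :: real
  assumes t: "0 \<le> t"
  shows "integrable lborel (kg_green a m t)"
    and "(CLINT x|lborel. complex_of_real (kg_green a m t x) * exp (- \<i> * complex_of_real (x * \<xi>)))
      = complex_of_real (klein_gordon_symbol a m t \<xi>)"
proof -
  let ?\<gamma> = "m\<^sup>2 - a\<^sup>2 / 4" and ?e = "exp (- a * t / 2)"
  have cont: "isCont (\<lambda>x. kg_profile ?\<gamma> (t\<^sup>2 - x\<^sup>2)) x" for x
    by (rule isCont_o2[OF _ kg_profile_isCont]) (intro continuous_intros)
  have int: "integrable lborel (\<lambda>x. kg_green a m t x * f x)" if f: "\<And>x. isCont f x" for f
  proof -
    have "integrable lborel (\<lambda>x. (?e / 2 * kg_profile ?\<gamma> (t\<^sup>2 - x\<^sup>2) * f x) * indicator {- t..t} x)"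
      by (rule integrable_cts_interval) (intro continuous_intros cont f)
    then show ?thesis by (simp add: kg_green_def mult_ac)
  qed
  show "integrable lborel (kg_green a m t)" using int[of "\<lambda>_. 1"] by simp
  have "(LINT x|lborel. kg_green a m t x * sin (x * \<xi>)) = (LINT x|lborel. kg_green a m t (- x) * sin (- x * \<xi>))"
    using lborel_integral_real_affine[of "-1" "\<lambda>x. kg_green a m t x * sin (x * \<xi>)" 0] by simp
  also have "\<dots> = - (LINT x|lborel. kg_green a m t x * sin (x * \<xi>))"
  proof -
    have "indicator {- t..t} (- x) = (indicator {- t..t} x :: real)" for x by (auto simp: indicator_def)
    then have "kg_green a m t (- x) = kg_green a m t x" for x by (simp add: kg_green_def)
    then show ?thesis by simp
  qed
  finally have sin0: "(LINT x|lborel. kg_green a m t x * sin (x * \<xi>)) = 0" by simp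
  have cosI: "(LINT x|lborel. kg_green a m t x * cos (x * \<xi>)) = klein_gordon_symbol a m t \<xi>"
  proof -
    let ?I = "LINT x|lborel. kg_profile ?\<gamma> (t\<^sup>2 - x\<^sup>2) * cos (x * \<xi>) * indicator {- t..t} x"
    have half: "?e / 2 * (2 * X) = ?e * X" for X :: real by simp
    have "(\<lambda>n. ?e / 2 * (2 * ((- 1) ^ n * (\<xi>\<^sup>2 + ?\<gamma>) ^ n * t ^ (2 * n + 1) / fact (2 * n + 1)))) sums (?e / 2 * ?I)"
      by (intro sums_mult kg_cos_transform t)
    then have "(\<lambda>n. ?e * ((- 1) ^ n * (\<xi>\<^sup>2 + ?\<gamma>) ^ n * t ^ (2 * n + 1) / fact (2 * n + 1))) sums (?e / 2 * ?I)"
      by (simp only: half)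
    then have "?e / 2 * ?I = klein_gordon_symbol a m t \<xi>"
      using kg_symbol_sums[of a t \<xi> m] by (rule sums_unique2)
    moreover have "(LINT x|lborel. kg_green a m t x * cos (x * \<xi>)) = ?e / 2 * ?I"
      unfolding kg_green_def by (subst integral_mult_right_zero[symmetric]) (simp add: mult_ac)
    ultimately show ?thesis by simp
  qed
  have ic: "integrable lborel (\<lambda>x. kg_green a m t x * cos (x * \<xi>))" by (rule int) (intro continuous_intros)
  have isn: "integrable lborel (\<lambda>x. kg_green a m t x * sin (x * \<xi>))" by (rule int) (intro continuous_intros)
  have eq: "complex_of_real (kg_green a m t x) * exp (- \<i> * complex_of_real (x * \<xi>))
      = complex_of_real (kg_green a m t x * cos (x * \<xi>)) - \<i> * complex_of_real (kg_green a m t x * sin (x * \<xi>))" for x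
    by (simp add: complex_eq_iff Re_exp Im_exp)
  have "(CLINT x|lborel. complex_of_real (kg_green a m t x) * exp (- \<i> * complex_of_real (x * \<xi>)))
     = (CLINT x|lborel. complex_of_real (kg_green a m t x * cos (x * \<xi>))) - (CLINT x|lborel. \<i> * complex_of_real (kg_green a m t x * sin (x * \<xi>)))"
    unfolding eq by (intro Bochner_Integration.integral_diff integrable_mult_right integrable_of_real ic isn)
  also have "\<dots> = complex_of_real (LINT x|lborel. kg_green a m t x * cos (x * \<xi>)) - \<i> * complex_of_real (LINT x|lborel. kg_green a m t x * sin (x * \<xi>))"
    unfolding integral_mult_right_zero integral_complex_of_real ..
  finally show "(CLINT x|lborel. complex_of_real (kg_green a m t x) * exp (- \<i> * complex_of_real (x * \<xi>)))
      = complex_of_real (klein_gordon_symbol a m t \<xi>)"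
    unfolding sin0 cosI by simp
qed

lemma fundamental_solution_eq_green:
  fixes a m t :: real
  assumes G: "klein_gordon_fundamental_solution a m G" and t: "0 \<le> t"
  shows "AE x in lborel. G t x = kg_green a m t x"
proof (rule fourier_transform_unique)
  show "integrable lborel (G t)" using G t unfolding klein_gordon_fundamental_solution_def by simp
  show "integrable lborel (kg_green a m t)" by (rule kg_green_transform[OF t])
  show "(CLINT x|lborel. complex_of_real (G t x) * exp (- \<i> * complex_of_real (x * \<xi>)))
      = (CLINT x|lborel. complex_of_real (kg_green a m t x) * exp (- \<i> * complex_of_real (x * \<xi>)))" for \<xi>
    using G t unfolding kg_green_transform(2)[OF t] klein_gordon_fundamental_solution_def by simp
qed

lemma kg_green_measurable:
  "(\<lambda>p. kg_green a m (fst p) (snd p)) \<in> borel_measurable borel"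
proof -
  have "(\<lambda>p. kg_green a m (fst p) (snd p)) =
    (\<lambda>p::real \<times> real. exp (- a * fst p / 2) / 2 * kg_profile (m\<^sup>2 - a\<^sup>2 / 4) ((fst p)\<^sup>2 - (snd p)\<^sup>2)
      * (if - fst p \<le> snd p \<and> snd p \<le> fst p then 1 else 0))"
    by (auto simp: kg_green_def indicator_def)
  then show ?thesis by (simp add: borel_prod[symmetric])
qed

lemma kg_kernel_measurable:
  fixes a m t x :: real
  shows "(\<lambda>p. if 0 \<le> fst p \<and> fst p \<le> t then kg_green a m (t - fst p) (x - snd p) else 0) \<in> borel_measurable borel"
proof -
  have [measurable]: "(\<lambda>p. kg_green a m (t - fst p) (x - snd p)) \<in> borel_measurable (borel \<Otimes>\<^sub>M borel)"
    using measurable_compose[OF _ kg_green_measurable, of "\<lambda>p. (t - fst p, x - snd p)" borel a m]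
    by (simp add: borel_prod[symmetric])
  have "(\<lambda>p. if 0 \<le> fst p \<and> fst p \<le> t then kg_green a m (t - fst p) (x - snd p) else 0) \<in> borel_measurable (borel \<Otimes>\<^sub>M borel)"
    by measurable
  then show ?thesis by (simp only: borel_prod)
qed

text \<open>The Fourier transform determines \<open>G\<close> for each single time up to a null set in space; by Fubini's theorem the exceptional set
in space-time is a null set.\<close>

lemma mild_kernel_eq_green:
  fixes a m t x :: real
  assumes G: "klein_gordon_fundamental_solution a m G"
    and f: "(\<lambda>(s, y). if 0 \<le> s \<and> s \<le> t then G (t - s) (x - y) else 0) \<in> borel_measurable borel"
  shows "AE p in lborel. (case p of (s, y) \<Rightarrow> if 0 \<le> s \<and> s \<le> t then G (t - s) (x - y) else 0)
    = (if 0 \<le> fst p \<and> fst p \<le> t then kg_green a m (t - fst p) (x - snd p) else 0)"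
proof -
  define k where "k p = (if 0 \<le> fst p \<and> fst p \<le> t then kg_green a m (t - fst p) (x - snd p) else 0)" for p
  have k: "k \<in> borel_measurable borel"
    unfolding k_def[abs_def] by (rule kg_kernel_measurable)
  let ?f = "\<lambda>(s, y). if 0 \<le> s \<and> s \<le> t then G (t - s) (x - y) else 0"
  have "AE p in lborel \<Otimes>\<^sub>M lborel. ?f p = k p"
  proof (rule lborel_pair.AE_pair_measure)
    show "{p \<in> space (lborel \<Otimes>\<^sub>M lborel). ?f p = k p} \<in> sets (lborel \<Otimes>\<^sub>M lborel)"
      unfolding lborel_prod using f k by measurable
    show "AE s in lborel. AE y in lborel. ?f (s, y) = k (s, y)"
    proof (rule AE_I2)
      fix s :: real
      show "AE y in lborel. ?f (s, y) = k (s, y)"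
      proof (cases "0 \<le> s \<and> s \<le> t")
        case True
        have Gm: "G (t - s) \<in> borel_measurable borel"
          using G True unfolding klein_gordon_fundamental_solution_def by (auto simp: integrable_iff_bounded)
        have km: "kg_green a m (t - s) \<in> borel_measurable borel"
          using kg_green_transform(1)[of "t - s" a m] True by (auto simp: integrable_iff_bounded)
        have "AE z in lborel. G (t - s) z = kg_green a m (t - s) z"
          by (rule fundamental_solution_eq_green[OF G]) (use True in simp)
        then have "AE y in lborel. G (t - s) (x + - 1 * y) = kg_green a m (t - s) (x + - 1 * y)"
          by (intro AE_borel_affine) (use Gm km in auto)
        then show ?thesis using True by (simp add: k_def)
      qed (auto simp: k_def)
    qed
  qed
  then show ?thesis by (simp only: lborel_prod k_def)
qed

section \<open>The kernel along a characteristic\<close>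

lemma exp_profile_lipschitz:
  fixes \<gamma> U V :: real
  assumes U: "0 \<le> U" and V: "0 \<le> V"
  obtains B L :: real where "0 \<le> B" "0 \<le> L"
    "\<And>u v. \<bar>u\<bar> \<le> U \<Longrightarrow> \<bar>v\<bar> \<le> V \<Longrightarrow> \<bar>exp u / 2 * kg_profile \<gamma> v\<bar> \<le> B"
    "\<And>u v u' v'. \<bar>u\<bar> \<le> U \<Longrightarrow> \<bar>v\<bar> \<le> V \<Longrightarrow> \<bar>u'\<bar> \<le> U \<Longrightarrow> \<bar>v'\<bar> \<le> V \<Longrightarrow>
      \<bar>exp u / 2 * kg_profile \<gamma> v - exp u' / 2 * kg_profile \<gamma> v'\<bar> \<le> L * (\<bar>u - u'\<bar> + \<bar>v - v'\<bar>)"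
proof -
  have bounded: "\<exists>K\<ge>0. \<forall>v\<in>{- V..V}. \<bar>f v\<bar> \<le> K" if "\<And>v. isCont f v" for f :: "real \<Rightarrow> real"
  proof -
    have "continuous_on {- V..V} f" using that by (intro continuous_at_imp_continuous_on) auto
    then have "bounded (f ` {- V..V})" by (intro compact_imp_bounded compact_continuous_image) auto
    then obtain K where "\<forall>v\<in>{- V..V}. \<bar>f v\<bar> \<le> K" by (auto simp: bounded_iff)
    then show ?thesis by (intro exI[of _ "max 0 K"]) auto
  qed
  obtain G0 where G0: "0 \<le> G0" "\<And>v. v \<in> {- V..V} \<Longrightarrow> \<bar>kg_profile \<gamma> v\<bar> \<le> G0"
    using bounded[OF kg_profile_isCont] by blast
  obtain G1 where G1: "0 \<le> G1" "\<And>v. v \<in> {- V..V} \<Longrightarrow> \<bar>kg_profile' \<gamma> v\<bar> \<le> G1"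
    using bounded[OF kg_profile'_isCont] by blast
  have lipg: "\<bar>kg_profile \<gamma> v - kg_profile \<gamma> v'\<bar> \<le> G1 * \<bar>v - v'\<bar>" if "v \<in> {- V..V}" "v' \<in> {- V..V}" for v v'
    using field_differentiable_bound[of "{- V..V}" "kg_profile \<gamma>" "kg_profile' \<gamma>" G1 v v'] that G1
      has_field_derivative_at_within[OF kg_profile_deriv] by auto
  have lipe: "\<bar>exp u - exp u'\<bar> \<le> exp U * \<bar>u - u'\<bar>" if "u \<in> {- U..U}" "u' \<in> {- U..U}" for u u' :: real
    using field_differentiable_bound[of "{- U..U}" exp exp "exp U" u u'] that
      has_field_derivative_at_within[OF DERIV_exp] by auto
  define L where "L = exp U * G0 + exp U * G1"
  show thesis
  proof (rule that[of "exp U * G0" L])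
    show "0 \<le> exp U * G0" "0 \<le> L" using G0 G1 by (auto simp: L_def)
    show "\<bar>exp u / 2 * kg_profile \<gamma> v\<bar> \<le> exp U * G0" if "\<bar>u\<bar> \<le> U" "\<bar>v\<bar> \<le> V" for u v
    proof -
      have "exp u / 2 \<le> exp U" using that by (intro order_trans[OF _ exp_le_cancel_iff[THEN iffD2, of u U]]) auto
      moreover have "\<bar>kg_profile \<gamma> v\<bar> \<le> G0" using that by (intro G0) auto
      ultimately have "exp u / 2 * \<bar>kg_profile \<gamma> v\<bar> \<le> exp U * G0" by (intro mult_mono) auto
      then show ?thesis by (simp add: abs_mult)
    qed
    fix u v u' v' :: real
    assume a: "\<bar>u\<bar> \<le> U" "\<bar>v\<bar> \<le> V" "\<bar>u'\<bar> \<le> U" "\<bar>v'\<bar> \<le> V"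
    let ?g = "kg_profile \<gamma>"
    have "exp u / 2 * ?g v - exp u' / 2 * ?g v' = (exp u - exp u') / 2 * ?g v + exp u' / 2 * (?g v - ?g v')"
      by (simp add: field_simps)
    also have "\<bar>\<dots>\<bar> \<le> \<bar>(exp u - exp u') / 2 * ?g v\<bar> + \<bar>exp u' / 2 * (?g v - ?g v')\<bar>" by (rule abs_triangle_ineq)
    also have "\<dots> \<le> exp U * \<bar>u - u'\<bar> * G0 + exp U * (G1 * \<bar>v - v'\<bar>)"
    proof (rule add_mono)
      have "\<bar>exp u - exp u'\<bar> / 2 \<le> \<bar>exp u - exp u'\<bar>" by simp
      also have "\<dots> \<le> exp U * \<bar>u - u'\<bar>" using a by (intro lipe) auto
      finally have "\<bar>exp u - exp u'\<bar> / 2 \<le> exp U * \<bar>u - u'\<bar>" .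
      moreover have "\<bar>?g v\<bar> \<le> G0" using a by (intro G0) auto
      ultimately show "\<bar>(exp u - exp u') / 2 * ?g v\<bar> \<le> exp U * \<bar>u - u'\<bar> * G0"
        unfolding abs_mult by (intro mult_mono) auto
      have "exp u' / 2 \<le> exp U" using a by (intro order_trans[OF _ exp_le_cancel_iff[THEN iffD2, of u' U]]) auto
      moreover have "\<bar>?g v - ?g v'\<bar> \<le> G1 * \<bar>v - v'\<bar>" using a by (intro lipg) auto
      ultimately show "\<bar>exp u' / 2 * (?g v - ?g v')\<bar> \<le> exp U * (G1 * \<bar>v - v'\<bar>)"
        unfolding abs_mult by (intro mult_mono) auto
    qed
    also have "\<dots> \<le> exp U * \<bar>u - u'\<bar> * G0 + exp U * (G1 * \<bar>v - v'\<bar>) + (exp U * G1 * \<bar>u - u'\<bar> + exp U * G0 * \<bar>v - v'\<bar>)"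
      using G0 G1 by auto
    also have "\<dots> = L * (\<bar>u - u'\<bar> + \<bar>v - v'\<bar>)" by (simp add: L_def algebra_simps)
    finally show "\<bar>exp u / 2 * ?g v - exp u' / 2 * ?g v'\<bar> \<le> L * (\<bar>u - u'\<bar> + \<bar>v - v'\<bar>)" .
  qed
qed

text \<open>The part of the band \<open>\<alpha> < y + s \<le> \<beta>\<close> over the times \<open>s \<in> I\<close>; space-time points are pairs \<open>(s, y)\<close> as in \<open>mild_solution\<close>.\<close>

definition strip :: "real set \<Rightarrow> real \<Rightarrow> real \<Rightarrow> (real \<times> real) set" where
  "strip I \<alpha> \<beta> = {p. fst p \<in> I \<and> \<alpha> < snd p + fst p \<and> snd p + fst p \<le> \<beta>}"

lemma strip_measurable:
  assumes "I \<in> sets borel"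
  shows "strip I \<alpha> \<beta> \<in> sets borel"
proof -
  have [measurable]: "I \<in> sets borel" by fact
  have "{p \<in> space (borel \<Otimes>\<^sub>M borel). fst p \<in> I \<and> \<alpha> < snd p + fst p \<and> snd p + fst p \<le> \<beta>} \<in> sets (borel \<Otimes>\<^sub>M (borel :: real measure))"
    by measurable
  then show ?thesis unfolding borel_prod by (simp add: strip_def)
qed

lemma strip_integral:
  fixes \<phi> :: "real \<Rightarrow> real"
  assumes \<alpha>\<beta>: "\<alpha> \<le> \<beta>" and I[measurable]: "I \<in> sets borel" and \<phi>: "integrable lborel (\<lambda>s. \<phi> s * indicator I s)"
  shows "integrable lborel (\<lambda>p. \<phi> (fst p) * indicator (strip I \<alpha> \<beta>) p)"
    and "(LINT p|lborel. \<phi> (fst p) * indicator (strip I \<alpha> \<beta>) p) = (\<beta> - \<alpha>) * (LINT s|lborel. \<phi> s * indicator I s)"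
proof -
  define \<psi> where "\<psi> s = \<phi> s * indicator I s" for s
  have \<psi>: "integrable lborel \<psi>" using \<phi> by (simp add: \<psi>_def[abs_def])
  have [measurable]: "\<psi> \<in> borel_measurable borel" using \<psi> by (simp add: integrable_iff_bounded)
  let ?F = "\<lambda>s y. \<psi> s * indicator {\<alpha> - s<..\<beta> - s} y"
  have split: "\<phi> (fst p) * indicator (strip I \<alpha> \<beta>) p = case_prod ?F p" for p
    by (auto simp: strip_def \<psi>_def indicator_def split: prod.splits)
  have "case_prod ?F = (\<lambda>p. \<psi> (fst p) * (if \<alpha> - fst p < snd p \<and> snd p \<le> \<beta> - fst p then 1 else 0))"
    by (auto simp: fun_eq_iff indicator_def)
  then have meas: "case_prod ?F \<in> borel_measurable (lborel \<Otimes>\<^sub>M lborel)" by simp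
  have inner: "(LINT y|lborel. indicator {\<alpha> - s<..\<beta> - s} y) = \<beta> - \<alpha>" for s :: real
    using \<alpha>\<beta> by simp
  have int_ind: "integrable lborel (indicator {\<alpha> - s<..\<beta> - s} :: real \<Rightarrow> real)" for s :: real
    using \<alpha>\<beta> by (intro integrable_real_indicator) simp_all
  have int: "integrable (lborel \<Otimes>\<^sub>M lborel) (case_prod ?F)"
  proof (rule lborel_pair.Fubini_integrable[OF meas])
    have "(LINT y|lborel. norm (case_prod ?F (s, y))) = \<bar>\<psi> s\<bar> * (\<beta> - \<alpha>)" for s
      using \<alpha>\<beta> by (simp add: abs_mult measure_lborel_Ioc)
    then show "integrable lborel (\<lambda>s. LINT y|lborel. norm (case_prod ?F (s, y)))"
      using \<psi> by simp
    show "AE s in lborel. integrable lborel (\<lambda>y. case_prod ?F (s, y))"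
      using int_ind by (intro AE_I2) auto
  qed
  show "integrable lborel (\<lambda>p. \<phi> (fst p) * indicator (strip I \<alpha> \<beta>) p)"
    unfolding split using int by (simp add: lborel_prod)
  have "(LINT p|lborel. case_prod ?F p) = (LINT s|lborel. LINT y|lborel. ?F s y)"
    using lborel_pair.integral_fst'[OF int] by (simp add: lborel_prod)
  also have "\<dots> = (LINT s|lborel. \<psi> s * (\<beta> - \<alpha>))" using \<alpha>\<beta> by simp
  also have "\<dots> = (\<beta> - \<alpha>) * (LINT s|lborel. \<phi> s * indicator I s)"
    by (simp add: \<psi>_def mult.commute)
  finally show "(LINT p|lborel. \<phi> (fst p) * indicator (strip I \<alpha> \<beta>) p) = (\<beta> - \<alpha>) * (LINT s|lborel. \<phi> s * indicator I s)"
    unfolding split .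
qed

lemma strip_area:
  assumes "\<alpha> \<le> \<beta>" "a \<le> b"
  shows "integrable lborel (indicator (strip {a..b} \<alpha> \<beta>) :: _ \<Rightarrow> real)"
    and "measure lborel (strip {a..b} \<alpha> \<beta>) = (\<beta> - \<alpha>) * (b - a)"
proof -
  have i: "integrable lborel (\<lambda>s. (1::real) * indicator {a..b} s)"
    using assms by (simp add: emeasure_lborel_Icc_eq)
  show "integrable lborel (indicator (strip {a..b} \<alpha> \<beta>) :: _ \<Rightarrow> real)"
    using strip_integral(1)[OF assms(1) _ i] by simp
  show "measure lborel (strip {a..b} \<alpha> \<beta>) = (\<beta> - \<alpha>) * (b - a)"
    using strip_integral(2)[OF assms(1) _ i] assms by simp
qed

text \<open>The integrand of \<open>u (t0 + h) (x0 + h)\<close>.\<close>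

definition light_kernel :: "real \<Rightarrow> real \<Rightarrow> real \<Rightarrow> real \<Rightarrow> real \<Rightarrow> real \<times> real \<Rightarrow> real" where
  "light_kernel a m t0 x0 h p =
    (if 0 \<le> fst p \<and> fst p \<le> t0 + h then kg_green a m (t0 + h - fst p) (x0 + h - snd p) else 0)"

text \<open>The same expression without the cutoff to the cone. In the light-cone coordinates
\<open>q = y - s - (x0 - t0)\<close> and \<open>r = x0 + t0 - y - s\<close>, the argument \<open>t\<^sup>2 - x\<^sup>2\<close> of \<open>kg_profile\<close> in the Green
function becomes \<open>q * (r + 2 * h)\<close>.\<close>

definition smooth_kernel :: "real \<Rightarrow> real \<Rightarrow> real \<Rightarrow> real \<Rightarrow> real \<Rightarrow> real \<times> real \<Rightarrow> real" where
  "smooth_kernel a m t0 x0 h p =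
    exp (- a * (t0 + h - fst p) / 2) / 2 *
    kg_profile (m\<^sup>2 - a\<^sup>2 / 4) ((snd p - fst p - (x0 - t0)) * (x0 + t0 + 2 * h - snd p - fst p))"

text \<open>The backward light cone of \<open>(t0 + h, x0 + h)\<close>, cut at time 0: the bound for \<open>y - s\<close> does not involve \<open>h\<close>, because the point
moves along this edge.\<close>

definition cone :: "real \<Rightarrow> real \<Rightarrow> real \<Rightarrow> (real \<times> real) set" where
  "cone t0 x0 h = {p. 0 \<le> fst p \<and> x0 - t0 + fst p \<le> snd p \<and> snd p + fst p \<le> x0 + t0 + 2 * h}"

lemma light_kernel_eq:
  "light_kernel a m t0 x0 h p = (if p \<in> cone t0 x0 h then smooth_kernel a m t0 x0 h p else 0)"
proof (cases "p \<in> cone t0 x0 h")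
  case True
  then have i: "0 \<le> fst p" "fst p \<le> t0 + h" "x0 + h - snd p \<in> {- (t0 + h - fst p)..t0 + h - fst p}"
    by (auto simp: cone_def)
  have "(t0 + h - fst p)\<^sup>2 - (x0 + h - snd p)\<^sup>2
      = (snd p - fst p - (x0 - t0)) * (x0 + t0 + 2 * h - snd p - fst p)"
    by (simp add: power2_eq_square algebra_simps)
  with i True show ?thesis
    by (simp add: light_kernel_def kg_green_def smooth_kernel_def)
next
  case False
  then have "\<not> (0 \<le> fst p \<and> x0 + h - snd p \<in> {- (t0 + h - fst p)..t0 + h - fst p})"
    by (auto simp: cone_def)
  with False show ?thesis by (auto simp: light_kernel_def kg_green_def)
qed

lemma cone_mono: "h \<le> k \<Longrightarrow> cone t0 x0 h \<subseteq> cone t0 x0 k"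
  by (auto simp: cone_def)

definition cone_box :: "real \<Rightarrow> real \<Rightarrow> (real \<times> real) set" where
  "cone_box t0 x0 = {0..t0 + 1} \<times> {x0 - t0..x0 + t0 + 2}"

lemma cone_subset_box: "h \<le> 1 \<Longrightarrow> cone t0 x0 h \<subseteq> cone_box t0 x0"
  by (auto simp: cone_def cone_box_def mem_Times_iff)

lemma cone_box_area:
  assumes "0 < t0"
  shows "cone_box t0 x0 \<in> sets borel"
    and "integrable lborel (indicator (cone_box t0 x0) :: _ \<Rightarrow> real)"
    and "measure lborel (cone_box t0 x0) = 2 * (t0 + 1)\<^sup>2"
proof -
  have box: "cone_box t0 x0 = cbox (0, x0 - t0) (t0 + 1, x0 + t0 + 2)"
    by (simp add: cone_box_def cbox_Pair_eq)
  show b: "cone_box t0 x0 \<in> sets borel" unfolding box by simp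
  have "emeasure lborel (cone_box t0 x0) < \<infinity>" unfolding box by (rule emeasure_lborel_cbox_finite)
  then show "integrable lborel (indicator (cone_box t0 x0) :: _ \<Rightarrow> real)"
    using b by simp
  have "measure lborel (cone_box t0 x0) = (t0 + 1) * (2 * t0 + 2)"
    unfolding box using assms by (simp add: content_Pair)
  then show "measure lborel (cone_box t0 x0) = 2 * (t0 + 1)\<^sup>2" by (simp add: power2_eq_square)
qed

text \<open>Both arguments of \<open>exp u / 2 * kg_profile \<gamma> v\<close> are affine in \<open>h\<close> and bounded on the box. On a strip just beyond the
edge \<open>y + s = x0 + t0\<close>, the argument \<open>v\<close> is \<open>O(h)\<close>, and \<open>kg_profile \<gamma> 0 = 1\<close> leaves the factor \<open>exp (- a (t0 - s) / 2) / 2\<close>.\<close>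

lemma smooth_kernel_lipschitz:
  fixes a m t0 x0 :: real
  assumes t0: "0 < t0"
  obtains B L :: real where "0 \<le> B" "0 \<le> L"
    "\<And>h p. 0 \<le> h \<Longrightarrow> h \<le> 1 \<Longrightarrow> p \<in> cone_box t0 x0 \<Longrightarrow> \<bar>smooth_kernel a m t0 x0 h p\<bar> \<le> B"
    "\<And>h k p. 0 \<le> k \<Longrightarrow> k \<le> h \<Longrightarrow> h \<le> 1 \<Longrightarrow> p \<in> cone_box t0 x0 \<Longrightarrow>
      \<bar>smooth_kernel a m t0 x0 h p - smooth_kernel a m t0 x0 k p\<bar> \<le> L * (h - k)"
    "\<And>h p. 0 \<le> h \<Longrightarrow> h \<le> 1 \<Longrightarrow> p \<in> cone_box t0 x0 \<Longrightarrow> x0 + t0 \<le> snd p + fst p \<Longrightarrow> snd p + fst p \<le> x0 + t0 + 2 * h \<Longrightarrow>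
      \<bar>smooth_kernel a m t0 x0 h p - exp (- a * (t0 - fst p) / 2) / 2\<bar> \<le> L * h"
proof -
  define D U V where "D = 2 * t0 + 2" and "U = \<bar>a\<bar> * (t0 + 1) / 2" and "V = D * (2 * t0 + 3)"
  have nn: "0 \<le> D" "0 \<le> U" "0 \<le> V" using t0 by (auto simp: D_def U_def V_def)
  obtain B L where B: "0 \<le> B" and L: "0 \<le> L"
    and bnd: "\<And>u v. \<bar>u\<bar> \<le> U \<Longrightarrow> \<bar>v\<bar> \<le> V \<Longrightarrow> \<bar>exp u / 2 * kg_profile (m\<^sup>2 - a\<^sup>2 / 4) v\<bar> \<le> B"
    and lip: "\<And>u v u' v'. \<bar>u\<bar> \<le> U \<Longrightarrow> \<bar>v\<bar> \<le> V \<Longrightarrow> \<bar>u'\<bar> \<le> U \<Longrightarrow> \<bar>v'\<bar> \<le> V \<Longrightarrow>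
      \<bar>exp u / 2 * kg_profile (m\<^sup>2 - a\<^sup>2 / 4) v - exp u' / 2 * kg_profile (m\<^sup>2 - a\<^sup>2 / 4) v'\<bar> \<le> L * (\<bar>u - u'\<bar> + \<bar>v - v'\<bar>)"
    using exp_profile_lipschitz[OF nn(2,3)] by metis
  define u where "u h p = - a * (t0 + h - fst p) / 2" for h and p :: "real \<times> real"
  define v where "v h p = (snd p - fst p - (x0 - t0)) * (x0 + t0 + 2 * h - snd p - fst p)" for h and p :: "real \<times> real"
  have sk: "smooth_kernel a m t0 x0 h p = exp (u h p) / 2 * kg_profile (m\<^sup>2 - a\<^sup>2 / 4) (v h p)" for h p
    by (simp add: smooth_kernel_def u_def v_def)
  have d1: "\<bar>snd p - fst p - (x0 - t0)\<bar> \<le> D" if "p \<in> cone_box t0 x0" for p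
    using that t0 by (auto simp: cone_box_def mem_Times_iff D_def abs_le_iff)
  have ub: "\<bar>u h p\<bar> \<le> U" if "p \<in> cone_box t0 x0" "0 \<le> h" "h \<le> 1" for p h
  proof -
    have "\<bar>t0 + h - fst p\<bar> \<le> t0 + 1" using that t0 by (auto simp: cone_box_def mem_Times_iff abs_le_iff)
    then have "\<bar>a\<bar> * \<bar>t0 + h - fst p\<bar> \<le> \<bar>a\<bar> * (t0 + 1)" by (intro mult_left_mono) auto
    then show ?thesis by (simp add: u_def U_def abs_mult)
  qed
  have vb: "\<bar>v h p\<bar> \<le> V" if "p \<in> cone_box t0 x0" "0 \<le> h" "h \<le> 1" for p h
  proof -
    have "\<bar>x0 + t0 + 2 * h - snd p - fst p\<bar> \<le> 2 * t0 + 3"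
      using that t0 by (auto simp: cone_box_def mem_Times_iff abs_le_iff)
    then show ?thesis unfolding v_def V_def abs_mult using d1[OF that(1)] nn by (intro mult_mono) auto
  qed
  define L' where "L' = L * (\<bar>a\<bar> / 2 + 2 * D)"
  show thesis
  proof (rule that[of B L'])
    show "0 \<le> B" "0 \<le> L'" using B L nn by (auto simp: L'_def)
    show "\<bar>smooth_kernel a m t0 x0 h p\<bar> \<le> B" if "0 \<le> h" "h \<le> 1" "p \<in> cone_box t0 x0" for h p
      unfolding sk using that by (intro bnd ub vb)
    show "\<bar>smooth_kernel a m t0 x0 h p - smooth_kernel a m t0 x0 k p\<bar> \<le> L' * (h - k)"
      if h: "0 \<le> k" "k \<le> h" "h \<le> 1" and p: "p \<in> cone_box t0 x0" for h k p
    proof -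
      have "u h p - u k p = - a / 2 * (h - k)" by (simp add: u_def field_simps)
      then have 1: "\<bar>u h p - u k p\<bar> = \<bar>a\<bar> / 2 * (h - k)" using h by (simp add: abs_mult)
      have "v h p - v k p = (snd p - fst p - (x0 - t0)) * (2 * (h - k))" by (simp add: v_def algebra_simps)
      then have "\<bar>v h p - v k p\<bar> = \<bar>snd p - fst p - (x0 - t0)\<bar> * (2 * (h - k))" using h by (simp add: abs_mult)
      also have "\<dots> \<le> D * (2 * (h - k))" using h d1[OF p] by (intro mult_right_mono) auto
      finally have 2: "\<bar>v h p - v k p\<bar> \<le> 2 * D * (h - k)" by (simp only: mult_ac)
      have "\<bar>smooth_kernel a m t0 x0 h p - smooth_kernel a m t0 x0 k p\<bar> \<le> L * (\<bar>u h p - u k p\<bar> + \<bar>v h p - v k p\<bar>)"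
        unfolding sk using h p by (intro lip ub vb) auto
      also have "\<dots> \<le> L * (\<bar>a\<bar> / 2 * (h - k) + 2 * D * (h - k))" using 1 2 L by (intro mult_left_mono) auto
      also have "\<dots> = L' * (h - k)" by (simp add: L'_def algebra_simps)
      finally show ?thesis .
    qed
    show "\<bar>smooth_kernel a m t0 x0 h p - exp (- a * (t0 - fst p) / 2) / 2\<bar> \<le> L' * h"
      if h: "0 \<le> h" "h \<le> 1" and p: "p \<in> cone_box t0 x0" and s: "x0 + t0 \<le> snd p + fst p" "snd p + fst p \<le> x0 + t0 + 2 * h" for h p
    proof -
      have 1: "\<bar>u h p - u 0 p\<bar> = \<bar>a\<bar> / 2 * h"
      proof -
        have "u h p - u 0 p = - a / 2 * h" by (simp add: u_def field_simps)
        then show ?thesis using h by (simp add: abs_mult)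
      qed
      have "\<bar>x0 + t0 + 2 * h - snd p - fst p\<bar> \<le> 2 * h" using s by (simp add: abs_le_iff)
      then have "\<bar>v h p\<bar> \<le> D * (2 * h)"
        unfolding v_def abs_mult using d1[OF p] h nn by (intro mult_mono) auto
      then have 2: "\<bar>v h p - 0\<bar> \<le> 2 * D * h" by simp
      have "exp (- a * (t0 - fst p) / 2) / 2 = exp (u 0 p) / 2 * kg_profile (m\<^sup>2 - a\<^sup>2 / 4) 0"
        by (simp add: u_def kg_profile_0)
      then have "\<bar>smooth_kernel a m t0 x0 h p - exp (- a * (t0 - fst p) / 2) / 2\<bar> \<le> L * (\<bar>u h p - u 0 p\<bar> + \<bar>v h p - 0\<bar>)"
        unfolding sk using h p nn by (simp only:) (intro lip ub vb, auto)
      also have "\<dots> \<le> L * (\<bar>a\<bar> / 2 * h + 2 * D * h)" using 1 2 L by (intro mult_left_mono) auto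
      also have "\<dots> = L' * h" by (simp add: L'_def algebra_simps)
      finally show ?thesis .
    qed
  qed
qed

lemma square_integral_two_indicators:
  fixes F :: "'a \<Rightarrow> real" and \<alpha> \<beta> :: real
  assumes F: "F \<in> borel_measurable M"
    and S: "integrable M (indicator S :: 'a \<Rightarrow> real)" and T: "integrable M (indicator T :: 'a \<Rightarrow> real)"
    and le: "\<And>p. \<bar>F p\<bar> \<le> \<alpha> * indicator S p + \<beta> * indicator T p"
  shows "square_integrable M F"
    and "(LINT p|M. (F p)\<^sup>2) \<le> 2 * \<alpha>\<^sup>2 * (LINT p|M. indicator S p) + 2 * \<beta>\<^sup>2 * (LINT p|M. indicator T p)"
proof -
  let ?g = "\<lambda>p. 2 * \<alpha>\<^sup>2 * indicator S p + 2 * \<beta>\<^sup>2 * indicator T p"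
  have sq: "(F p)\<^sup>2 \<le> ?g p" for p
  proof -
    have "(F p)\<^sup>2 \<le> (\<alpha> * indicator S p + \<beta> * indicator T p)\<^sup>2"
      using power_mono[OF le[of p], of 2] by simp
    also have "\<dots> \<le> 2 * (\<alpha> * indicator S p)\<^sup>2 + 2 * (\<beta> * indicator T p)\<^sup>2"
      using sum_squares_bound[of "\<alpha> * indicator S p" "\<beta> * indicator T p"] by (simp add: power2_sum)
    also have "\<dots> = ?g p" by (simp add: indicator_def)
    finally show ?thesis .
  qed
  have g: "integrable M ?g" using S T by (intro Bochner_Integration.integrable_add integrable_mult_right)
  have i: "integrable M (\<lambda>p. (F p)\<^sup>2)"
    by (rule Bochner_Integration.integrable_bound[OF g]) (use F sq in \<open>auto intro: order_trans[OF _ abs_ge_self]\<close>)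
  then show "square_integrable M F" using F by (simp add: square_integrable_def)
  have "(LINT p|M. (F p)\<^sup>2) \<le> (LINT p|M. ?g p)" using i g sq by (intro integral_mono)
  also have "\<dots> = 2 * \<alpha>\<^sup>2 * (LINT p|M. indicator S p) + 2 * \<beta>\<^sup>2 * (LINT p|M. indicator T p)"
    by (subst Bochner_Integration.integral_add[OF integrable_mult_right[OF S] integrable_mult_right[OF T]])
       (simp only: integral_mult_right_zero)
  finally show "(LINT p|M. (F p)\<^sup>2) \<le> 2 * \<alpha>\<^sup>2 * (LINT p|M. indicator S p) + 2 * \<beta>\<^sup>2 * (LINT p|M. indicator T p)" .
qed

lemma light_kernel_measurable: "light_kernel a m t0 x0 h \<in> borel_measurable lborel"
  using kg_kernel_measurable[of "t0 + h" a m "x0 + h"] by (simp add: light_kernel_def[abs_def])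

text \<open>The leading part of \<open>light_kernel h - light_kernel k\<close>: the wave front, with the kernel frozen at its value on the edge of the cone.
It is supported on bands that are disjoint for disjoint intervals \<open>(k, h]\<close>, and its squared norm is proportional to \<open>h - k\<close>.\<close>

definition front_profile :: "real \<Rightarrow> real \<Rightarrow> real \<Rightarrow> real \<Rightarrow> real \<Rightarrow> real \<times> real \<Rightarrow> real" where
  "front_profile a t0 x0 k h p =
    exp (- a * (t0 - fst p) / 2) / 2 * indicator (strip {0..t0} (x0 + t0 + 2 * k) (x0 + t0 + 2 * h)) p"

definition front_sd :: "real \<Rightarrow> real \<Rightarrow> real" where
  "front_sd a t0 = sqrt (2 * (LINT s|lborel. (exp (- a * (t0 - s) / 2) / 2)\<^sup>2 * indicator {0..t0} s))"

lemma front_sd_pos: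
  assumes "0 < t0"
  shows "0 < front_sd a t0"
proof -
  let ?c = "(exp (- \<bar>a\<bar> * t0 / 2) / 2)\<^sup>2"
  have "0 < ?c * t0" using assms by simp
  also have "\<dots> = (LINT s|lborel. ?c * indicator {0..t0} s)" using assms by simp
  also have "\<dots> \<le> (LINT s|lborel. (exp (- a * (t0 - s) / 2) / 2)\<^sup>2 * indicator {0..t0} s)"
  proof (rule integral_mono)
    show "integrable lborel (\<lambda>s. ?c * indicator {0..t0} s)"
      by (intro integrable_mult_right integrable_real_indicator) (auto simp: emeasure_lborel_Icc_eq)
    show "integrable lborel (\<lambda>s. (exp (- a * (t0 - s) / 2) / 2)\<^sup>2 * indicator {0..t0} s)"
      by (rule integrable_cts_interval) (intro continuous_intros, auto)
    fix s :: real
    show "?c * indicator {0..t0} s \<le> (exp (- a * (t0 - s) / 2) / 2)\<^sup>2 * indicator {0..t0} s"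
    proof (cases "s \<in> {0..t0}")
      case True
      have "a * (t0 - s) \<le> \<bar>a\<bar> * (t0 - s)" using True by (intro mult_right_mono) auto
      also have "\<dots> \<le> \<bar>a\<bar> * t0" using True by (intro mult_left_mono) auto
      finally have "exp (- \<bar>a\<bar> * t0 / 2) \<le> exp (- a * (t0 - s) / 2)" by simp
      then have "?c \<le> (exp (- a * (t0 - s) / 2) / 2)\<^sup>2" by (intro power_mono) auto
      then show ?thesis using True by simp
    qed simp
  qed
  finally show ?thesis by (simp add: front_sd_def)
qed

lemma front_profile_norm:
  assumes "0 < t0" "k \<le> h"
  shows "square_integrable lborel (front_profile a t0 x0 k h)"
    and "l2_norm lborel (front_profile a t0 x0 k h) = front_sd a t0 * sqrt (h - k)"
proof -
  let ?\<phi> = "\<lambda>s. (exp (- a * (t0 - s) / 2) / 2)\<^sup>2"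
  have i: "integrable lborel (\<lambda>s. ?\<phi> s * indicator {0..t0} s)"
    by (rule integrable_cts_interval) (intro continuous_intros, auto)
  have le: "x0 + t0 + 2 * k \<le> x0 + t0 + 2 * h" using assms by simp
  have sq: "(front_profile a t0 x0 k h p)\<^sup>2
      = ?\<phi> (fst p) * indicator (strip {0..t0} (x0 + t0 + 2 * k) (x0 + t0 + 2 * h)) p" for p
    by (simp add: front_profile_def indicator_def)
  have "front_profile a t0 x0 k h \<in> borel_measurable (borel \<Otimes>\<^sub>M borel)"
  proof -
    have [measurable]: "strip {0..t0} (x0 + t0 + 2 * k) (x0 + t0 + 2 * h) \<in> sets (borel \<Otimes>\<^sub>M borel)"
      unfolding borel_prod by (rule strip_measurable) simp
    show ?thesis unfolding front_profile_def[abs_def] by measurable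
  qed
  then have meas: "front_profile a t0 x0 k h \<in> borel_measurable lborel" by (simp add: borel_prod)
  show "square_integrable lborel (front_profile a t0 x0 k h)"
    unfolding square_integrable_def sq using meas strip_integral(1)[OF le _ i] by simp
  have "(LINT p|lborel. (front_profile a t0 x0 k h p)\<^sup>2) = 2 * (h - k) * (LINT s|lborel. ?\<phi> s * indicator {0..t0} s)"
    unfolding sq using strip_integral(2)[OF le _ i] by (simp add: algebra_simps)
  then show "l2_norm lborel (front_profile a t0 x0 k h) = front_sd a t0 * sqrt (h - k)"
    unfolding l2_norm_def front_sd_def by (simp only: real_sqrt_mult mult_ac)
qed

text \<open>A point either lies in the smaller cone, where the smooth kernel moves by \<open>O(h - k)\<close>; or in the new strip, where the kernel is
bounded and for \<open>s \<le> t0\<close> close to the front profile; or outside both. The new strip over the times after \<open>t0\<close> is a corner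
of area \<open>O(h\<^sup>2)\<close>.\<close>

lemma light_kernel_increments:
  fixes a m t0 x0 :: real
  assumes t0: "0 < t0"
  obtains B L :: real where "0 \<le> B" "0 \<le> L"
    "\<And>h k p. 0 \<le> k \<Longrightarrow> k \<le> h \<Longrightarrow> h \<le> 1 \<Longrightarrow> p \<in> cone t0 x0 k \<Longrightarrow>
      \<bar>light_kernel a m t0 x0 h p - light_kernel a m t0 x0 k p\<bar> \<le> L * (h - k)"
    "\<And>h k p. 0 \<le> k \<Longrightarrow> k \<le> h \<Longrightarrow> h \<le> 1 \<Longrightarrow>
      \<bar>light_kernel a m t0 x0 h p - light_kernel a m t0 x0 k p\<bar>
        \<le> L * (h - k) * indicator (cone_box t0 x0) p
          + B * indicator (strip {0..t0 + 1} (x0 + t0 + 2 * k) (x0 + t0 + 2 * h)) p"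
    "\<And>h k p. 0 \<le> k \<Longrightarrow> k \<le> h \<Longrightarrow> h \<le> 1 \<Longrightarrow>
      \<bar>light_kernel a m t0 x0 h p - light_kernel a m t0 x0 k p - front_profile a t0 x0 k h p\<bar>
        \<le> L * h * indicator (cone_box t0 x0) p
          + B * indicator (strip {t0..t0 + h} (x0 + t0 + 2 * k) (x0 + t0 + 2 * h)) p"
proof (rule smooth_kernel_lipschitz[OF t0, where ?x0.0 = x0 and a = a and m = m])
  fix B L :: real
  assume B: "0 \<le> B" and L: "0 \<le> L"
    and bnd: "\<And>h p. 0 \<le> h \<Longrightarrow> h \<le> 1 \<Longrightarrow> p \<in> cone_box t0 x0 \<Longrightarrow> \<bar>smooth_kernel a m t0 x0 h p\<bar> \<le> B"
    and lip: "\<And>h k p. 0 \<le> k \<Longrightarrow> k \<le> h \<Longrightarrow> h \<le> 1 \<Longrightarrow> p \<in> cone_box t0 x0 \<Longrightarrow>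
      \<bar>smooth_kernel a m t0 x0 h p - smooth_kernel a m t0 x0 k p\<bar> \<le> L * (h - k)"
    and front: "\<And>h p. 0 \<le> h \<Longrightarrow> h \<le> 1 \<Longrightarrow> p \<in> cone_box t0 x0 \<Longrightarrow> x0 + t0 \<le> snd p + fst p \<Longrightarrow> snd p + fst p \<le> x0 + t0 + 2 * h \<Longrightarrow>
      \<bar>smooth_kernel a m t0 x0 h p - exp (- a * (t0 - fst p) / 2) / 2\<bar> \<le> L * h"
  let ?f = "light_kernel a m t0 x0" and ?E = "smooth_kernel a m t0 x0" and ?R = "cone t0 x0"
  have nonneg: "0 \<le> L * c * indicator S p + B * indicator T p" if "0 \<le> c" for c and S T :: "(real \<times> real) set" and p
    using that B L by simp
  have inner: "\<bar>?f h p - ?f k p\<bar> \<le> L * (h - k)" "p \<in> cone_box t0 x0" if h: "0 \<le> k" "k \<le> h" "h \<le> 1" and p: "p \<in> ?R k" for h k p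
  proof -
    have "p \<in> ?R h" using p cone_mono[OF h(2)] by blast
    moreover show "p \<in> cone_box t0 x0" using p h cone_subset_box[of k t0 x0] by auto
    ultimately show "\<bar>?f h p - ?f k p\<bar> \<le> L * (h - k)" using lip[OF h] p by (simp add: light_kernel_eq)
  qed
  have new: "snd p + fst p > x0 + t0 + 2 * k" "snd p + fst p \<le> x0 + t0 + 2 * h" "p \<in> cone_box t0 x0" "?f h p - ?f k p = ?E h p"
      "0 \<le> fst p" "fst p \<le> t0 + h"
    if h: "0 \<le> k" "k \<le> h" "h \<le> 1" and p: "p \<notin> ?R k" "p \<in> ?R h" for h k p
  proof -
    show "snd p + fst p > x0 + t0 + 2 * k" "snd p + fst p \<le> x0 + t0 + 2 * h" "0 \<le> fst p" "fst p \<le> t0 + h"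
      using p by (auto simp: cone_def)
    show "p \<in> cone_box t0 x0" using p h cone_subset_box[of h t0 x0] by auto
    show "?f h p - ?f k p = ?E h p" using p by (simp add: light_kernel_eq)
  qed
  have outer: "?f h p - ?f k p = 0" if h: "k \<le> h" and p: "p \<notin> ?R h" for h k p
  proof -
    have "p \<notin> ?R k" using p cone_mono[OF h] by blast
    then show ?thesis using p by (simp add: light_kernel_eq)
  qed
  show thesis
  proof (rule that[OF B L])
    show "\<bar>?f h p - ?f k p\<bar> \<le> L * (h - k)" if "0 \<le> k" "k \<le> h" "h \<le> 1" "p \<in> ?R k" for h k p
      by (rule inner(1)[OF that])
    show "\<bar>?f h p - ?f k p\<bar> \<le> L * (h - k) * indicator (cone_box t0 x0) p
          + B * indicator (strip {0..t0 + 1} (x0 + t0 + 2 * k) (x0 + t0 + 2 * h)) p"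
      if h: "0 \<le> k" "k \<le> h" "h \<le> 1" for h k p
    proof -
      consider "p \<in> ?R k" | "p \<notin> ?R k" "p \<in> ?R h" | "p \<notin> ?R h" by blast
      then show ?thesis
      proof cases
        case 1
        have "0 \<le> B * indicator (strip {0..t0 + 1} (x0 + t0 + 2 * k) (x0 + t0 + 2 * h)) p" using B by simp
        with inner[OF h 1] show ?thesis by simp
      next
        case 2
        note n = new[OF h 2]
        have "p \<in> strip {0..t0 + 1} (x0 + t0 + 2 * k) (x0 + t0 + 2 * h)"
          using n h by (auto simp: strip_def)
        moreover have "\<bar>?E h p\<bar> \<le> B" using n h by (intro bnd) auto
        moreover have "0 \<le> L * (h - k)" using L h by simp
        ultimately show ?thesis using n(3,4) by simp
      next
        case 3
        show ?thesis unfolding outer[OF h(2) 3] using nonneg[of "h - k"] h by simp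
      qed
    qed
    show "\<bar>?f h p - ?f k p - front_profile a t0 x0 k h p\<bar>
        \<le> L * h * indicator (cone_box t0 x0) p
          + B * indicator (strip {t0..t0 + h} (x0 + t0 + 2 * k) (x0 + t0 + 2 * h)) p"
      if h: "0 \<le> k" "k \<le> h" "h \<le> 1" for h k p
    proof -
      consider "p \<in> ?R k" | "p \<notin> ?R k" "p \<in> ?R h" | "p \<notin> ?R h" by blast
      then show ?thesis
      proof cases
        case 1
        then have "front_profile a t0 x0 k h p = 0" by (simp add: front_profile_def strip_def cone_def)
        moreover have "0 \<le> B * indicator (strip {t0..t0 + h} (x0 + t0 + 2 * k) (x0 + t0 + 2 * h)) p" using B by simp
        moreover have "L * (h - k) \<le> L * h" using L h by (intro mult_left_mono) auto
        ultimately show ?thesis using inner[OF h 1] by simp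
      next
        case 2
        note n = new[OF h 2]
        show ?thesis
        proof (cases "fst p \<le> t0")
          case True
          then have "front_profile a t0 x0 k h p = exp (- a * (t0 - fst p) / 2) / 2"
            using n by (simp add: front_profile_def strip_def)
          moreover have "\<bar>?E h p - exp (- a * (t0 - fst p) / 2) / 2\<bar> \<le> L * h"
            using n h by (intro front) auto
          moreover have "0 \<le> B * indicator (strip {t0..t0 + h} (x0 + t0 + 2 * k) (x0 + t0 + 2 * h)) p" using B by simp
          ultimately show ?thesis using n(3,4) by simp
        next
          case False
          then have "front_profile a t0 x0 k h p = 0" by (simp add: front_profile_def strip_def)
          moreover have "p \<in> strip {t0..t0 + h} (x0 + t0 + 2 * k) (x0 + t0 + 2 * h)"
            using n False by (auto simp: strip_def)
          moreover have "\<bar>?E h p\<bar> \<le> B" using n h by (intro bnd) auto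
          moreover have "0 \<le> L * h" using L h by simp
          ultimately show ?thesis using n(3,4) by simp
        qed
      next
        case 3
        have "p \<notin> strip {0..t0} (x0 + t0 + 2 * k) (x0 + t0 + 2 * h)"
          using 3 h by (auto simp: strip_def cone_def)
        then have "front_profile a t0 x0 k h p = 0" by (simp add: front_profile_def)
        then show ?thesis unfolding outer[OF h(2) 3] using nonneg[of h] h by simp
      qed
    qed
  qed
qed

lemma light_kernel_square_integrable:
  fixes a m t0 x0 h :: real
  assumes t0: "0 < t0" and h: "0 \<le> h" "h \<le> 1"
  shows "square_integrable lborel (light_kernel a m t0 x0 h)"
proof (rule smooth_kernel_lipschitz[OF t0, where ?x0.0 = x0 and a = a and m = m])
  fix B L :: real
  assume B: "0 \<le> B" and L: "0 \<le> L"
    and bnd: "\<And>h p. 0 \<le> h \<Longrightarrow> h \<le> 1 \<Longrightarrow> p \<in> cone_box t0 x0 \<Longrightarrow> \<bar>smooth_kernel a m t0 x0 h p\<bar> \<le> B"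
    and lip: "\<And>h k p. 0 \<le> k \<Longrightarrow> k \<le> h \<Longrightarrow> h \<le> 1 \<Longrightarrow> p \<in> cone_box t0 x0 \<Longrightarrow>
      \<bar>smooth_kernel a m t0 x0 h p - smooth_kernel a m t0 x0 k p\<bar> \<le> L * (h - k)"
    and front: "\<And>h p. 0 \<le> h \<Longrightarrow> h \<le> 1 \<Longrightarrow> p \<in> cone_box t0 x0 \<Longrightarrow> x0 + t0 \<le> snd p + fst p \<Longrightarrow> snd p + fst p \<le> x0 + t0 + 2 * h \<Longrightarrow>
      \<bar>smooth_kernel a m t0 x0 h p - exp (- a * (t0 - fst p) / 2) / 2\<bar> \<le> L * h"
  show ?thesis
  proof (rule square_integral_two_indicators(1)[OF light_kernel_measurable cone_box_area(2)[OF t0] cone_box_area(2)[OF t0]])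
    show "\<bar>light_kernel a m t0 x0 h p\<bar> \<le> B * indicator (cone_box t0 x0) p + 0 * indicator (cone_box t0 x0) p" for p
      using bnd[OF h, of p] cone_subset_box[OF h(2), of t0 x0] B by (auto simp: light_kernel_eq indicator_def)
  qed
qed

text \<open>The squares of the two summands in \<open>light_kernel_increments\<close> integrate to \<open>O((h - k)\<^sup>2)\<close> and \<open>O(h - k)\<close>, which gives the
first bound; for the second bound the strip is the corner of area \<open>O(h\<^sup>2)\<close>. For disjoint intervals, the increment of the earlier interval
vanishes outside the cone on which the increment of the later interval is \<open>O(h1 - h2)\<close>, and its \<open>L\<^sup>1\<close> norm is \<open>O(h3 - h4)\<close>.\<close>

lemma light_kernel_estimates:
  fixes a m t0 x0 :: real
  assumes t0: "0 < t0"
  defines "f \<equiv> light_kernel a m t0 x0"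
  obtains C :: real where "0 < C"
    "\<And>h k. 0 \<le> k \<Longrightarrow> k \<le> h \<Longrightarrow> h \<le> 1 \<Longrightarrow> (LINT p|lborel. (f h p - f k p)\<^sup>2) \<le> C * (h - k)"
    "\<And>h k. 0 \<le> k \<Longrightarrow> k \<le> h \<Longrightarrow> h \<le> 1 \<Longrightarrow>
      \<bar>l2_norm lborel (\<lambda>p. f h p - f k p) - front_sd a t0 * sqrt (h - k)\<bar> \<le> C * h"
    "\<And>h1 h2 h3 h4. 0 \<le> h4 \<Longrightarrow> h4 \<le> h3 \<Longrightarrow> h3 \<le> h2 \<Longrightarrow> h2 \<le> h1 \<Longrightarrow> h1 \<le> 1 \<Longrightarrow>
      \<bar>LINT p|lborel. (f h1 p - f h2 p) * (f h3 p - f h4 p)\<bar> \<le> C * (h1 - h2) * (h3 - h4)"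
proof (rule light_kernel_increments[OF t0, where ?x0.0 = x0 and a = a and m = m])
  fix B L :: real
  assume B: "0 \<le> B" and L: "0 \<le> L"
    and inner': "\<And>h k p. 0 \<le> k \<Longrightarrow> k \<le> h \<Longrightarrow> h \<le> 1 \<Longrightarrow> p \<in> cone t0 x0 k \<Longrightarrow> \<bar>light_kernel a m t0 x0 h p - light_kernel a m t0 x0 k p\<bar> \<le> L * (h - k)"
    and inc': "\<And>h k p. 0 \<le> k \<Longrightarrow> k \<le> h \<Longrightarrow> h \<le> 1 \<Longrightarrow>
      \<bar>light_kernel a m t0 x0 h p - light_kernel a m t0 x0 k p\<bar> \<le> L * (h - k) * indicator (cone_box t0 x0) p
          + B * indicator (strip {0..t0 + 1} (x0 + t0 + 2 * k) (x0 + t0 + 2 * h)) p"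
    and approx': "\<And>h k p. 0 \<le> k \<Longrightarrow> k \<le> h \<Longrightarrow> h \<le> 1 \<Longrightarrow>
      \<bar>light_kernel a m t0 x0 h p - light_kernel a m t0 x0 k p - front_profile a t0 x0 k h p\<bar>
        \<le> L * h * indicator (cone_box t0 x0) p
          + B * indicator (strip {t0..t0 + h} (x0 + t0 + 2 * k) (x0 + t0 + 2 * h)) p"
  note inner = inner'[folded f_def] and inc = inc'[folded f_def] and approx = approx'[folded f_def]
  define A where "A = 2 * (t0 + 1)\<^sup>2"
  have A: "0 < A" using t0 by (simp add: A_def)
  have boxI: "integrable lborel (indicator (cone_box t0 x0) :: _ \<Rightarrow> real)" "(LINT p|lborel. indicator (cone_box t0 x0) p) = A"
    using cone_box_area[OF t0, of x0] by (simp_all add: A_def)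
  have stripI: "integrable lborel (indicator (strip {b..c} (x0 + t0 + 2 * k) (x0 + t0 + 2 * h)) :: _ \<Rightarrow> real)"
    "(LINT p|lborel. indicator (strip {b..c} (x0 + t0 + 2 * k) (x0 + t0 + 2 * h)) p) = 2 * (h - k) * (c - b)"
    if "k \<le> h" "b \<le> c" for h k b c :: real
  proof -
    have le: "x0 + t0 + 2 * k \<le> x0 + t0 + 2 * h" using that by simp
    show "integrable lborel (indicator (strip {b..c} (x0 + t0 + 2 * k) (x0 + t0 + 2 * h)) :: _ \<Rightarrow> real)"
      by (rule strip_area(1)[OF le that(2)])
    show "(LINT p|lborel. indicator (strip {b..c} (x0 + t0 + 2 * k) (x0 + t0 + 2 * h)) p) = 2 * (h - k) * (c - b)"
      using strip_area(2)[OF le that(2)] by (simp add: algebra_simps)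
  qed
  have sf: "square_integrable lborel (f h)" if "0 \<le> h" "h \<le> 1" for h
    unfolding f_def by (rule light_kernel_square_integrable[OF t0 that])
  have sd: "square_integrable lborel (\<lambda>p. f h p - f k p)" if "0 \<le> h" "h \<le> 1" "0 \<le> k" "k \<le> 1" for h k
    by (intro square_integrable_diff sf that)
  have meas: "(\<lambda>p. f h p - f k p) \<in> borel_measurable lborel" for h k
    unfolding f_def using light_kernel_measurable by (intro borel_measurable_diff)
  define C1 where "C1 = 2 * L\<^sup>2 * A + 4 * B\<^sup>2 * (t0 + 1)"
  define C2 where "C2 = sqrt (2 * L\<^sup>2 * A + 4 * B\<^sup>2)"
  define C3 where "C3 = L * (L * A + 2 * B * (t0 + 1))"
  define C where "C = 1 + C1 + C2 + C3"
  have nn: "0 \<le> C1" "0 \<le> C2" "0 \<le> C3" using A B L t0 by (simp_all add: C1_def C2_def C3_def)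
  show thesis
  proof (rule that[of C])
    show "0 < C" using nn by (simp add: C_def)
    show "(LINT p|lborel. (f h p - f k p)\<^sup>2) \<le> C * (h - k)" if h: "0 \<le> k" "k \<le> h" "h \<le> 1" for h k
    proof -
      have le: "0 \<le> t0 + 1" using t0 by simp
      have "(LINT p|lborel. (f h p - f k p)\<^sup>2) \<le> 2 * (L * (h - k))\<^sup>2 * A + 2 * B\<^sup>2 * (2 * (h - k) * (t0 + 1 - 0))"
        using square_integral_two_indicators(2)[OF meas boxI(1) stripI(1)[OF h(2) le] inc[OF h]]
        unfolding boxI(2) stripI(2)[OF h(2) le] .
      also have "\<dots> = 2 * L\<^sup>2 * A * ((h - k) * (h - k)) + 4 * B\<^sup>2 * (t0 + 1) * (h - k)"
        by (simp add: power_mult_distrib power2_eq_square)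
      also have "\<dots> \<le> 2 * L\<^sup>2 * A * (1 * (h - k)) + 4 * B\<^sup>2 * (t0 + 1) * (h - k)"
        using h A by (intro add_right_mono mult_left_mono mult_right_mono) auto
      also have "\<dots> = C1 * (h - k)" by (simp add: C1_def algebra_simps)
      also have "\<dots> \<le> C * (h - k)" using nn h by (intro mult_right_mono) (auto simp: C_def)
      finally show ?thesis .
    qed
    show "\<bar>l2_norm lborel (\<lambda>p. f h p - f k p) - front_sd a t0 * sqrt (h - k)\<bar> \<le> C * h"
      if h: "0 \<le> k" "k \<le> h" "h \<le> 1" for h k
    proof -
      have le: "t0 \<le> t0 + h" using h by simp
      note fp = front_profile_norm[OF t0 h(2), of a x0]
      have m: "(\<lambda>p. f h p - f k p - front_profile a t0 x0 k h p) \<in> borel_measurable lborel"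
        using fp(1) by (intro borel_measurable_diff[OF meas]) (simp add: square_integrable_def)
      have "(LINT p|lborel. (f h p - f k p - front_profile a t0 x0 k h p)\<^sup>2)
          \<le> 2 * (L * h)\<^sup>2 * A + 2 * B\<^sup>2 * (2 * (h - k) * (t0 + h - t0))"
        using square_integral_two_indicators(2)[OF m boxI(1) stripI(1)[OF h(2) le] approx[OF h]]
        unfolding boxI(2) stripI(2)[OF h(2) le] .
      also have "\<dots> = 2 * L\<^sup>2 * A * h\<^sup>2 + 4 * B\<^sup>2 * ((h - k) * h)"
        by (simp add: power_mult_distrib)
      also have "\<dots> \<le> 2 * L\<^sup>2 * A * h\<^sup>2 + 4 * B\<^sup>2 * (h * h)"
        using h by (intro add_left_mono mult_left_mono mult_right_mono) auto
      also have "\<dots> = (C2 * h)\<^sup>2"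
        using A by (simp add: C2_def power_mult_distrib power2_eq_square[of h] algebra_simps)
      finally have "l2_norm lborel (\<lambda>p. f h p - f k p - front_profile a t0 x0 k h p) \<le> C2 * h"
        unfolding l2_norm_def using nn h by (intro real_le_lsqrt) auto
      moreover have "\<bar>l2_norm lborel (\<lambda>p. f h p - f k p) - l2_norm lborel (front_profile a t0 x0 k h)\<bar>
          \<le> l2_norm lborel (\<lambda>p. f h p - f k p - front_profile a t0 x0 k h p)"
        using h by (intro l2_norm_diff_le sd fp(1)) auto
      moreover have "C2 * h \<le> C * h" using nn h by (intro mult_right_mono) (auto simp: C_def)
      ultimately show ?thesis unfolding fp(2) by linarith
    qed
    show "\<bar>LINT p|lborel. (f h1 p - f h2 p) * (f h3 p - f h4 p)\<bar> \<le> C * (h1 - h2) * (h3 - h4)"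
      if h: "0 \<le> h4" "h4 \<le> h3" "h3 \<le> h2" "h2 \<le> h1" "h1 \<le> 1" for h1 h2 h3 h4
    proof -
      have le: "0 \<le> t0 + 1" using t0 by simp
      have h34: "0 \<le> h4" "h4 \<le> h3" "h3 \<le> 1" and h12: "0 \<le> h2" "h2 \<le> h1" "h1 \<le> 1" using h by auto
      let ?g = "\<lambda>p. L * (h1 - h2) * (L * (h3 - h4) * indicator (cone_box t0 x0) p
          + B * indicator (strip {0..t0 + 1} (x0 + t0 + 2 * h4) (x0 + t0 + 2 * h3)) p)"
      have pw: "\<bar>(f h1 p - f h2 p) * (f h3 p - f h4 p)\<bar> \<le> ?g p" for p
      proof (cases "p \<in> cone t0 x0 h3")
        case True
        then have "p \<in> cone t0 x0 h2" using cone_mono[OF h(3)] by blast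
        then show ?thesis
          unfolding abs_mult using inner[OF h12] inc[OF h34] L h by (intro mult_mono) auto
      next
        case False
        then have "p \<notin> cone t0 x0 h4" using cone_mono[OF h(2)] by blast
        then have "f h3 p - f h4 p = 0" using False by (simp add: f_def light_kernel_eq)
        moreover have "0 \<le> ?g p" using L B h by simp
        ultimately show ?thesis by simp
      qed
      have ig: "integrable lborel ?g"
        by (intro integrable_mult_right Bochner_Integration.integrable_add boxI stripI le h)
      have i: "integrable lborel (\<lambda>p. (f h1 p - f h2 p) * (f h3 p - f h4 p))"
        using h by (intro square_integrable_mult sd) auto
      have "\<bar>LINT p|lborel. (f h1 p - f h2 p) * (f h3 p - f h4 p)\<bar> \<le> (LINT p|lborel. \<bar>(f h1 p - f h2 p) * (f h3 p - f h4 p)\<bar>)"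
        by (rule integral_abs_bound)
      also have "\<dots> \<le> (LINT p|lborel. ?g p)"
        by (intro integral_mono integrable_abs i ig pw)
      also have "\<dots> = L * (h1 - h2) * (L * (h3 - h4) * A + B * (2 * (h3 - h4) * (t0 + 1 - 0)))"
        unfolding integral_mult_right_zero
        by (subst Bochner_Integration.integral_add[OF integrable_mult_right[OF boxI(1)] integrable_mult_right[OF stripI(1)[OF h(2) le]]])
           (simp only: integral_mult_right_zero boxI(2) stripI(2)[OF h(2) le])
      also have "\<dots> = C3 * (h1 - h2) * (h3 - h4)" by (simp add: C3_def algebra_simps)
      also have "\<dots> \<le> C * (h1 - h2) * (h3 - h4)" using nn h by (intro mult_right_mono) (auto simp: C_def)
      finally show ?thesis .
    qed
  qed
qed

section \<open>The mild solution\<close>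

lemma mild_solution_light_kernel:
  fixes a m t0 x0 h :: real
  assumes G: "klein_gordon_fundamental_solution a m G" and u: "mild_solution M W G u"
    and t: "0 \<le> t0 + h"
  shows "has_walsh_integral M W (light_kernel a m t0 x0 h) (u (t0 + h) (x0 + h))"
proof -
  let ?f = "\<lambda>(s, y). if 0 \<le> s \<and> s \<le> t0 + h then G (t0 + h - s) (x0 + h - y) else 0"
  have w: "has_walsh_integral M W ?f (u (t0 + h) (x0 + h))"
    using u t unfolding mild_solution_def by (elim allE impE)
  then have "?f \<in> borel_measurable borel" unfolding has_walsh_integral_def by (elim conjE)
  then have "AE p in lborel. ?f p = light_kernel a m t0 x0 h p"
    unfolding light_kernel_def by (rule mild_kernel_eq_green[OF G])
  then show ?thesis
    by (rule walsh_integral_cong_AE[OF w]) (use light_kernel_measurable in simp)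
qed

lemma walsh_increments_law:
  fixes f :: "real \<Rightarrow> real \<times> real \<Rightarrow> real" and X :: "real \<Rightarrow> 'w \<Rightarrow> real" and s t :: real
  assumes M: "prob_space M" and W: "white_noise M W"
    and X: "\<And>h. h \<in> {h1, h2, h3, h4} \<Longrightarrow> has_walsh_integral M W (f h) (X h)"
  shows "gaussian_law M (\<lambda>\<omega>. s * (X h1 \<omega> - X h2 \<omega>) + t * (X h3 \<omega> - X h4 \<omega>))
    (s\<^sup>2 * (LINT p|lborel. (f h1 p - f h2 p) * (f h1 p - f h2 p))
      + 2 * s * t * (LINT p|lborel. (f h1 p - f h2 p) * (f h3 p - f h4 p))
      + t\<^sup>2 * (LINT p|lborel. (f h3 p - f h4 p) * (f h3 p - f h4 p)))"
proof -
  interpret prob_space M by (rule M)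
  have diff: "has_walsh_integral M W (\<lambda>p. f h p - f k p) (\<lambda>\<omega>. X h \<omega> - X k \<omega>)"
    if "h \<in> {h1, h2, h3, h4}" "k \<in> {h1, h2, h3, h4}" for h k
    using walsh_integral_lincomb[OF W X[OF that(1)] X[OF that(2)], of 1 "-1"] by simp
  have d12: "has_walsh_integral M W (\<lambda>p. f h1 p - f h2 p) (\<lambda>\<omega>. X h1 \<omega> - X h2 \<omega>)"
    and d34: "has_walsh_integral M W (\<lambda>p. f h3 p - f h4 p) (\<lambda>\<omega>. X h3 \<omega> - X h4 \<omega>)"
    by (rule diff; simp)+
  note walsh_integral_law(2)[OF W walsh_integral_lincomb[OF W d12 d34, of s t]]
  then show ?thesis
    unfolding square_integrable_lincomb(2)[OF walsh_integral_law(1)[OF W d12] walsh_integral_law(1)[OF W d34]]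
    by (simp only: power2_eq_square)
qed

theorem theorem1p1:
  fixes a m t0 x0 :: real
    and M :: "'w measure"
    and W :: "(real \<times> real) set \<Rightarrow> 'w \<Rightarrow> real"
    and G :: "real \<Rightarrow> real \<Rightarrow> real"
    and u :: "real \<Rightarrow> real \<Rightarrow> 'w \<Rightarrow> real"
  assumes "prob_space M" and "complete_measure M"
    and "white_noise M W"
    and "klein_gordon_fundamental_solution a m G"
    and "mild_solution M W G u"
    and "ae_continuous_paths M u"
    and "t0 > 0"
  shows "\<exists>K1::real. 0 < K1 \<and>
    (AE \<omega> in M.
      Limsup (at_right 0)
        (\<lambda>h. ereal (\<bar>u (t0 + h) (x0 + h) \<omega> - u t0 x0 \<omega>\<bar> / sqrt (h * ln (ln (1 / h)))))
      = ereal K1)"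
proof (rule light_kernel_estimates[OF \<open>t0 > 0\<close>, where ?x0.0 = x0 and a = a and m = m])
  let ?f = "light_kernel a m t0 x0"
  fix C :: real
  assume C: "0 < C"
    and var: "\<And>h k. 0 \<le> k \<Longrightarrow> k \<le> h \<Longrightarrow> h \<le> 1 \<Longrightarrow> (LINT p|lborel. (?f h p - ?f k p)\<^sup>2) \<le> C * (h - k)"
    and sd: "\<And>h k. 0 \<le> k \<Longrightarrow> k \<le> h \<Longrightarrow> h \<le> 1 \<Longrightarrow>
      \<bar>l2_norm lborel (\<lambda>p. ?f h p - ?f k p) - front_sd a t0 * sqrt (h - k)\<bar> \<le> C * h"
    and cov: "\<And>h1 h2 h3 h4. 0 \<le> h4 \<Longrightarrow> h4 \<le> h3 \<Longrightarrow> h3 \<le> h2 \<Longrightarrow> h2 \<le> h1 \<Longrightarrow> h1 \<le> 1 \<Longrightarrow>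
      \<bar>LINT p|lborel. (?f h1 p - ?f h2 p) * (?f h3 p - ?f h4 p)\<bar> \<le> C * (h1 - h2) * (h3 - h4)"
  define X where "X h \<omega> = u (t0 + h) (x0 + h) \<omega>" for h \<omega>
  define c where "c h1 h2 h3 h4 = (LINT p|lborel. (?f h1 p - ?f h2 p) * (?f h3 p - ?f h4 p))" for h1 h2 h3 h4
  have walsh: "has_walsh_integral M W (?f h) (X h)" if "0 \<le> h" for h
    unfolding X_def[abs_def]
    by (rule mild_solution_light_kernel[OF assms(4,5)]) (use that \<open>t0 > 0\<close> in simp)
  have sigma: "0 < front_sd a t0" by (rule front_sd_pos[OF \<open>t0 > 0\<close>])
  have paths: "AE \<omega> in M. continuous_on {0..1} (\<lambda>h. X h \<omega>)"
    using assms(6) unfolding ae_continuous_paths_def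
  proof eventually_elim
    case (elim \<omega>)
    have "continuous_on {0..1} (\<lambda>h. (\<lambda>(t, x). u t x \<omega>) (t0 + h, x0 + h))"
      by (rule continuous_on_compose2[OF elim]) (use \<open>t0 > 0\<close> in \<open>auto intro!: continuous_intros\<close>)
    then show ?case by (simp add: X_def)
  qed
  interpret near_brownian_increments M X c "front_sd a t0" C
  proof (intro near_brownian_increments.intro near_brownian_increments_axioms.intro assms(1) paths sigma C)
    fix h1 h2 h3 h4 s t :: real
    assume "{h1, h2, h3, h4} \<subseteq> {0..1}"
    then show "gaussian_law M (\<lambda>\<omega>. s * (X h1 \<omega> - X h2 \<omega>) + t * (X h3 \<omega> - X h4 \<omega>))
        (s\<^sup>2 * c h1 h2 h1 h2 + 2 * s * t * c h1 h2 h3 h4 + t\<^sup>2 * c h3 h4 h3 h4)"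
      unfolding c_def by (intro walsh_increments_law[OF assms(1,3)] walsh) auto
  next
    fix h k :: real assume hk: "0 \<le> k" "k \<le> h" "h \<le> 1"
    show "c h k h k \<le> C * (h - k)"
      using var[OF hk] by (simp add: c_def power2_eq_square)
    show "\<bar>sqrt (c h k h k) - front_sd a t0 * sqrt (h - k)\<bar> \<le> C * h"
      using sd[OF hk] by (simp add: c_def l2_norm_def power2_eq_square)
  next
    fix h1 h2 h3 h4 :: real
    assume "0 \<le> h4" "h4 \<le> h3" "h3 \<le> h2" "h2 \<le> h1" "h1 \<le> 1"
    then show "\<bar>c h1 h2 h3 h4\<bar> \<le> C * (h1 - h2) * (h3 - h4)"
      unfolding c_def by (rule cov)
  qed
  show ?thesis
    using law_of_iterated_logarithm sigma
    by (intro exI[of _ "sqrt 2 * front_sd a t0"]) (simp add: X_def lil_gauge_def)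
qed

end
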